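(* (1) For every discrete split oscillator group $\mathrm{Osc}^r(B,l)$, the numbers $r$ and $T:=\operatorname{tr}(B)$ depend only on the isomorphism class of the group $\mathrm{Osc}^r(B,l)$. (2) Let $\mathcal G$ be the set of isomorphism classes of discrete split oscillator groups, and for integers $r\ge 1$, $T\ge 3$ let $\mathcal G_{r,T}\subset\mathcal G$ be the set of isomorphism classes of those with the given $r$ and $T$. Then $$\mathcal G=\coprod_{r=1}^\infty\ \coprod_{T=3}^\infty \mathcal G_{r,T},$$ and the map $\mathbf B_T\times(\mathbb Z/r\mathbb Z)^2\ni(B,l)\mapsto \mathrm{Osc}^r(B,l)$ induces a bijection $$\big(\mathbb Z_2\times(\mathrm{GL}(2,\mathbb Z)\ltimes\mathbb Z^2)\big)\backslash\big(\mathbf B_T\times(\mathbb Z/r\mathbb Z)^2\big)\longrightarrow \mathcal G_{r,T}.$$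
   Context: For an integer $r\ge1$ let $H^r(\mathbb Z)=\langle \alpha,\beta,\gamma\mid \alpha\beta\alpha^{-1}\beta^{-1}=\gamma^r,\ \alpha\gamma=\gamma\alpha,\ \beta\gamma=\gamma\beta\rangle$. A discrete Heisenberg group is a group isomorphic to some $H^r(\mathbb Z)$. Let $\mathbf B=\{B\in\mathrm{SL}(2,\mathbb Z)\mid \operatorname{tr}B>2\}$ and $\mathbf B_T=\{B\in\mathbf B\mid\operatorname{tr}B=T\}$ for $T\ge 3$. A discrete split oscillator group is a semidirect product $H_d\rtimes_\phi\mathbb Z\cdot\delta$ of a discrete Heisenberg group $H_d$ with an infinite cyclic group generated by $\delta$, with respect to a homomorphism $\phi:\mathbb Z\cdot\delta\to\mathrm{Aut}(H_d)$ for which the map induced by $\phi(\delta)$ on $H_d/Z(H_d)\cong\mathbb Z^2$ is conjugate in $\mathrm{GL}(2,\mathbb R)$ to an element of $\mathrm{SO}^+(1,1)\setminus\{I_2\}$ (equivalently, it belongs to $\mathbf B$). For $B=\begin{pmatrix}a&b\\c&d\end{pmatrix}\in\mathbf B$ and $l=(l_1,l_2)\in(\mathbb Z/r\mathbb Z)^2$, define $\mathrm{Osc}^r(B,l):=H^r(\mathbb Z)\rtimes_\phi\mathbb Z\cdot\delta$, where $\phi(\delta)(\alpha)=\alpha^a\beta^c\gamma^{-l_2}$, $\phi(\delta)(\beta)=\alpha^b\beta^d\gamma^{l_1}$, $\phi(\delta)(\gamma)=\gamma$ (in these formulas an integer representative of $l$ is used; up to isomorphism the group does not depend on the representative). Every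 discrete split oscillator group is isomorphic to some $\mathrm{Osc}^r(B,l)$. The group $\mathbb Z_2\times(\mathrm{GL}(2,\mathbb Z)\ltimes\mathbb Z^2)$, with $\mathbb Z_2=\{\pm1\}$ and where $(K,m)=(K,0)(I_2,m)$ in $\mathrm{GL}(2,\mathbb Z)\ltimes\mathbb Z^2$, acts on $\mathbf B_T\times(\mathbb Z/r\mathbb Z)^2$ by $$(K,m)\cdot(B,l)=\big(KBK^{-1},\,K(l-(I_2-B^{-1})m)\big),\qquad \kappa\cdot(B,l)=(B^{-1},-Bl)\ \text{ for }\kappa=-1\in\mathbb Z_2.$$ *)

theory Defs
  imports "HOL-Analysis.Analysis" "HOL-Algebra.Elementary_Groups"
    "HOL-Algebra.Group_Action" "HOL-Algebra.Sym_Groups" "HOL-Number_Theory.Cong"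
begin

section \<open>Groups given by generators and relations\<close>

text \<open>The letter \<open>(x, True)\<close> stands for the generator \<open>x\<close> and \<open>(x, False)\<close> for its formal inverse.
  A pair \<open>(u, v)\<close> of words in \<open>R\<close> is the relation \<open>u = v\<close>.\<close>

type_synonym 'g word = "('g \<times> bool) list"

inductive pres_eq :: "('g word \<times> 'g word) set \<Rightarrow> 'g word \<Rightarrow> 'g word \<Rightarrow> bool"
  for R where
  refl: "pres_eq R u u"
| sym: "pres_eq R u v \<Longrightarrow> pres_eq R v u"
| trans: "pres_eq R u v \<Longrightarrow> pres_eq R v w \<Longrightarrow> pres_eq R u w"
| cancel: "pres_eq R (a @ [(x, s), (x, \<not> s)] @ b) (a @ b)"
| rel: "(u, v) \<in> R \<Longrightarrow> pres_eq R (a @ u @ b) (a @ v @ b)"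

definition pres_class :: "('g word \<times> 'g word) set \<Rightarrow> 'g word \<Rightarrow> 'g word set" where
  "pres_class R u = {v. pres_eq R u v}"

definition presented_group :: "('g word \<times> 'g word) set \<Rightarrow> ('g word set) monoid" where
  "presented_group R =
     \<lparr>carrier = range (pres_class R),
      mult = (\<lambda>X Y. \<Union>u\<in>X. \<Union>v\<in>Y. pres_class R (u @ v)),
      one = pres_class R []\<rparr>"


section \<open>Discrete Heisenberg groups\<close>

datatype heis_gen = Alpha | Beta | Gamma

definition heis_rels :: "nat \<Rightarrow> (heis_gen word \<times> heis_gen word) set" where
  "heis_rels r =
     {([(Alpha, True), (Beta, True), (Alpha, False), (Beta, False)], replicate r (Gamma, True)),
      ([(Alpha, True), (Gamma, True)], [(Gamma, True), (Alpha, True)]),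
      ([(Beta, True), (Gamma, True)], [(Gamma, True), (Beta, True)])}"

definition Heis :: "nat \<Rightarrow> (heis_gen word set) monoid" where
  "Heis r = presented_group (heis_rels r)"

definition heis_elem :: "nat \<Rightarrow> heis_gen \<Rightarrow> heis_gen word set" where
  "heis_elem r x = pres_class (heis_rels r) [(x, True)]"

definition discrete_heisenberg_group :: "'h monoid \<Rightarrow> bool" where
  "discrete_heisenberg_group H \<longleftrightarrow> group H \<and> (\<exists>r\<ge>1. H \<cong> Heis r)"


section \<open>Discrete split oscillator groups\<close>

text \<open>In \<open>semidirect H K \<phi>\<close> the element \<open>(h, k)\<close> is the product \<open>h k\<close>, and
  \<open>k h k\<inverse> = \<phi> k h\<close>.\<close>

definition semidirect ::
    "('h, 'm) monoid_scheme \<Rightarrow> ('k, 'n) monoid_scheme \<Rightarrow> ('k \<Rightarrow> 'h \<Rightarrow> 'h) \<Rightarrow> ('h \<times> 'k) monoid" where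
  "semidirect H K \<phi> =
     \<lparr>carrier = carrier H \<times> carrier K,
      mult = (\<lambda>(h, k) (h', k'). (h \<otimes>\<^bsub>H\<^esub> \<phi> k h', k \<otimes>\<^bsub>K\<^esub> k')),
      one = (\<one>\<^bsub>H\<^esub>, \<one>\<^bsub>K\<^esub>)\<rparr>"

definition group_center :: "('h, 'm) monoid_scheme \<Rightarrow> 'h set" where
  "group_center H = {z \<in> carrier H. \<forall>h\<in>carrier H. z \<otimes>\<^bsub>H\<^esub> h = h \<otimes>\<^bsub>H\<^esub> z}"

text \<open>The identity component of \<open>SO(1,1)\<close>: the condition on the first entry singles it out
  among the two components of \<open>SO(1,1)\<close>.\<close>

definition minkowski :: "real^2^2" where
  "minkowski = vector [vector [1, 0], vector [0, -1]]"

definition SO_plus_1_1 :: "(real^2^2) set" where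
  "SO_plus_1_1 = {S. transpose S ** minkowski ** S = minkowski \<and> det S = 1 \<and> S $ 1 $ 1 > 0}"

text \<open>For an automorphism \<open>f\<close> of \<open>H\<close>, the induced map on the cosets of the centre sends \<open>X\<close> to
  \<open>f ` X\<close>. Its matrix \<open>B\<close> is taken with respect to some identification \<open>\<psi>\<close> of \<open>H / Z(H)\<close> with
  \<open>\<int>\<^sup>2\<close>; the condition does not depend on \<open>\<psi>\<close>, since a different choice conjugates \<open>B\<close> in
  \<open>GL(2,\<int>)\<close>.\<close>

definition hyperbolic_on_central_quotient :: "('h, 'm) monoid_scheme \<Rightarrow> ('h \<Rightarrow> 'h) \<Rightarrow> bool" where
  "hyperbolic_on_central_quotient H f \<longleftrightarrow>
     (\<exists>(\<psi> :: 'h set \<Rightarrow> int \<times> int) (B :: int^2^2).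
        \<psi> \<in> iso (H Mod group_center H) (integer_group \<times>\<times> integer_group) \<and>
        (\<forall>X \<in> carrier (H Mod group_center H). \<forall>x y. \<psi> X = (x, y) \<longrightarrow>
           \<psi> (f ` X) = (B $ 1 $ 1 * x + B $ 1 $ 2 * y, B $ 2 $ 1 * x + B $ 2 $ 2 * y)) \<and>
        (\<exists>P :: real^2^2. invertible P \<and>
           P ** map_matrix real_of_int B ** matrix_inv P \<in> SO_plus_1_1 - {mat 1}))"

text \<open>The infinite cyclic group \<open>\<int>\<cdot>\<delta>\<close> is \<open>integer_group\<close> with \<open>\<delta> = 1\<close>.\<close>

definition discrete_split_oscillator_group :: "('h \<times> int) monoid \<Rightarrow> bool" where
  "discrete_split_oscillator_group G \<longleftrightarrow>
     (\<exists>(H :: 'h monoid) \<phi>.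
        discrete_heisenberg_group H \<and>
        \<phi> \<in> hom integer_group (AutoGroup H) \<and>
        hyperbolic_on_central_quotient H (\<phi> 1) \<and>
        G = semidirect H integer_group \<phi>)"

definition SL2_trace_gt2 :: "(int^2^2) set" where
  "SL2_trace_gt2 = {B. det B = 1 \<and> trace B > 2}"

definition SL2_trace :: "int \<Rightarrow> (int^2^2) set" where
  "SL2_trace T = {B \<in> SL2_trace_gt2. trace B = T}"

text \<open>Elements of \<open>auto H\<close> are extensional, so an automorphism is determined by its values on
  the generators. Here \<open>l\<close> is an integer representative of an element of \<open>(\<int>/r\<int>)\<^sup>2\<close>.\<close>

definition osc_aut :: "nat \<Rightarrow> int^2^2 \<Rightarrow> int^2 \<Rightarrow> heis_gen word set \<Rightarrow> heis_gen word set" where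
  "osc_aut r B l =
     (let H = Heis r; \<alpha> = heis_elem r Alpha; \<beta> = heis_elem r Beta; \<gamma> = heis_elem r Gamma in
      THE f. f \<in> auto H \<and>
        f \<alpha> = \<alpha> [^]\<^bsub>H\<^esub> (B $ 1 $ 1) \<otimes>\<^bsub>H\<^esub> \<beta> [^]\<^bsub>H\<^esub> (B $ 2 $ 1) \<otimes>\<^bsub>H\<^esub> \<gamma> [^]\<^bsub>H\<^esub> (- (l $ 2)) \<and>
        f \<beta> = \<alpha> [^]\<^bsub>H\<^esub> (B $ 1 $ 2) \<otimes>\<^bsub>H\<^esub> \<beta> [^]\<^bsub>H\<^esub> (B $ 2 $ 2) \<otimes>\<^bsub>H\<^esub> \<gamma> [^]\<^bsub>H\<^esub> (l $ 1) \<and>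
        f \<gamma> = \<gamma>)"

definition Osc :: "nat \<Rightarrow> int^2^2 \<Rightarrow> int^2 \<Rightarrow> (heis_gen word set \<times> int) monoid" where
  "Osc r B l = semidirect (Heis r) integer_group (\<lambda>n. osc_aut r B l [^]\<^bsub>AutoGroup (Heis r)\<^esub> n)"


section \<open>Isomorphism classes\<close>

text \<open>All groups considered here are countably infinite, so each of them has an isomorphic copy
  with underlying set in \<open>nat\<close>. The isomorphism class of \<open>G\<close> is represented by the set of these
  copies, and a discrete Heisenberg group may be taken with elements in \<open>nat\<close>.\<close>

definition iso_class :: "'a monoid \<Rightarrow> nat monoid set" where
  "iso_class G = {X. group X \<and> X \<cong> G}"

definition osc_classes :: "nat monoid set set" where
  "osc_classes = {iso_class G | G :: (nat \<times> int) monoid. discrete_split_oscillator_group G}"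

definition osc_classes_rT :: "nat \<Rightarrow> int \<Rightarrow> nat monoid set set" where
  "osc_classes_rT r T =
     {C \<in> osc_classes. \<exists>B\<in>SL2_trace_gt2. \<exists>l. C = iso_class (Osc r B l) \<and> trace B = T}"


section \<open>The group action\<close>

text \<open>\<open>(\<int>/r\<int>)\<^sup>2\<close> as \<open>\<int>\<^sup>2 / r\<int>\<^sup>2\<close>. An affine bijection of \<open>\<int>\<^sup>2\<close> maps residue classes to residue
  classes, so it acts on \<open>(\<int>/r\<int>)\<^sup>2\<close> by taking images.\<close>

definition residue_class :: "nat \<Rightarrow> int^2 \<Rightarrow> (int^2) set" where
  "residue_class r l = {l'. \<forall>i. [l' $ i = l $ i] (mod int r)}"

definition residue_plane :: "nat \<Rightarrow> (int^2) set set" where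
  "residue_plane r = range (residue_class r)"

text \<open>\<open>GL(2,\<int>) \<ltimes> \<int>\<^sup>2\<close>, with the convention \<open>(K, m) = (K, 0) (I, m)\<close>. This gives
  \<open>(K, m) (K', m') = (K, 0) (K', 0) (I, K'\<inverse> m) (I, m')\<close>.\<close>

definition GL2_Z2 :: "((int^2^2) \<times> (int^2)) monoid" where
  "GL2_Z2 =
     \<lparr>carrier = {K. invertible K} \<times> UNIV,
      mult = (\<lambda>(K, m) (K', m'). (K ** K', matrix_inv K' *v m + m')),
      one = (mat 1, 0)\<rparr>"

abbreviation acting_group :: "(int \<times> ((int^2^2) \<times> (int^2))) monoid" where
  "acting_group \<equiv> sign_img \<times>\<times> GL2_Z2"

definition aff_act :: "(int^2^2) \<times> (int^2) \<Rightarrow> (int^2^2) \<times> (int^2) set \<Rightarrow> (int^2^2) \<times> (int^2) set" where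
  "aff_act = (\<lambda>(K, m) (B, L).
     (K ** B ** matrix_inv K, (\<lambda>l. K *v (l - (mat 1 - matrix_inv B) *v m)) ` L))"

definition sign_act :: "int \<Rightarrow> (int^2^2) \<times> (int^2) set \<Rightarrow> (int^2^2) \<times> (int^2) set" where
  "sign_act \<kappa> = (\<lambda>(B, L). if \<kappa> = -1 then (matrix_inv B, (\<lambda>l. - (B *v l)) ` L) else (B, L))"

text \<open>The restriction makes the maps extensional, as the library's group actions require.\<close>

definition osc_act ::
    "nat \<Rightarrow> int \<Rightarrow> int \<times> ((int^2^2) \<times> (int^2)) \<Rightarrow> (int^2^2) \<times> (int^2) set \<Rightarrow> (int^2^2) \<times> (int^2) set" where
  "osc_act r T = (\<lambda>(\<kappa>, g). \<lambda>x \<in> SL2_trace T \<times> residue_plane r. sign_act \<kappa> (aff_act g x))"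


subsection \<open>It is a group action\<close>

lemma minv:
  fixes K :: "int^2^2"
  assumes "invertible K"
  shows "K ** matrix_inv K = mat 1" "matrix_inv K ** K = mat 1"
  using assms someI_ex[of "\<lambda>A'. K ** A' = mat 1 \<and> A' ** K = mat 1"]
  unfolding invertible_def matrix_inv_def by auto

lemma minv_unique:
  fixes K :: "int^2^2"
  assumes "K ** A = mat 1" "A ** K = mat 1"
  shows "matrix_inv K = A"
proof -
  have K: "invertible K" using assms unfolding invertible_def by blast
  have "matrix_inv K = matrix_inv K ** (K ** A)" using assms by simp
  also have "\<dots> = A" by (simp add: matrix_mul_assoc minv[OF K])
  finally show ?thesis .
qed

lemma invertible_minv: "invertible (K :: int^2^2) \<Longrightarrow> invertible (matrix_inv K)"
  using minv unfolding invertible_def by blast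

lemma minv_minv: "invertible (K :: int^2^2) \<Longrightarrow> matrix_inv (matrix_inv K) = K"
  by (rule minv_unique) (auto simp: minv)

lemma minv_mult:
  fixes K K' :: "int^2^2"
  assumes "invertible K" "invertible K'"
  shows "invertible (K ** K')" "matrix_inv (K ** K') = matrix_inv K' ** matrix_inv K"
proof -
  have a: "K ** K' ** (matrix_inv K' ** matrix_inv K) = mat 1"
    by (metis assms matrix_mul_assoc matrix_mul_rid minv(1))
  have b: "matrix_inv K' ** matrix_inv K ** (K ** K') = mat 1"
    by (metis assms matrix_mul_assoc matrix_mul_rid minv(2))
  show "invertible (K ** K')" using a b unfolding invertible_def by blast
  show "matrix_inv (K ** K') = matrix_inv K' ** matrix_inv K" by (rule minv_unique[OF a b])
qed

lemma minv_1: "matrix_inv (mat 1 :: int^2^2) = mat 1"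
  by (rule minv_unique) auto

lemma SL2_minv:
  fixes B :: "int^2^2" assumes "det B = 1"
  shows "invertible B" "det (matrix_inv B) = 1" "trace (matrix_inv B) = trace B"
proof -
  define A :: "int^2^2" where "A = vector [vector [B$2$2, - B$1$2], vector [- B$2$1, B$1$1]]"
  have d: "B$1$1 * B$2$2 - B$1$2 * B$2$1 = 1" using assms by (simp add: det_2)
  have 1: "B ** A = mat 1" "A ** B = mat 1"
    using d by (auto simp: A_def vec_eq_iff matrix_matrix_mult_def mat_def forall_2 sum_2 algebra_simps)
  then show "invertible B" unfolding invertible_def by blast
  have "matrix_inv B = A" by (rule minv_unique[OF 1])
  then show "det (matrix_inv B) = 1" "trace (matrix_inv B) = trace B"
    using d by (simp_all add: A_def det_2 trace_def sum_2 algebra_simps)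
qed

lemma conj_SL2:
  fixes B K :: "int^2^2" assumes "invertible K"
  shows "det (K ** B ** matrix_inv K) = det B" "trace (K ** B ** matrix_inv K) = trace B"
proof -
  have "det K * det (matrix_inv K) = 1"
    by (metis assms minv(1) det_mul det_I)
  then show "det (K ** B ** matrix_inv K) = det B"
    by (simp add: det_mul algebra_simps)
  have "trace (K ** B ** matrix_inv K) = trace (matrix_inv K ** (K ** B))"
    by (rule trace_mul_sym)
  then show "trace (K ** B ** matrix_inv K) = trace B"
    by (simp add: matrix_mul_assoc minv assms)
qed

lemma residue_class_alt: "residue_class r l = range (\<lambda>d. l + int r *s d)"
proof (intro equalityI subsetI)
  fix x assume "x \<in> residue_class r l"
  then have "\<forall>i. \<exists>k. x $ i = l $ i + int r * k"
    unfolding residue_class_def mem_Collect_eq using cong_sym cong_iff_lin by meson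
  then obtain k where "\<And>i. x $ i = l $ i + int r * k i" by metis
  then have "x = l + int r *s (\<chi> i. k i)" by (simp add: vec_eq_iff)
  then show "x \<in> range (\<lambda>d. l + int r *s d)" by blast
next
  fix x assume "x \<in> range (\<lambda>d. l + int r *s d)"
  then show "x \<in> residue_class r l"
    by (auto simp: residue_class_def cong_def)
qed

lemma mv_scale: "A *v (k *s x) = k *s (A *v (x :: int^2))" for A :: "int^2^2"
  by (simp add: vec_eq_iff matrix_vector_mult_def sum_2 algebra_simps)

lemma mv_minus: "A *v (- x) = - (A *v (x :: int^2))" for A :: "int^2^2"
  by (simp add: vec_eq_iff matrix_vector_mult_def sum_2 algebra_simps)

lemma affine_residue:
  fixes A :: "int^2^2"
  assumes A: "invertible A" and f: "\<And>l. f l = A *v l + c" and L: "L \<in> residue_plane r"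
  shows "f ` L \<in> residue_plane r"
proof -
  obtain l where l: "L = residue_class r l" using L by (auto simp: residue_plane_def)
  have "f ` L = (\<lambda>d. f l + int r *s (A *v d)) ` UNIV"
    unfolding l residue_class_alt image_image f
    by (simp add: matrix_vector_right_distrib mv_scale ac_simps)
  also have "\<dots> = (\<lambda>d. f l + int r *s d) ` range (\<lambda>d. A *v d)" by (simp add: image_image)
  also have "range (\<lambda>d. A *v d) = UNIV"
    by (rule surjI[where f = "\<lambda>d. matrix_inv A *v d"])
      (simp only: matrix_vector_mul_assoc minv[OF A] matrix_vector_mul_lid)
  finally have "f ` L = residue_class r (f l)" by (simp only: residue_class_alt)
  then show ?thesis unfolding residue_plane_def by (rule ssubst) (rule rangeI)
qed

lemma inv_mat1: "invertible (mat 1 :: int^2^2)"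
  unfolding invertible_def by (rule exI[of _ "mat 1"]) simp

lemma group_GL2_Z2: "group GL2_Z2"
proof (rule groupI)
  fix x assume "x \<in> carrier GL2_Z2"
  then obtain K m where x: "x = (K, m)" and K: "invertible K" by (auto simp: GL2_Z2_def)
  have "(matrix_inv K, - (K *v m)) \<otimes>\<^bsub>GL2_Z2\<^esub> x = \<one>\<^bsub>GL2_Z2\<^esub>"
    using K by (simp add: GL2_Z2_def x minv mv_minus matrix_vector_mul_assoc)
  moreover have "(matrix_inv K, - (K *v m)) \<in> carrier GL2_Z2"
    by (simp add: GL2_Z2_def invertible_minv K)
  ultimately show "\<exists>y\<in>carrier GL2_Z2. y \<otimes>\<^bsub>GL2_Z2\<^esub> x = \<one>\<^bsub>GL2_Z2\<^esub>" by blast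
next
  fix x y assume "x \<in> carrier GL2_Z2" "y \<in> carrier GL2_Z2"
  then show "x \<otimes>\<^bsub>GL2_Z2\<^esub> y \<in> carrier GL2_Z2" by (auto simp: GL2_Z2_def minv_mult)
next
  show "\<one>\<^bsub>GL2_Z2\<^esub> \<in> carrier GL2_Z2" by (simp add: GL2_Z2_def inv_mat1)
next
  fix x assume "x \<in> carrier GL2_Z2"
  then show "\<one>\<^bsub>GL2_Z2\<^esub> \<otimes>\<^bsub>GL2_Z2\<^esub> x = x" by (auto simp: GL2_Z2_def)
next
  fix x y z assume "x \<in> carrier GL2_Z2" "y \<in> carrier GL2_Z2" "z \<in> carrier GL2_Z2"
  then show "x \<otimes>\<^bsub>GL2_Z2\<^esub> y \<otimes>\<^bsub>GL2_Z2\<^esub> z = x \<otimes>\<^bsub>GL2_Z2\<^esub> (y \<otimes>\<^bsub>GL2_Z2\<^esub> z)"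
    by (auto simp: GL2_Z2_def minv_mult matrix_mul_assoc matrix_vector_right_distrib
        matrix_vector_mul_assoc add.assoc)
qed

lemma aff_act_mult:
  assumes "g \<in> carrier GL2_Z2" "g' \<in> carrier GL2_Z2" "invertible (fst x)"
  shows "aff_act (g \<otimes>\<^bsub>GL2_Z2\<^esub> g') x = aff_act g (aff_act g' x)"
proof -
  obtain K m where g: "g = (K, m)" and K: "invertible K" using assms by (auto simp: GL2_Z2_def)
  obtain K' m' where g': "g' = (K', m')" and K': "invertible K'" using assms by (auto simp: GL2_Z2_def)
  obtain B L where x: "x = (B, L)" and B: "invertible B" using assms by (cases x) auto
  have inv: "matrix_inv (K' ** B ** matrix_inv K') = K' ** matrix_inv B ** matrix_inv K'"
    using B K' by (simp add: minv_mult invertible_minv minv_minv matrix_mul_assoc)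
  have c: "K *v (K' *v v) = (K ** K') *v v" for v by (simp add: matrix_vector_mul_assoc)
  have d: "K' ** matrix_inv K' = mat 1" by (rule minv[OF K'])
  have "(K ** K') *v (l - (mat 1 - matrix_inv B) *v (matrix_inv K' *v m + m'))
      = K *v (K' *v (l - (mat 1 - matrix_inv B) *v m') - (mat 1 - K' ** matrix_inv B ** matrix_inv K') *v m)"
    for l
  proof -
    have "K' *v ((mat 1 - matrix_inv B) *v (matrix_inv K' *v m)) = (mat 1 - K' ** matrix_inv B ** matrix_inv K') *v m"
      unfolding matrix_vector_mult_diff_rdistrib matrix_vector_mult_diff_distrib
      using d by (simp add: matrix_vector_mul_assoc matrix_mul_assoc)
    then show ?thesis
      by (simp add: c[symmetric] matrix_vector_mult_diff_distrib matrix_vector_right_distrib)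
  qed
  then show ?thesis
    using K K' B by (simp add: aff_act_def GL2_Z2_def g g' x inv image_image minv_mult matrix_mul_assoc)
qed

lemma aff_act_closed:
  assumes "g \<in> carrier GL2_Z2" "x \<in> SL2_trace T \<times> residue_plane r"
  shows "aff_act g x \<in> SL2_trace T \<times> residue_plane r"
proof -
  obtain K m where g: "g = (K, m)" and K: "invertible K" using assms by (auto simp: GL2_Z2_def)
  obtain B L where x: "x = (B, L)" and B: "B \<in> SL2_trace T" and L: "L \<in> residue_plane r"
    using assms by auto
  have "(\<lambda>l. K *v (l - (mat 1 - matrix_inv B) *v m)) ` L \<in> residue_plane r"
    by (rule affine_residue[OF K _ L, where c = "- (K *v ((mat 1 - matrix_inv B) *v m))"])
      (simp add: matrix_vector_mult_diff_distrib)
  then show ?thesis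
    using B K by (simp add: aff_act_def g x SL2_trace_def SL2_trace_gt2_def conj_SL2)
qed

lemma sign_act_closed:
  assumes "k \<in> carrier sign_img" "x \<in> SL2_trace T \<times> residue_plane r"
  shows "sign_act k x \<in> SL2_trace T \<times> residue_plane r"
proof -
  obtain B L where x: "x = (B, L)" and B: "B \<in> SL2_trace T" and L: "L \<in> residue_plane r"
    using assms by auto
  have 1: "(-B) ** (- matrix_inv B) = mat 1" "(- matrix_inv B) ** (-B) = mat 1"
    using minv[OF SL2_minv(1), of B] B
    by (simp_all add: SL2_trace_def SL2_trace_gt2_def vec_eq_iff matrix_matrix_mult_def)
  then have "invertible (-B)" unfolding invertible_def by blast
  then have "(\<lambda>l. - (B *v l)) ` L \<in> residue_plane r"
    by (rule affine_residue[OF _ _ L, where c = 0])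
      (simp add: vec_eq_iff matrix_vector_mult_def sum_2)
  then show ?thesis
    using B L by (simp add: sign_act_def x SL2_trace_def SL2_trace_gt2_def SL2_minv)
qed

lemma sign_aff_commute:
  assumes "g \<in> carrier GL2_Z2" "invertible (fst x)"
  shows "sign_act k (aff_act g x) = aff_act g (sign_act k x)"
proof -
  obtain K m where g: "g = (K, m)" and K: "invertible K" using assms by (auto simp: GL2_Z2_def)
  obtain B L where x: "x = (B, L)" and B: "invertible B" using assms by (cases x) auto
  have inv: "matrix_inv (K ** B ** matrix_inv K) = K ** matrix_inv B ** matrix_inv K"
    using B K by (simp add: minv_mult invertible_minv minv_minv matrix_mul_assoc)
  have "- (K ** B ** matrix_inv K *v (K *v (l - (mat 1 - matrix_inv B) *v m))) 
     = K *v (- (B *v l) - (mat 1 - B) *v m)" for l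
  proof -
    have "K ** B ** matrix_inv K *v (K *v v) = K *v (B *v v)" for v
      by (metis K matrix_mul_assoc matrix_mul_rid matrix_vector_mul_assoc minv(2))
    moreover have "B *v ((mat 1 - matrix_inv B) *v m) = (B - mat 1) *v m"
      using minv(1)[OF B] by (simp add: matrix_vector_mult_diff_rdistrib matrix_vector_mult_diff_distrib
         matrix_vector_mul_assoc)
    ultimately show ?thesis
      by (simp add: matrix_vector_mult_diff_distrib matrix_vector_mult_diff_rdistrib mv_minus)
  qed
  then show ?thesis
    using B by (simp add: sign_act_def aff_act_def g x inv image_image minv_minv)
qed

lemma sign_act_mult:
  assumes "k \<in> carrier sign_img" "k' \<in> carrier sign_img" "invertible (fst x)"
  shows "sign_act (k * k') x = sign_act k (sign_act k' x)"
  using assms by (cases x) (auto simp: sign_act_def sign_img_def image_image minv_minv mv_minus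
     matrix_vector_mul_assoc minv)

lemma osc_group_action: "group_action acting_group (SL2_trace T \<times> residue_plane r) (osc_act r T)"
proof -
  define E where "E = SL2_trace T \<times> residue_plane r"
  have G: "group acting_group" by (simp add: DirProd_group sign_img_is_group group_GL2_Z2)
  interpret G: group acting_group by (rule G)
  have inv: "invertible (fst x)" if "x \<in> E" for x
    using that by (auto simp: E_def SL2_trace_def SL2_trace_gt2_def SL2_minv)
  have osc: "osc_act r T (k, h) y = sign_act k (aff_act h y)" if "y \<in> E" for k h y
    using that by (simp only: osc_act_def E_def case_prod_conv restrict_apply if_True)
  have closed: "osc_act r T g x \<in> E" if "g \<in> carrier acting_group" "x \<in> E" for g x
    using that by (auto simp: osc_act_def E_def simp del: mem_Sigma_iff mem_Times_iff
       intro!: sign_act_closed aff_act_closed split: prod.splits)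
  have mult: "osc_act r T (g \<otimes>\<^bsub>acting_group\<^esub> g') x = osc_act r T g (osc_act r T g' x)"
    if gg': "g \<in> carrier acting_group" "g' \<in> carrier acting_group" and x: "x \<in> E" for g g' x
  proof -
    obtain k h where g: "g = (k, h)" and k: "k \<in> carrier sign_img" and h: "h \<in> carrier GL2_Z2" 
      using gg' by (auto simp: DirProd_def)
    obtain k' h' where g': "g' = (k', h')" and k': "k' \<in> carrier sign_img" and h': "h' \<in> carrier GL2_Z2" 
      using gg' by (auto simp: DirProd_def)
    have 1: "aff_act h' x \<in> E" using aff_act_closed[OF h' x[unfolded E_def]] by (simp only: E_def)
    have 2: "sign_act k' (aff_act h' x) \<in> E" using sign_act_closed[OF k' 1[unfolded E_def]] by (simp only: E_def)
    have 3: "aff_act h (aff_act h' x) \<in> E" using aff_act_closed[OF h 1[unfolded E_def]] by (simp only: E_def)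
    have "osc_act r T (g \<otimes>\<^bsub>acting_group\<^esub> g') x = sign_act (k * k') (aff_act (h \<otimes>\<^bsub>GL2_Z2\<^esub> h') x)"
      by (simp only: g g' mult_DirProd osc[OF x]) (simp add: sign_img_def)
    also have "\<dots> = sign_act k (sign_act k' (aff_act h (aff_act h' x)))"
      by (simp add: aff_act_mult h h' inv x sign_act_mult k k' 3)
    also have "\<dots> = sign_act k (aff_act h (sign_act k' (aff_act h' x)))"
      by (simp add: sign_aff_commute h inv 1)
    also have "\<dots> = osc_act r T g (osc_act r T g' x)"
      by (simp only: g g' osc[OF x] osc[OF 2])
    finally show ?thesis .
  qed
  have one: "osc_act r T \<one>\<^bsub>acting_group\<^esub> x = x" if "x \<in> E" for x
    using that by (cases x) (auto simp: osc_act_def E_def sign_img_def GL2_Z2_def aff_act_def sign_act_def minv_1)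
  have bij: "osc_act r T g \<in> Bij E" if g: "g \<in> carrier acting_group" for g
  proof -
    have i: "inv\<^bsub>acting_group\<^esub> g \<in> carrier acting_group" using g by (rule G.inv_closed)
    have "bij_betw (osc_act r T g) E E"
      by (rule bij_betwI[where g = "osc_act r T (inv\<^bsub>acting_group\<^esub> g)"])
        (auto simp: closed g i mult[symmetric] one simp del: carrier_DirProd mult_DirProd one_DirProd)
    moreover have "osc_act r T g \<in> extensional E"
      by (cases g) (simp add: osc_act_def E_def)
    ultimately show ?thesis by (simp add: Bij_def)
  qed
  have "osc_act r T \<in> hom acting_group (BijGroup E)"
  proof (rule homI)
    fix g g' assume g: "g \<in> carrier acting_group" "g' \<in> carrier acting_group"
    have "osc_act r T (g \<otimes>\<^bsub>acting_group\<^esub> g') = compose E (osc_act r T g) (osc_act r T g')"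
    proof (rule extensionalityI[where A = E])
      show "osc_act r T (g \<otimes>\<^bsub>acting_group\<^esub> g') \<in> extensional E"
        using bij[OF G.m_closed[OF g]] by (simp add: Bij_def)
    qed (simp_all add: compose_def mult[OF g] del: mult_DirProd)
    then show "osc_act r T (g \<otimes>\<^bsub>acting_group\<^esub> g') = osc_act r T g \<otimes>\<^bsub>BijGroup E\<^esub> osc_act r T g'"
      using bij g by (simp add: BijGroup_def)
  qed (simp add: BijGroup_def bij)
  then show ?thesis
    unfolding E_def by (intro group_action.intro group_hom.intro group_hom_axioms.intro G group_BijGroup)
qed

end

theory Submission
  imports Defs
begin


text \<open>A split oscillator group is the extension of a Heisenberg group \<open>H\<close> by an infinite cyclic group
that is determined by one automorphism \<open>f\<close> of \<open>H\<close>. Three ideas carry the classification.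

The subgroup \<open>H\<close> can be recovered from the extension: some power of \<open>\<gamma>\<close> is a commutator and \<open>f\<close>
has no eigenvalue \<open>1\<close> on \<open>H / Z(H)\<close>, so every homomorphism to \<open>\<int>\<close> vanishes on \<open>H\<close>
(\<open>heis_extension_hom_int\<close>), and \<open>H\<close> is the common kernel of these homomorphisms. Hence an isomorphism
between two extensions restricts to an isomorphism \<open>\<theta>\<close> of the Heisenberg groups, and it sends the
generator \<open>\<delta>\<close> to \<open>k \<delta>\<^sup>e\<close> with \<open>e = \<plusminus>1\<close>. The extensions are isomorphic if and only if some
\<open>\<theta>\<close> conjugates \<open>f\<close> into \<open>f'\<^sup>e\<close> up to an inner automorphism (\<open>cyclic_extension_isoI\<close>, \<open>cyclic_extension_isoD\<close>). So
the extensions are classified by the conjugacy class of \<open>f\<close> in the outer automorphism group, up to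
inversion.

The outer automorphism group is computable. In the coordinates \<open>\<alpha>\<^sup>x \<beta>\<^sup>y \<gamma>\<^sup>z\<close> the group is
\<open>\<int>\<^sup>2 \<times> \<int>\<close> with a cocycle that is divisible by \<open>r\<close>, so modulo \<open>r\<close> the last coordinate is additive. An
automorphism therefore has a symbol \<open>(K, m)\<close>, where \<open>K\<close> in \<open>GL(2,\<int>)\<close> is the induced map on
\<open>\<int>\<^sup>2\<close> and \<open>m\<close>, taken modulo \<open>r\<close>, records the last coordinate. Every pair is a symbol
(\<open>has_symbol_exists\<close>), symbols multiply as in \<open>GL(2,\<int>) \<ltimes> \<int>\<^sup>2\<close> (\<open>has_symbol_compose\<close>), and
automorphisms with the same symbol differ by an inner one (\<open>same_symbol_conj\<close>). The automorphism that
defines \<open>Osc r B l\<close> has symbol \<open>(B, l)\<close>. The action of \<open>(K, m)\<close> on \<open>(B, l)\<close> is conjugation of symbols,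
and the sign \<open>-1\<close> acts by inversion, so orbits are isomorphism classes (\<open>Osc_iso_iff\<close>,
\<open>mem_orbit_iff_iso\<close>). The number \<open>r\<close> is already an invariant of \<open>H\<close> (\<open>heis_iso_matrix\<close>), and
the trace is constant under conjugation and inversion in \<open>SL(2,\<int>)\<close>.

Finally, the abstract definition produces exactly these groups: the matrix \<open>K\<close> of \<open>f\<close> is conjugate over
the reals to a nontrivial element of the identity component of \<open>SO(1,1)\<close> if and only if it has
determinant \<open>1\<close> and trace greater than \<open>2\<close> (\<open>conj_boost_iff\<close>, \<open>heis_hyperbolic_iff\<close>).\<close>

section \<open>Extensions by an infinite cyclic group\<close>

text \<open>The algebraic mapping torus of \<open>f\<close>.\<close>

definition cyclic_extension :: "('h, 'm) monoid_scheme \<Rightarrow> ('h \<Rightarrow> 'h) \<Rightarrow> ('h \<times> int) monoid" where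
  "cyclic_extension H f = semidirect H integer_group (\<lambda>n. f [^]\<^bsub>AutoGroup H\<^esub> n)"

lemma carrier_AutoGroup [simp]: "carrier (AutoGroup H) = auto H"
  by (simp add: AutoGroup_def)

lemma auto_closed: "f \<in> auto H \<Longrightarrow> x \<in> carrier H \<Longrightarrow> f x \<in> carrier H"
  by (auto simp: auto_def hom_def)

lemma auto_hom: "f \<in> auto H \<Longrightarrow> f \<in> hom H H"
  by (simp add: auto_def)

lemma auto_bij: "f \<in> auto H \<Longrightarrow> bij_betw f (carrier H) (carrier H)"
  by (simp add: auto_def Bij_def)

lemma auto_iso: "f \<in> auto H \<Longrightarrow> f \<in> iso H H"
  by (simp add: auto_hom auto_bij iso_def)

lemma auto_mult:
  "f \<in> auto H \<Longrightarrow> x \<in> carrier H \<Longrightarrow> y \<in> carrier H \<Longrightarrow> f (x \<otimes>\<^bsub>H\<^esub> y) = f x \<otimes>\<^bsub>H\<^esub> f y"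
  by (auto simp: auto_def hom_def)

lemma auto_eqI:
  "f \<in> auto H \<Longrightarrow> g \<in> auto H \<Longrightarrow> (\<And>x. x \<in> carrier H \<Longrightarrow> f x = g x) \<Longrightarrow> f = g"
  by (auto simp: auto_def Bij_def intro: extensionalityI)

lemma AutoGroup_mult_apply:
  "f \<in> auto H \<Longrightarrow> g \<in> auto H \<Longrightarrow> x \<in> carrier H \<Longrightarrow> (f \<otimes>\<^bsub>AutoGroup H\<^esub> g) x = f (g x)"
  by (simp add: AutoGroup_def BijGroup_def auto_def compose_def)

lemma AutoGroup_one_apply: "x \<in> carrier H \<Longrightarrow> \<one>\<^bsub>AutoGroup H\<^esub> x = x"
  by (simp add: AutoGroup_def BijGroup_def)

lemma AutoGroup_inv_apply:
  assumes "group H" "f \<in> auto H" "x \<in> carrier H"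
  shows "f ((inv\<^bsub>AutoGroup H\<^esub> f) x) = x" "(inv\<^bsub>AutoGroup H\<^esub> f) (f x) = x"
proof -
  interpret A: group "AutoGroup H" by (rule group.AutoGroup[OF assms(1)])
  have i: "inv\<^bsub>AutoGroup H\<^esub> f \<in> auto H" using A.inv_closed[of f] assms by simp
  show "f ((inv\<^bsub>AutoGroup H\<^esub> f) x) = x"
    using A.r_inv[of f] assms i
    by (metis AutoGroup_mult_apply AutoGroup_one_apply carrier_AutoGroup)
  show "(inv\<^bsub>AutoGroup H\<^esub> f) (f x) = x"
    using A.l_inv[of f] assms i
    by (metis AutoGroup_mult_apply AutoGroup_one_apply carrier_AutoGroup)
qed

lemma restrict_iso_auto: "f \<in> iso H H \<Longrightarrow> group H \<Longrightarrow> restrict f (carrier H) \<in> auto H"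
  by (auto simp: auto_def Bij_def iso_def hom_def group.is_monoid monoid.m_closed
      cong: bij_betw_cong)

text \<open>The witness is \<open>\<theta> f \<theta>\<inverse>\<close>, cut off outside the carrier because elements of \<open>auto\<close> are extensional.\<close>

lemma conj_auto:
  assumes "group H" "group H'" "\<theta> \<in> iso H H'" "f \<in> auto H"
  obtains f' where "f' \<in> auto H'" "\<And>x. x \<in> carrier H \<Longrightarrow> \<theta> (f x) = f' (\<theta> x)"
proof
  let ?f = "\<theta> \<circ> (f \<circ> inv_into (carrier H) \<theta>)"
  have "?f \<in> iso H' H'"
    using assms auto_iso[OF assms(4)] group.iso_set_sym[OF assms(1,3)]
    by (meson Group.iso_set_trans iso_set_trans)
  then show "restrict ?f (carrier H') \<in> auto H'" by (rule restrict_iso_auto[OF _ assms(2)])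
  fix x assume x: "x \<in> carrier H"
  have "inj_on \<theta> (carrier H)" "\<theta> x \<in> carrier H'"
    using assms(3) x by (auto simp: iso_def bij_betw_def hom_def)
  then show "\<theta> (f x) = restrict ?f (carrier H') (\<theta> x)" using x by simp
qed

lemma semidirect_simps [simp]:
  "carrier (semidirect H K \<phi>) = carrier H \<times> carrier K"
  "(h, k) \<otimes>\<^bsub>semidirect H K \<phi>\<^esub> (h', k') = (h \<otimes>\<^bsub>H\<^esub> \<phi> k h', k \<otimes>\<^bsub>K\<^esub> k')"
  "\<one>\<^bsub>semidirect H K \<phi>\<^esub> = (\<one>\<^bsub>H\<^esub>, \<one>\<^bsub>K\<^esub>)"
  by (simp_all add: semidirect_def)

lemma group_semidirect:
  assumes "group H" "group K" "\<phi> \<in> hom K (AutoGroup H)"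
  shows "group (semidirect H K \<phi>)"
proof -
  interpret H: group H by fact
  interpret K: group K by fact
  interpret A: group "AutoGroup H" by (rule H.AutoGroup)
  interpret \<phi>: group_hom K "AutoGroup H" \<phi>
    by (intro group_hom.intro group_hom_axioms.intro assms K.group_axioms A.group_axioms)
  have au: "\<phi> k \<in> auto H" if "k \<in> carrier K" for k using \<phi>.hom_closed[OF that] by simp
  have cl: "\<phi> k h \<in> carrier H" if "k \<in> carrier K" "h \<in> carrier H" for k h
    using au[OF that(1)] that(2) by (rule auto_closed)
  have mu: "\<phi> (k \<otimes>\<^bsub>K\<^esub> k') h = \<phi> k (\<phi> k' h)" if "k \<in> carrier K" "k' \<in> carrier K" "h \<in> carrier H" for k k' h
    using that au by (simp add: AutoGroup_mult_apply)
  have on: "\<phi> \<one>\<^bsub>K\<^esub> h = h" if "h \<in> carrier H" for h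
    using that by (simp add: AutoGroup_one_apply)
  show ?thesis
  proof (rule groupI)
    fix x assume "x \<in> carrier (semidirect H K \<phi>)"
    then obtain h k where x: "x = (h, k)" "h \<in> carrier H" "k \<in> carrier K" by auto
    show "\<exists>y\<in>carrier (semidirect H K \<phi>). y \<otimes>\<^bsub>semidirect H K \<phi>\<^esub> x = \<one>\<^bsub>semidirect H K \<phi>\<^esub>"
    proof
      let ?y = "(\<phi> (inv\<^bsub>K\<^esub> k) (inv\<^bsub>H\<^esub> h), inv\<^bsub>K\<^esub> k)"
      show "?y \<in> carrier (semidirect H K \<phi>)" using x by (simp add: cl del: \<phi>.hom_inv)
      have "\<phi> (inv\<^bsub>K\<^esub> k) (inv\<^bsub>H\<^esub> h) \<otimes>\<^bsub>H\<^esub> \<phi> (inv\<^bsub>K\<^esub> k) h = \<phi> (inv\<^bsub>K\<^esub> k) (inv\<^bsub>H\<^esub> h \<otimes>\<^bsub>H\<^esub> h)"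
        using x auto_mult[OF au[of "inv\<^bsub>K\<^esub> k"], of "inv\<^bsub>H\<^esub> h" h] by (simp del: \<phi>.hom_inv)
      also have "\<dots> = \<one>\<^bsub>H\<^esub>"
        using x au[of "inv\<^bsub>K\<^esub> k"] hom_one[OF auto_hom H.group_axioms H.group_axioms]
        by (simp del: \<phi>.hom_inv)
      finally show "?y \<otimes>\<^bsub>semidirect H K \<phi>\<^esub> x = \<one>\<^bsub>semidirect H K \<phi>\<^esub>"
        using x by simp
    qed
  qed (auto simp: cl mu on H.m_assoc K.m_assoc auto_mult[OF au] simp del: \<phi>.hom_mult \<phi>.hom_one)
qed

context
  fixes H :: "('h, 'm) monoid_scheme" and f :: "'h \<Rightarrow> 'h"
  assumes H: "group H" and f: "f \<in> auto H"
begin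

interpretation H: group H by (rule H)
interpretation A: group "AutoGroup H" by (rule H.AutoGroup)

lemma auto_power: "f [^]\<^bsub>AutoGroup H\<^esub> (n :: int) \<in> auto H"
  using A.int_pow_closed[of f n] f by simp

lemma auto_power_closed: "x \<in> carrier H \<Longrightarrow> (f [^]\<^bsub>AutoGroup H\<^esub> (n :: int)) x \<in> carrier H"
  using auto_power by (rule auto_closed)

lemma auto_power_1: "f [^]\<^bsub>AutoGroup H\<^esub> (1 :: int) = f"
  using f by simp

lemma auto_power_minus_1: "f [^]\<^bsub>AutoGroup H\<^esub> (-1 :: int) = inv\<^bsub>AutoGroup H\<^esub> f"
  using f by (subst A.int_pow_neg) auto

lemma auto_power_Suc:
  "x \<in> carrier H \<Longrightarrow> (f [^]\<^bsub>AutoGroup H\<^esub> (1 + n :: int)) x = f ((f [^]\<^bsub>AutoGroup H\<^esub> n) x)"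
  using f A.int_pow_mult[of f 1 n] auto_power[of n] auto_power_1
  by (simp add: AutoGroup_mult_apply)

lemma group_cyclic_extension: "group (cyclic_extension H f)"
  unfolding cyclic_extension_def using f
  by (intro group_semidirect H group_integer_group A.hom_integer_group_pow) simp

lemma cyclic_extension_simps:
  "carrier (cyclic_extension H f) = carrier H \<times> UNIV"
  "(h, k) \<otimes>\<^bsub>cyclic_extension H f\<^esub> (h', k') = (h \<otimes>\<^bsub>H\<^esub> (f [^]\<^bsub>AutoGroup H\<^esub> k) h', k + k')"
  "\<one>\<^bsub>cyclic_extension H f\<^esub> = (\<one>\<^bsub>H\<^esub>, 0)"
  by (simp_all add: cyclic_extension_def)

lemma snd_hom_cyclic_extension: "snd \<in> hom (cyclic_extension H f) integer_group"
  by (auto simp: hom_def cyclic_extension_simps)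

lemma fibre_hom_cyclic_extension: "(\<lambda>h. (h, 0)) \<in> hom H (cyclic_extension H f)"
  by (auto simp: hom_def cyclic_extension_simps AutoGroup_one_apply)

lemma snd_int_pow_cyclic_extension:
  assumes "d \<in> carrier (cyclic_extension H f)"
  shows "snd (d [^]\<^bsub>cyclic_extension H f\<^esub> (n :: int)) = n * snd d"
  using hom_int_pow[OF snd_hom_cyclic_extension assms group_cyclic_extension group_integer_group]
  by simp

end

text \<open>The last hypothesis says that conjugation by \<open>d = (k, e)\<close> acts on the copy of \<open>H\<close> given by \<open>\<theta>\<close> in the
way \<open>f\<close> acts on \<open>H\<close>. Hence \<open>(h, n) \<mapsto> \<theta> h d\<^sup>n\<close> is a homomorphism, and it is bijective because
\<open>e = \<plusminus>1\<close> generates the quotient \<open>\<int>\<close>. Changing coordinates in \<open>H\<close>, changing \<open>f\<close> by an inner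
automorphism and replacing \<open>f\<close> by its inverse are the special cases with two of \<open>\<theta>\<close>, \<open>k\<close>, \<open>e\<close>
trivial.\<close>

theorem cyclic_extension_isoI:
  assumes H: "group H" and f: "f \<in> auto H" and H': "group H'" and f': "f' \<in> auto H'"
    and \<theta>: "\<theta> \<in> iso H H'" and k: "k \<in> carrier H'" and e: "e = 1 \<or> e = (-1 :: int)"
    and conj: "\<And>x. x \<in> carrier H \<Longrightarrow>
      \<theta> (f x) \<otimes>\<^bsub>H'\<^esub> k = k \<otimes>\<^bsub>H'\<^esub> (f' [^]\<^bsub>AutoGroup H'\<^esub> e) (\<theta> x)"
  shows "cyclic_extension H f \<cong> cyclic_extension H' f'"
proof -
  define G where "G = cyclic_extension H f"
  define G' where "G' = cyclic_extension H' f'"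
  interpret H: group H by fact
  interpret H': group H' by fact
  interpret G': group G' unfolding G'_def by (rule group_cyclic_extension[OF H' f'])
  note simps = cyclic_extension_simps[OF H f, folded G_def] cyclic_extension_simps[OF H' f', folded G'_def]
  have ee: "e * e = 1" using e by auto
  have \<theta>c: "\<theta> x \<in> carrier H'" if "x \<in> carrier H" for x using \<theta> that by (auto simp: iso_def hom_def)
  define i where "i x = (\<theta> x, 0 :: int)" for x
  define d where "d = (k, e)"
  have d: "d \<in> carrier G'" by (simp add: d_def simps k)
  have i: "i x \<in> carrier G'" if "x \<in> carrier H" for x using \<theta>c that by (simp add: i_def simps)
  have i_mult: "i (x \<otimes>\<^bsub>H\<^esub> y) = i x \<otimes>\<^bsub>G'\<^esub> i y" if "x \<in> carrier H" "y \<in> carrier H" for x y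
    using \<theta> that \<theta>c by (simp add: i_def simps iso_def hom_mult AutoGroup_one_apply)
  have step: "d \<otimes>\<^bsub>G'\<^esub> i x = i (f x) \<otimes>\<^bsub>G'\<^esub> d" if "x \<in> carrier H" for x
    using conj[OF that] k by (simp add: d_def i_def simps AutoGroup_one_apply)
  have fc: "(f [^]\<^bsub>AutoGroup H\<^esub> (n :: int)) x \<in> carrier H" if "x \<in> carrier H" for n x
    by (rule auto_power_closed[OF H f that])
  have dn: "d [^]\<^bsub>G'\<^esub> (n :: int) \<in> carrier G'" for n using d by simp
  have dS: "d [^]\<^bsub>G'\<^esub> (1 + n :: int) = d \<otimes>\<^bsub>G'\<^esub> d [^]\<^bsub>G'\<^esub> n" for n
    using d by (simp add: G'.int_pow_mult)
  \<comment> \<open>Going from \<open>n\<close> to \<open>n + 1\<close> is an equivalence, so negative powers need no separate argument.\<close>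
  define P where "P n \<longleftrightarrow> (\<forall>x\<in>carrier H. d [^]\<^bsub>G'\<^esub> (n :: int) \<otimes>\<^bsub>G'\<^esub> i x = i ((f [^]\<^bsub>AutoGroup H\<^esub> n) x) \<otimes>\<^bsub>G'\<^esub> d [^]\<^bsub>G'\<^esub> n)" for n
  have iff: "P n \<longleftrightarrow> P (1 + n)" for n
  proof -
    have "d [^]\<^bsub>G'\<^esub> n \<otimes>\<^bsub>G'\<^esub> i x = i ((f [^]\<^bsub>AutoGroup H\<^esub> n) x) \<otimes>\<^bsub>G'\<^esub> d [^]\<^bsub>G'\<^esub> n \<longleftrightarrow>
      d [^]\<^bsub>G'\<^esub> (1 + n) \<otimes>\<^bsub>G'\<^esub> i x = i ((f [^]\<^bsub>AutoGroup H\<^esub> (1 + n)) x) \<otimes>\<^bsub>G'\<^esub> d [^]\<^bsub>G'\<^esub> (1 + n)"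
      (is "?l \<longleftrightarrow> ?r") if x: "x \<in> carrier H" for x
    proof -
      let ?y = "(f [^]\<^bsub>AutoGroup H\<^esub> n) x"
      have "i ((f [^]\<^bsub>AutoGroup H\<^esub> (1 + n)) x) \<otimes>\<^bsub>G'\<^esub> d [^]\<^bsub>G'\<^esub> (1 + n)
          = i (f ?y) \<otimes>\<^bsub>G'\<^esub> d \<otimes>\<^bsub>G'\<^esub> d [^]\<^bsub>G'\<^esub> n"
        using d dn i[OF auto_closed[OF f fc[OF x]]]
        by (simp add: auto_power_Suc[OF H f x] dS G'.m_assoc)
      also have "\<dots> = d \<otimes>\<^bsub>G'\<^esub> (i ?y \<otimes>\<^bsub>G'\<^esub> d [^]\<^bsub>G'\<^esub> n)"
        using d dn i[OF fc[OF x]] by (simp add: step[OF fc[OF x], symmetric] G'.m_assoc)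
      finally have "?r \<longleftrightarrow> d \<otimes>\<^bsub>G'\<^esub> (d [^]\<^bsub>G'\<^esub> n \<otimes>\<^bsub>G'\<^esub> i x) = d \<otimes>\<^bsub>G'\<^esub> (i ?y \<otimes>\<^bsub>G'\<^esub> d [^]\<^bsub>G'\<^esub> n)"
        using d dn i[OF x] by (simp add: dS G'.m_assoc)
      also have "\<dots> \<longleftrightarrow> ?l"
        using d dn i[OF x] i[OF fc[OF x]] by (intro G'.Units_l_cancel) auto
      finally show ?thesis by simp
    qed
    then show ?thesis unfolding P_def by blast
  qed
  have P: "P n" for n
  proof (induction n rule: int_induct[where k = 0])
    case base
    show ?case using i by (simp add: P_def AutoGroup_one_apply)
  next
    case (step1 n) then show ?case using iff[of n] by (simp add: add.commute)
  next
    case (step2 n) then show ?case using iff[of "n - 1"] by simp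
  qed
  define \<Phi> where "\<Phi> = (\<lambda>(h, n). i h \<otimes>\<^bsub>G'\<^esub> d [^]\<^bsub>G'\<^esub> (n :: int))"
  have snd_i: "snd (i h \<otimes>\<^bsub>G'\<^esub> x) = snd x" for h x by (cases x) (simp add: i_def simps)
  have snd_d: "snd (d [^]\<^bsub>G'\<^esub> (n :: int)) = n * e" for n
    using snd_int_pow_cyclic_extension[OF H' f', folded G'_def, OF d] by (simp add: d_def)
  have "\<Phi> \<in> iso G G'"
  proof (rule isoI)
    show "\<Phi> \<in> hom G G'"
    proof (rule homI)
      fix x y assume "x \<in> carrier G" "y \<in> carrier G"
      then obtain h m h' n where x: "x = (h, m)" "h \<in> carrier H" and y: "y = (h', n)" "h' \<in> carrier H"
        by (auto simp: simps)
      have "\<Phi> (x \<otimes>\<^bsub>G\<^esub> y) = i h \<otimes>\<^bsub>G'\<^esub> i ((f [^]\<^bsub>AutoGroup H\<^esub> m) h') \<otimes>\<^bsub>G'\<^esub> (d [^]\<^bsub>G'\<^esub> m \<otimes>\<^bsub>G'\<^esub> d [^]\<^bsub>G'\<^esub> n)"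
        using x y fc d by (simp add: simps \<Phi>_def i_mult G'.int_pow_mult)
      also have "\<dots> = i h \<otimes>\<^bsub>G'\<^esub> (i ((f [^]\<^bsub>AutoGroup H\<^esub> m) h') \<otimes>\<^bsub>G'\<^esub> d [^]\<^bsub>G'\<^esub> m) \<otimes>\<^bsub>G'\<^esub> d [^]\<^bsub>G'\<^esub> n"
        using x y fc i dn by (simp add: G'.m_assoc)
      also have "\<dots> = i h \<otimes>\<^bsub>G'\<^esub> (d [^]\<^bsub>G'\<^esub> m \<otimes>\<^bsub>G'\<^esub> i h') \<otimes>\<^bsub>G'\<^esub> d [^]\<^bsub>G'\<^esub> n"
        using P[of m] y by (simp add: P_def)
      also have "\<dots> = \<Phi> x \<otimes>\<^bsub>G'\<^esub> \<Phi> y"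
        using x y i dn by (simp add: \<Phi>_def G'.m_assoc)
      finally show "\<Phi> (x \<otimes>\<^bsub>G\<^esub> y) = \<Phi> x \<otimes>\<^bsub>G'\<^esub> \<Phi> y" .
    qed (auto simp: \<Phi>_def simps(1) intro!: i dn)
    show "bij_betw \<Phi> (carrier G) (carrier G')"
    proof (rule bij_betw_imageI)
      show "inj_on \<Phi> (carrier G)"
      proof (rule inj_onI)
        fix x y assume xy: "x \<in> carrier G" "y \<in> carrier G" and eq: "\<Phi> x = \<Phi> y"
        then obtain h m h' n where x: "x = (h, m)" "h \<in> carrier H" and y: "y = (h', n)" "h' \<in> carrier H"
          by (auto simp: simps)
        have "snd (\<Phi> x) = snd (\<Phi> y)" using eq by simp
        then have mn: "m = n" using e by (auto simp: \<Phi>_def x y snd_i snd_d)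
        then have "i h = i h'" using eq x y i dn by (simp add: \<Phi>_def)
        then have "\<theta> h = \<theta> h'" by (simp add: i_def)
        then show "x = y" using \<theta> x y mn by (auto simp: iso_def bij_betw_def inj_on_def)
      qed
      show "\<Phi> ` carrier G = carrier G'"
      proof (intro equalityI subsetI)
        fix y assume y: "y \<in> carrier G'"
        \<comment> \<open>Since \<open>e\<^sup>2 = 1\<close>, this power of \<open>d\<close> has the same second coordinate as \<open>y\<close>.\<close>
        let ?n = "snd y * e"
        let ?z = "y \<otimes>\<^bsub>G'\<^esub> inv\<^bsub>G'\<^esub> (d [^]\<^bsub>G'\<^esub> ?n)"
        have z: "?z \<in> carrier G'" using y d by simp
        have z': "?z \<otimes>\<^bsub>G'\<^esub> d [^]\<^bsub>G'\<^esub> ?n = y" using y d by (simp add: G'.m_assoc)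
        then have "snd ?z + ?n * e = snd y"
          using snd_hom_cyclic_extension[OF H' f', folded G'_def] z dn[of ?n] snd_d[of ?n]
          by (metis hom_mult mult_integer_group)
        moreover have "?n * e = snd y" by (simp add: mult.assoc ee)
        ultimately have "snd ?z = 0" by linarith
        moreover have "fst ?z \<in> \<theta> ` carrier H" using \<theta> z by (auto simp: iso_def bij_betw_def simps)
        ultimately obtain h where h: "h \<in> carrier H" "?z = i h" by (auto simp: i_def prod_eq_iff)
        then have "y = \<Phi> (h, ?n)" using z' by (simp add: \<Phi>_def)
        then show "y \<in> \<Phi> ` carrier G" using h by (auto simp: simps)
      qed (auto simp: \<Phi>_def simps(1) intro!: i dn)
    qed
  qed
  then show ?thesis unfolding G_def G'_def by (rule is_isoI)
qed

text \<open>By the vanishing hypotheses the two base groups are the common kernels of all homomorphisms to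
\<open>\<int>\<close>, so an isomorphism \<open>\<Phi>\<close> matches them. The pair \<open>(k, e)\<close> is the image of the generator
\<open>\<delta> = (1, 1)\<close>, and the conclusion is the image under \<open>\<Phi>\<close> of the relation \<open>\<delta> h = f h \<delta>\<close>.\<close>

theorem cyclic_extension_isoD:
  assumes H: "group H" and f: "f \<in> auto H" and H': "group H'" and f': "f' \<in> auto H'"
    and van: "\<And>\<xi> h. \<xi> \<in> hom (cyclic_extension H f) integer_group \<Longrightarrow> h \<in> carrier H \<Longrightarrow> \<xi> (h, 0) = 0"
    and van': "\<And>\<xi> h. \<xi> \<in> hom (cyclic_extension H' f') integer_group \<Longrightarrow> h \<in> carrier H' \<Longrightarrow> \<xi> (h, 0) = 0"
    and iso: "cyclic_extension H f \<cong> cyclic_extension H' f'"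
  obtains \<theta> k e where "\<theta> \<in> iso H H'" "k \<in> carrier H'" "e = 1 \<or> e = (-1 :: int)"
    "\<And>x. x \<in> carrier H \<Longrightarrow> \<theta> (f x) \<otimes>\<^bsub>H'\<^esub> k = k \<otimes>\<^bsub>H'\<^esub> (f' [^]\<^bsub>AutoGroup H'\<^esub> e) (\<theta> x)"
proof -
  define G where "G = cyclic_extension H f"
  define G' where "G' = cyclic_extension H' f'"
  interpret H: group H by fact
  interpret H': group H' by fact
  interpret G: group G unfolding G_def by (rule group_cyclic_extension[OF H f])
  interpret G': group G' unfolding G'_def by (rule group_cyclic_extension[OF H' f'])
  note simps = cyclic_extension_simps[OF H f, folded G_def] cyclic_extension_simps[OF H' f', folded G'_def]
  obtain \<Phi> where \<Phi>: "\<Phi> \<in> iso G G'" using iso unfolding G_def G'_def is_iso_def by blast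
  let ?\<Psi> = "inv_into (carrier G) \<Phi>"
  have \<Psi>: "?\<Psi> \<in> iso G' G" by (rule G.iso_set_sym[OF \<Phi>])
  have hom\<Phi>: "\<Phi> \<in> hom G G'" and hom\<Psi>: "?\<Psi> \<in> hom G' G" using \<Phi> \<Psi> by (auto simp: iso_def)
  have inj: "inj_on \<Phi> (carrier G)" and im: "\<Phi> ` carrier G = carrier G'"
    using \<Phi> by (auto simp: iso_def bij_betw_def)
  have \<xi>: "snd \<circ> \<Phi> \<in> hom G integer_group"
    by (rule hom_compose[OF hom\<Phi> snd_hom_cyclic_extension[OF H' f', folded G'_def]])
  have \<xi>': "snd \<circ> ?\<Psi> \<in> hom G' integer_group"
    by (rule hom_compose[OF hom\<Psi> snd_hom_cyclic_extension[OF H f, folded G_def]])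
  have snd0: "snd (\<Phi> (h, 0)) = 0" if "h \<in> carrier H" for h
    using van[OF \<xi>[unfolded G_def] that] by simp
  have snd0': "snd (?\<Psi> (h, 0)) = 0" if "h \<in> carrier H'" for h
    using van'[OF \<xi>'[unfolded G'_def] that] by simp
  define \<theta> where "\<theta> h = fst (\<Phi> (h, 0))" for h
  have \<theta>: "\<Phi> (h, 0) = (\<theta> h, 0)" if "h \<in> carrier H" for h
    using snd0[OF that] by (metis \<theta>_def prod.collapse)
  have \<theta>c: "\<theta> h \<in> carrier H'" if "h \<in> carrier H" for h
    using hom_in_carrier[OF hom\<Phi>, of "(h, 0)"] that by (simp add: simps \<theta>)
  obtain k e where ke: "\<Phi> (\<one>\<^bsub>H\<^esub>, 1) = (k, e)" by fastforce
  have k: "k \<in> carrier H'"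
    using hom_in_carrier[OF hom\<Phi>, of "(\<one>\<^bsub>H\<^esub>, 1)"] by (simp add: simps ke)
  have pow: "\<Phi> (h, n) = (\<theta> h, 0) \<otimes>\<^bsub>G'\<^esub> (k, e) [^]\<^bsub>G'\<^esub> (n :: int)" if h: "h \<in> carrier H" for h n
  proof -
    let ?t = "(\<one>\<^bsub>H\<^esub>, 1 :: int)"
    have t: "?t \<in> carrier G" by (simp add: simps)
    have "fst (?t [^]\<^bsub>G\<^esub> (n :: int)) = \<one>\<^bsub>H\<^esub>" for n
    proof -
      have one: "(f [^]\<^bsub>AutoGroup H\<^esub> (n :: int)) \<one>\<^bsub>H\<^esub> = \<one>\<^bsub>H\<^esub>" for n
        by (rule hom_one[OF auto_hom[OF auto_power[OF H f]] H H])
      have S: "?t [^]\<^bsub>G\<^esub> (1 + n :: int) = ?t \<otimes>\<^bsub>G\<^esub> ?t [^]\<^bsub>G\<^esub> n" for n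
        using t by (simp add: G.int_pow_mult)
      have "fst (?t [^]\<^bsub>G\<^esub> (1 + n :: int)) = \<one>\<^bsub>H\<^esub> \<longleftrightarrow> fst (?t [^]\<^bsub>G\<^esub> n) = \<one>\<^bsub>H\<^esub>" for n
      proof -
        obtain u v where uv: "?t [^]\<^bsub>G\<^esub> n = (u, v)" by fastforce
        have u: "u \<in> carrier H" using G.int_pow_closed[OF t, of n] by (simp add: uv simps)
        have "f \<one>\<^bsub>H\<^esub> = \<one>\<^bsub>H\<^esub>" using one[of 1] auto_power_1[OF H f] by simp
        then have "f u = \<one>\<^bsub>H\<^esub> \<longleftrightarrow> u = \<one>\<^bsub>H\<^esub>"
          using auto_bij[OF f] u by (metis H.one_closed bij_betw_def inj_on_eq_iff)
        then show ?thesis unfolding S uv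
          using auto_closed[OF f u] by (simp add: simps auto_power_1[OF H f, simplified])
      qed
      note iff = this
      show ?thesis
      proof (induction n rule: int_induct[where k = 0])
        case base show ?case by (simp add: simps)
      next
        case (step1 n) then show ?case using iff[of n] by (simp add: add.commute)
      next
        case (step2 n) then show ?case using iff[of "n - 1"] by simp
      qed
    qed
    moreover have "snd (?t [^]\<^bsub>G\<^esub> (n :: int)) = n"
      using snd_int_pow_cyclic_extension[OF H f, folded G_def, OF t] by simp
    ultimately have tn: "?t [^]\<^bsub>G\<^esub> n = (\<one>\<^bsub>H\<^esub>, n)" by (metis prod.collapse)
    have "(h, n) = (h, 0) \<otimes>\<^bsub>G\<^esub> ?t [^]\<^bsub>G\<^esub> n"
      using h by (simp add: tn simps AutoGroup_one_apply)
    then have "\<Phi> (h, n) = \<Phi> (h, 0) \<otimes>\<^bsub>G'\<^esub> \<Phi> (?t [^]\<^bsub>G\<^esub> n)"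
      using hom_mult[OF hom\<Phi>, of "(h, 0)" "?t [^]\<^bsub>G\<^esub> n"] h G.int_pow_closed[OF t, of n] by (simp add: simps(1))
    also have "\<Phi> (?t [^]\<^bsub>G\<^esub> n) = \<Phi> ?t [^]\<^bsub>G'\<^esub> n"
      by (rule hom_int_pow[OF hom\<Phi> t G.group_axioms G'.group_axioms])
    finally show ?thesis using h by (simp add: \<theta> ke)
  qed
  have kec: "(k, e) \<in> carrier G'" using k by (simp add: simps)
  have sndn: "snd (\<Phi> (h, n)) = n * e" if h: "h \<in> carrier H" for h n
  proof -
    have "snd ((\<theta> h, 0) \<otimes>\<^bsub>G'\<^esub> x) = snd x" for x by (cases x) (simp add: simps)
    then show ?thesis unfolding pow[OF h]
      using snd_int_pow_cyclic_extension[OF H' f', folded G'_def, OF kec] by simp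
  qed
  have "(\<one>\<^bsub>H'\<^esub>, 1) \<in> \<Phi> ` carrier G" unfolding im by (simp add: simps)
  then obtain h n where "h \<in> carrier H" "\<Phi> (h, n) = (\<one>\<^bsub>H'\<^esub>, 1)" by (auto simp: simps)
  then have "n * e = 1" using sndn[of h n] by simp
  then have e: "e = 1 \<or> e = -1" by (auto simp: zmult_eq_1_iff)
  have "\<theta> \<in> iso H H'"
  proof (rule isoI)
    show "\<theta> \<in> hom H H'"
    proof (rule homI)
      fix x y assume x: "x \<in> carrier H" and y: "y \<in> carrier H"
      have "(\<theta> (x \<otimes>\<^bsub>H\<^esub> y), 0) = \<Phi> ((x, 0) \<otimes>\<^bsub>G\<^esub> (y, 0))"
        using x y by (simp add: simps AutoGroup_one_apply \<theta>)
      also have "\<dots> = (\<theta> x, 0) \<otimes>\<^bsub>G'\<^esub> (\<theta> y, 0)"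
        using hom_mult[OF hom\<Phi>, of "(x, 0)" "(y, 0)"] x y by (simp add: simps(1) \<theta>)
      also have "\<dots> = (\<theta> x \<otimes>\<^bsub>H'\<^esub> \<theta> y, 0)"
        using \<theta>c[OF y] by (simp add: simps AutoGroup_one_apply)
      finally show "\<theta> (x \<otimes>\<^bsub>H\<^esub> y) = \<theta> x \<otimes>\<^bsub>H'\<^esub> \<theta> y" by simp
    qed (rule \<theta>c)
    show "bij_betw \<theta> (carrier H) (carrier H')"
    proof (rule bij_betw_imageI)
      show "inj_on \<theta> (carrier H)"
      proof (rule inj_onI)
        fix x y assume x: "x \<in> carrier H" and y: "y \<in> carrier H" and "\<theta> x = \<theta> y"
        then have "\<Phi> (x, 0) = \<Phi> (y, 0)" by (simp add: \<theta>)
        then show "x = y" using inj_onD[OF inj, of "(x, 0)" "(y, 0)"] x y by (simp add: simps)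
      qed
      show "\<theta> ` carrier H = carrier H'"
      proof (intro equalityI subsetI)
        fix y assume y: "y \<in> carrier H'"
        then have yG: "(y, 0) \<in> carrier G'" by (simp add: simps)
        let ?x = "?\<Psi> (y, 0)"
        have x: "?x \<in> carrier G" by (rule hom_in_carrier[OF hom\<Psi> yG])
        have "?x = (fst ?x, 0)" using snd0'[OF y] by (metis prod.collapse)
        moreover have "\<Phi> ?x = (y, 0)" using f_inv_into_f[of "(y, 0)" \<Phi> "carrier G"] im yG by simp
        ultimately have "\<Phi> (fst ?x, 0) = (y, 0)" by simp
        moreover have fx: "fst ?x \<in> carrier H" using x by (auto simp: simps)
        ultimately have "\<theta> (fst ?x) = y" by (simp add: \<theta>)
        then show "y \<in> \<theta> ` carrier H" using imageI[OF fx, of \<theta>] by simp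
      qed (auto simp: \<theta>c)
    qed
  qed
  moreover have "\<theta> (f x) \<otimes>\<^bsub>H'\<^esub> k = k \<otimes>\<^bsub>H'\<^esub> (f' [^]\<^bsub>AutoGroup H'\<^esub> e) (\<theta> x)" if x: "x \<in> carrier H" for x
  proof -
    have fx: "f x \<in> carrier H" by (rule auto_closed[OF f x])
    have eq: "(\<one>\<^bsub>H\<^esub>, 1) \<otimes>\<^bsub>G\<^esub> (x, 0) = (f x, 0) \<otimes>\<^bsub>G\<^esub> (\<one>\<^bsub>H\<^esub>, 1)"
      using fx by (simp add: simps auto_power_1[OF H f, simplified] AutoGroup_one_apply)
    have "(k, e) \<otimes>\<^bsub>G'\<^esub> (\<theta> x, 0) = \<Phi> ((\<one>\<^bsub>H\<^esub>, 1) \<otimes>\<^bsub>G\<^esub> (x, 0))"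
      using hom_mult[OF hom\<Phi>, of "(\<one>\<^bsub>H\<^esub>, 1)" "(x, 0)"] x by (simp add: simps(1) \<theta> ke)
    also have "\<dots> = (\<theta> (f x), 0) \<otimes>\<^bsub>G'\<^esub> (k, e)"
      unfolding eq using hom_mult[OF hom\<Phi>, of "(f x, 0)" "(\<one>\<^bsub>H\<^esub>, 1)"] fx by (simp add: simps(1) \<theta> ke)
    finally show ?thesis using k by (simp add: simps AutoGroup_one_apply)
  qed
  ultimately show ?thesis using that k e by blast
qed


section \<open>Groups given by generators and relations\<close>

lemma pres_eq_context: "pres_eq R u v \<Longrightarrow> pres_eq R (a @ u @ b) (a @ v @ b)"
proof (induction rule: pres_eq.induct)
  case (cancel a' x s b')
  show ?case using pres_eq.cancel[of R "a @ a'" x s "b' @ b"] by simp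
next
  case (rel u v a' b')
  then show ?case using pres_eq.rel[of u v R "a @ a'" "b' @ b"] by simp
qed (blast intro: pres_eq.refl pres_eq.sym pres_eq.trans)+

lemma pres_eq_append: "pres_eq R u u' \<Longrightarrow> pres_eq R v v' \<Longrightarrow> pres_eq R (u @ v) (u' @ v')"
  using pres_eq_context[of R u u' "[]" v] pres_eq_context[of R v v' u' "[]"]
  by (auto intro: pres_eq.trans)

lemma pres_class_eq_iff: "pres_class R u = pres_class R v \<longleftrightarrow> pres_eq R u v"
  unfolding pres_class_def by (blast intro: pres_eq.refl pres_eq.sym pres_eq.trans)

lemma pres_class_mult:
  "pres_class R u \<otimes>\<^bsub>presented_group R\<^esub> pres_class R v = pres_class R (u @ v)"
proof -
  have "pres_class R (u' @ v') = pres_class R (u @ v)"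
    if "u' \<in> pres_class R u" "v' \<in> pres_class R v" for u' v'
  proof -
    have "pres_eq R u u'" "pres_eq R v v'" using that by (simp_all add: pres_class_def)
    then show ?thesis unfolding pres_class_eq_iff by (intro pres_eq.sym[OF pres_eq_append])
  qed
  then have "(\<Union>u'\<in>pres_class R u. \<Union>v'\<in>pres_class R v. pres_class R (u' @ v'))
      = (\<Union>u'\<in>pres_class R u. \<Union>v'\<in>pres_class R v. pres_class R (u @ v))"
    by (intro SUP_cong[OF HOL.refl]) blast
  also have "u \<in> pres_class R u" "v \<in> pres_class R v" by (simp_all add: pres_class_def pres_eq.refl)
  then have "(\<Union>u'\<in>pres_class R u. \<Union>v'\<in>pres_class R v. pres_class R (u @ v)) = pres_class R (u @ v)" by blast
  finally show ?thesis unfolding presented_group_def by simp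
qed

lemma presented_group_simps:
  "carrier (presented_group R) = range (pres_class R)"
  "\<one>\<^bsub>presented_group R\<^esub> = pres_class R []"
  by (simp_all add: presented_group_def)

definition inverse_word :: "'g word \<Rightarrow> 'g word" where
  "inverse_word u = rev (map (\<lambda>(x, s). (x, \<not> s)) u)"

lemma inverse_word_left: "pres_eq R (inverse_word u @ u) []"
proof (induction u)
  case (Cons a u)
  obtain x s where a: "a = (x, s)" by fastforce
  have "pres_eq R (inverse_word u @ [(x, \<not> s), (x, \<not> \<not> s)] @ u) (inverse_word u @ u)"
    by (rule pres_eq.cancel)
  then show ?case using Cons by (auto simp: inverse_word_def a intro: pres_eq.trans)
qed (simp add: inverse_word_def pres_eq.refl)

lemma group_presented_group: "group (presented_group R)"
proof (rule groupI)
  fix X assume "X \<in> carrier (presented_group R)"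
  then obtain u where u: "X = pres_class R u" by (auto simp: presented_group_simps)
  have "pres_class R (inverse_word u) \<otimes>\<^bsub>presented_group R\<^esub> X = \<one>\<^bsub>presented_group R\<^esub>"
    by (simp add: u pres_class_mult presented_group_simps pres_class_eq_iff inverse_word_left)
  then show "\<exists>Y\<in>carrier (presented_group R). Y \<otimes>\<^bsub>presented_group R\<^esub> X = \<one>\<^bsub>presented_group R\<^esub>"
    unfolding presented_group_simps by blast
next
  fix X Y Z
  assume "X \<in> carrier (presented_group R)" "Y \<in> carrier (presented_group R)" "Z \<in> carrier (presented_group R)"
  then obtain u v w where "X = pres_class R u" "Y = pres_class R v" "Z = pres_class R w"
    unfolding presented_group_simps by blast
  then show "X \<otimes>\<^bsub>presented_group R\<^esub> Y \<otimes>\<^bsub>presented_group R\<^esub> Z = X \<otimes>\<^bsub>presented_group R\<^esub> (Y \<otimes>\<^bsub>presented_group R\<^esub> Z)"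
    by (simp add: pres_class_mult)
next
  fix X Y
  assume "X \<in> carrier (presented_group R)" "Y \<in> carrier (presented_group R)"
  then obtain u v where "X = pres_class R u" "Y = pres_class R v" 
    unfolding presented_group_simps by blast
  then show "X \<otimes>\<^bsub>presented_group R\<^esub> Y \<in> carrier (presented_group R)"
    by (simp add: pres_class_mult presented_group_simps)
next
  show "\<one>\<^bsub>presented_group R\<^esub> \<in> carrier (presented_group R)"
    unfolding presented_group_simps by (rule rangeI)
next
  fix X assume "X \<in> carrier (presented_group R)"
  then obtain u where u: "X = pres_class R u" unfolding presented_group_simps by blast
  show "\<one>\<^bsub>presented_group R\<^esub> \<otimes>\<^bsub>presented_group R\<^esub> X = X"
    by (simp only: u presented_group_simps pres_class_mult append_Nil)
qed

primrec word_value :: "('a, 'm) monoid_scheme \<Rightarrow> ('g \<Rightarrow> 'a) \<Rightarrow> 'g word \<Rightarrow> 'a" where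
  "word_value G g [] = \<one>\<^bsub>G\<^esub>"
| "word_value G g (a # u) = (if snd a then g (fst a) else inv\<^bsub>G\<^esub> g (fst a)) \<otimes>\<^bsub>G\<^esub> word_value G g u"

context group
begin

context
  fixes g :: "'g \<Rightarrow> 'a"
  assumes g: "\<And>x. g x \<in> carrier G"
begin

lemma word_value_closed: "word_value G g u \<in> carrier G"
  by (induction u) (auto simp: g)

lemma word_value_append: "word_value G g (u @ v) = word_value G g u \<otimes> word_value G g v"
  by (induction u) (auto simp: g word_value_closed m_assoc)

lemma word_value_replicate: "word_value G g (replicate n (x, True)) = g x [^] n"
  by (induction n) (auto simp: g nat_pow_Suc2[symmetric])

lemma word_value_respects:
  assumes "\<And>u v. (u, v) \<in> R \<Longrightarrow> word_value G g u = word_value G g v" and "pres_eq R u v"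
  shows "word_value G g u = word_value G g v"
  using assms(2)
proof (induction rule: pres_eq.induct)
  case (cancel a x s b)
  have "word_value G g [(x, s), (x, \<not> s)] = \<one>" by (simp add: g)
  then show ?case by (simp only: word_value_append word_value_closed l_one)
qed (simp_all add: word_value_append assms(1))

text \<open>Von Dyck's theorem.\<close>

lemma presented_group_universal:
  assumes "\<And>u v. (u, v) \<in> R \<Longrightarrow> word_value G g u = word_value G g v"
  obtains h where "h \<in> hom (presented_group R) G" "\<And>x. h (pres_class R [(x, True)]) = g x"
proof
  define h where "h X = word_value G g (SOME u. u \<in> X)" for X
  have h: "h (pres_class R u) = word_value G g u" for u
  proof -
    have "(SOME v. v \<in> pres_class R u) \<in> pres_class R u"
      by (rule someI[of _ u]) (simp add: pres_class_def pres_eq.refl)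
    then have "pres_eq R u (SOME v. v \<in> pres_class R u)" by (simp add: pres_class_def)
    then show ?thesis unfolding h_def using word_value_respects[OF assms] by metis
  qed
  show "h \<in> hom (presented_group R) G"
    by (rule homI)
      (auto simp: presented_group_simps h word_value_closed pres_class_mult word_value_append)
  show "h (pres_class R [(x, True)]) = g x" for x by (simp add: h g)
qed

end

end

section \<open>The integral Heisenberg group in coordinates\<close>

context group
begin

text \<open>The relation \<open>ab\<close> says \<open>b\<inverse> a b = a c\<close>, and conjugation by \<open>b\<close> commutes with taking powers.\<close>

lemma pow_twisted_commute:
  assumes a: "a \<in> carrier G" and b: "b \<in> carrier G" and c: "c \<in> carrier G"
    and ab: "a \<otimes> b = b \<otimes> a \<otimes> c" and ac: "a \<otimes> c = c \<otimes> a"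
  shows "a [^] (n :: int) \<otimes> b = b \<otimes> a [^] n \<otimes> c [^] n"
proof -
  let ?conj = "\<lambda>x. inv b \<otimes> x \<otimes> b"
  have "?conj \<in> hom G G"
  proof (rule homI)
    fix x y assume xy: "x \<in> carrier G" "y \<in> carrier G"
    have "?conj x \<otimes> ?conj y = inv b \<otimes> x \<otimes> (b \<otimes> inv b) \<otimes> y \<otimes> b"
      using xy b by (simp only: m_assoc m_closed inv_closed)
    then show "?conj (x \<otimes> y) = ?conj x \<otimes> ?conj y" using xy b by (simp add: m_assoc)
  qed (use b in simp)
  then have "?conj (a [^] n) = ?conj a [^] n"
    using hom_int_pow[of ?conj G G a n] a group_axioms by simp
  also have "?conj a = inv b \<otimes> b \<otimes> (a \<otimes> c)"
    using a b c ab by (simp only: m_assoc m_closed inv_closed)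
  also have "\<dots> = a \<otimes> c" using a b c by simp
  also have "(a \<otimes> c) [^] n = a [^] n \<otimes> c [^] n"
    by (rule int_pow_mult_distrib[OF ac a c])
  finally have "inv b \<otimes> (a [^] n \<otimes> b) = a [^] n \<otimes> c [^] n" using a b by (simp add: m_assoc)
  then show ?thesis using a b c by (metis inv_solve_left int_pow_closed m_closed m_assoc)
qed

lemma pow_commute:
  assumes "a \<in> carrier G" "b \<in> carrier G" "a \<otimes> b = b \<otimes> a"
  shows "a [^] (n :: int) \<otimes> b = b \<otimes> a [^] n"
  using pow_twisted_commute[of a b \<one> n] assms by simp

end

text \<open>The symplectic form on \<open>\<int>\<^sup>2\<close>; its multiple by \<open>r\<close> is the commutator pairing of the Heisenberg group.\<close>

definition omega :: "int^2 \<Rightarrow> int^2 \<Rightarrow> int" where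
  "omega v w = v $ 1 * w $ 2 - v $ 2 * w $ 1"

text \<open>The element \<open>((x, y), z)\<close> stands for \<open>\<alpha>\<^sup>x \<beta>\<^sup>y \<gamma>\<^sup>z\<close>. The correction term in a product is the power of
\<open>\<gamma>\<close> that appears when the \<open>\<beta>\<close> of the first factor moves past the \<open>\<alpha>\<close> of the second.\<close>

definition heis :: "nat \<Rightarrow> ((int^2) \<times> int) monoid" where
  "heis r = \<lparr>carrier = UNIV,
     mult = (\<lambda>(v, z) (w, u). (v + w, z + u - int r * (v $ 2 * w $ 1))),
     one = (0, 0)\<rparr>"

lemma heis_simps [simp]:
  "carrier (heis r) = UNIV"
  "(v, z) \<otimes>\<^bsub>heis r\<^esub> (w, u) = (v + w, z + u - int r * (v $ 2 * w $ 1))"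
  "\<one>\<^bsub>heis r\<^esub> = (0, 0)"
  by (simp_all add: heis_def)

lemma group_heis: "group (heis r)"
proof (rule groupI)
  fix x assume "x \<in> carrier (heis r)"
  obtain v z where x: "x = (v, z)" by fastforce
  have "(- v, - z - int r * (v $ 2 * v $ 1)) \<otimes>\<^bsub>heis r\<^esub> x = \<one>\<^bsub>heis r\<^esub>" by (simp add: x)
  then show "\<exists>y\<in>carrier (heis r). y \<otimes>\<^bsub>heis r\<^esub> x = \<one>\<^bsub>heis r\<^esub>" by auto
qed (auto simp: algebra_simps)

lemma heis_commutator:
  "x \<otimes>\<^bsub>heis r\<^esub> y = y \<otimes>\<^bsub>heis r\<^esub> x \<otimes>\<^bsub>heis r\<^esub> (0, int r * omega (fst x) (fst y))"
  by (cases x; cases y) (simp add: omega_def algebra_simps)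

abbreviation "hA \<equiv> (vector [1, 0] :: int^2, 0 :: int)"
abbreviation "hB \<equiv> (vector [0, 1] :: int^2, 0 :: int)"
abbreviation "hC \<equiv> (0 :: int^2, 1 :: int)"

lemma hom_integer_group_pow_eq:
  assumes "h \<in> hom integer_group G" "group G"
  shows "h n = h 1 [^]\<^bsub>G\<^esub> n"
  using hom_int_pow[OF assms(1), of 1 n] assms(2) by simp

text \<open>Without the hypothesis the last coordinate of a power contains a term quadratic in \<open>n\<close>. The
lemma is meant for powers of the generators and of central elements.\<close>

lemma heis_pow:
  assumes "v $ 1 * v $ 2 = 0"
  shows "(v, z) [^]\<^bsub>heis r\<^esub> (n :: int) = (n *s v, n * z)"
proof -
  have "(\<lambda>n. (n *s v, n * z)) \<in> hom integer_group (heis r)"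
    using assms by (auto simp: hom_def vec_eq_iff algebra_simps)
  from hom_integer_group_pow_eq[OF this group_heis, of n] show ?thesis by simp
qed

lemma heis_normal_form:
  "(v, z) = hA [^]\<^bsub>heis r\<^esub> (v $ 1) \<otimes>\<^bsub>heis r\<^esub> hB [^]\<^bsub>heis r\<^esub> (v $ 2) \<otimes>\<^bsub>heis r\<^esub> hC [^]\<^bsub>heis r\<^esub> z"
  by (simp add: heis_pow vec_eq_iff forall_2)

lemma heis_hom_eq:
  assumes "f \<in> hom (heis r) G" "group G"
  shows "f (v, z) = f hA [^]\<^bsub>G\<^esub> (v $ 1) \<otimes>\<^bsub>G\<^esub> f hB [^]\<^bsub>G\<^esub> (v $ 2) \<otimes>\<^bsub>G\<^esub> f hC [^]\<^bsub>G\<^esub> z"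
proof -
  have m: "f (x \<otimes>\<^bsub>heis r\<^esub> y) = f x \<otimes>\<^bsub>G\<^esub> f y" for x y by (rule hom_mult[OF assms(1)]) auto
  have p: "f (x [^]\<^bsub>heis r\<^esub> n) = f x [^]\<^bsub>G\<^esub> n" for x and n :: int
    by (rule hom_int_pow[OF assms(1) _ group_heis assms(2)]) simp
  have "f (v, z) = f (hA [^]\<^bsub>heis r\<^esub> (v $ 1) \<otimes>\<^bsub>heis r\<^esub> hB [^]\<^bsub>heis r\<^esub> (v $ 2) \<otimes>\<^bsub>heis r\<^esub> hC [^]\<^bsub>heis r\<^esub> z)"
    by (rule arg_cong[OF heis_normal_form])
  then show ?thesis unfolding m p .
qed

lemma heis_hom_eqI:
  assumes "f \<in> hom (heis r) G" "g \<in> hom (heis r) G" "group G"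
    and "f hA = g hA" "f hB = g hB" "f hC = g hC"
  shows "f x = g x"
proof (cases x)
  case (Pair v z)
  show ?thesis unfolding Pair heis_hom_eq[OF assms(1,3), of v z] heis_hom_eq[OF assms(2,3), of v z]
    by (simp only: assms(4-6))
qed

text \<open>The relations give \<open>b\<^sup>y a\<^sup>x = a\<^sup>x b\<^sup>y c\<^sup>-\<^sup>r\<^sup>x\<^sup>y\<close> for all integers \<open>x\<close> and \<open>y\<close>, by applying
\<open>pow_twisted_commute\<close> first to \<open>a\<close> and then to \<open>b\<close>. This rule and the centrality of \<open>c\<close> are enough to
multiply normal forms.\<close>

lemma (in group) heis_universal:
  assumes a: "a \<in> carrier G" and b: "b \<in> carrier G" and c: "c \<in> carrier G"
    and ab: "a \<otimes> b = b \<otimes> a \<otimes> c [^] int r" and ac: "a \<otimes> c = c \<otimes> a" and bc: "b \<otimes> c = c \<otimes> b"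
  shows "(\<lambda>(v :: int^2, z :: int). a [^] (v $ 1) \<otimes> b [^] (v $ 2) \<otimes> c [^] z) \<in> hom (heis r) G"
proof -
  have central: "c [^] n \<otimes> x [^] m = x [^] m \<otimes> c [^] n"
    if x: "x \<in> carrier G" and "x \<otimes> c = c \<otimes> x" for x and n m :: int
    by (intro pow_commute[OF c] pow_commute[OF x, THEN HOL.sym] int_pow_closed x c that(2))
  note ca = central[OF a ac] and cb = central[OF b bc]
  have ba: "b [^] y \<otimes> a [^] x = a [^] x \<otimes> b [^] y \<otimes> c [^] (- int r * (y * x))" for x y :: int
  proof -
    let ?c = "c [^] (- (int r * x))"
    have "c [^] int r \<otimes> a = a \<otimes> c [^] int r" using ca[of "int r" 1] a by simp
    then have "a [^] x \<otimes> b = b \<otimes> a [^] x \<otimes> (c [^] int r) [^] x"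
      by (intro pow_twisted_commute a b ab int_pow_closed c) (rule HOL.sym)
    then have "a [^] x \<otimes> b = b \<otimes> a [^] x \<otimes> c [^] (int r * x)"
      by (simp only: int_pow_pow c)
    then have "a [^] x \<otimes> b \<otimes> ?c = b \<otimes> a [^] x \<otimes> (c [^] (int r * x) \<otimes> ?c)"
      using a b c by (simp only: m_assoc int_pow_closed m_closed)
    also have "c [^] (int r * x) \<otimes> ?c = \<one>"
      using c by (simp only: int_pow_mult[symmetric] add.right_inverse int_pow_0)
    finally have "b \<otimes> a [^] x = a [^] x \<otimes> b \<otimes> ?c" using a b by simp
    moreover have "b \<otimes> ?c = ?c \<otimes> b" using cb[of "- (int r * x)" 1] b by simp
    ultimately have "b [^] y \<otimes> a [^] x = a [^] x \<otimes> b [^] y \<otimes> ?c [^] y"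
      by (intro pow_twisted_commute a b c int_pow_closed)
    then show ?thesis using c by (simp only: int_pow_pow) (simp add: mult.commute mult.left_commute)
  qed
  show ?thesis
  proof (rule homI)
    fix p q :: "(int^2) \<times> int"
    obtain v z where p: "p = (v, z)" by fastforce
    obtain w u where q: "q = (w, u)" by fastforce
    let ?t = "- int r * (v $ 2 * w $ 1)"
    have "a [^] (v $ 1) \<otimes> b [^] (v $ 2) \<otimes> c [^] z \<otimes> (a [^] (w $ 1) \<otimes> b [^] (w $ 2) \<otimes> c [^] u)
        = a [^] (v $ 1) \<otimes> b [^] (v $ 2) \<otimes> (c [^] z \<otimes> a [^] (w $ 1)) \<otimes> b [^] (w $ 2) \<otimes> c [^] u"
      using a b c by (simp add: m_assoc)
    also have "\<dots> = a [^] (v $ 1) \<otimes> (b [^] (v $ 2) \<otimes> a [^] (w $ 1)) \<otimes> (c [^] z \<otimes> b [^] (w $ 2)) \<otimes> c [^] u"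
      unfolding ca using a b c by (simp add: m_assoc)
    also have "\<dots> = a [^] (v $ 1) \<otimes> a [^] (w $ 1) \<otimes> b [^] (v $ 2) \<otimes> (c [^] ?t \<otimes> b [^] (w $ 2)) \<otimes> c [^] z \<otimes> c [^] u"
      unfolding ba cb[of z] using a b c by (simp add: m_assoc)
    also have "\<dots> = (a [^] (v $ 1) \<otimes> a [^] (w $ 1)) \<otimes> (b [^] (v $ 2) \<otimes> b [^] (w $ 2)) \<otimes> (c [^] ?t \<otimes> (c [^] z \<otimes> c [^] u))"
      unfolding cb[of ?t] using a b c by (simp add: m_assoc)
    also have "\<dots> = a [^] (v $ 1 + w $ 1) \<otimes> b [^] (v $ 2 + w $ 2) \<otimes> c [^] (z + u + ?t)"
      using a b c by (simp only: int_pow_mult[symmetric] add.commute[of ?t])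
    finally show "(case p \<otimes>\<^bsub>heis r\<^esub> q of (v, z) \<Rightarrow> a [^] (v $ 1) \<otimes> b [^] (v $ 2) \<otimes> c [^] z)
        = (case p of (v, z) \<Rightarrow> a [^] (v $ 1) \<otimes> b [^] (v $ 2) \<otimes> c [^] z)
        \<otimes> (case q of (v, z) \<Rightarrow> a [^] (v $ 1) \<otimes> b [^] (v $ 2) \<otimes> c [^] z)"
      by (simp add: p q)
  qed (use a b c in auto)
qed

lemma group_Heis: "group (Heis r)"
  unfolding Heis_def by (rule group_presented_group)

text \<open>The coordinate map \<open>q\<close> is a homomorphism by \<open>heis_universal\<close>. Von Dyck's theorem gives a homomorphism
\<open>p\<close> in the other direction; \<open>p \<circ> q\<close> fixes the generators, so \<open>q\<close> is injective. It is surjective because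
every word is a product of generators and their inverses.\<close>

theorem Heis_coordinates:
  obtains q where "q \<in> iso (heis r) (Heis r)"
    "q hA = heis_elem r Alpha" "q hB = heis_elem r Beta" "q hC = heis_elem r Gamma"
proof -
  interpret M: group "heis r" by (rule group_heis)
  interpret P: group "Heis r" by (rule group_Heis)
  let ?cl = "pres_class (heis_rels r)"
  have cl: "?cl u \<in> carrier (Heis r)" for u by (simp add: Heis_def presented_group_simps)
  have mult: "?cl u \<otimes>\<^bsub>Heis r\<^esub> ?cl v = ?cl (u @ v)" for u v by (simp add: Heis_def pres_class_mult)
  let ?a = "heis_elem r Alpha" and ?b = "heis_elem r Beta" and ?c = "heis_elem r Gamma"
  have pow: "?c [^]\<^bsub>Heis r\<^esub> n = ?cl (replicate n (Gamma, True))" for n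
  proof (induction n)
    case 0 then show ?case by (simp add: Heis_def presented_group_simps)
  next
    case (Suc n) then show ?case
      by (simp add: heis_elem_def mult replicate_append_same[symmetric])
  qed
  have rel: "?cl u = ?cl v" if "(u, v) \<in> heis_rels r" for u v
    using pres_eq.rel[OF that, of "[]" "[]"] by (simp add: pres_class_eq_iff)
  have ac: "?a \<otimes>\<^bsub>Heis r\<^esub> ?c = ?c \<otimes>\<^bsub>Heis r\<^esub> ?a" and bc: "?b \<otimes>\<^bsub>Heis r\<^esub> ?c = ?c \<otimes>\<^bsub>Heis r\<^esub> ?b"
    by (auto simp: heis_elem_def mult intro!: rel) (auto simp: heis_rels_def)
  have inv: "inv\<^bsub>Heis r\<^esub> heis_elem r x = ?cl [(x, False)]" for x
  proof (rule P.inv_equality)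
    show "?cl [(x, False)] \<otimes>\<^bsub>Heis r\<^esub> heis_elem r x = \<one>\<^bsub>Heis r\<^esub>"
      using pres_eq.cancel[of _ "[]" x False "[]"]
      by (simp add: heis_elem_def mult) (simp add: Heis_def presented_group_simps pres_class_eq_iff)
  qed (simp_all add: heis_elem_def cl)
  have elem: "heis_elem r x \<in> carrier (Heis r)" for x by (simp add: heis_elem_def cl)
  have "?a \<otimes>\<^bsub>Heis r\<^esub> ?b \<otimes>\<^bsub>Heis r\<^esub> inv\<^bsub>Heis r\<^esub> ?a \<otimes>\<^bsub>Heis r\<^esub> inv\<^bsub>Heis r\<^esub> ?b = ?c [^]\<^bsub>Heis r\<^esub> r"
    unfolding inv pow by (auto simp: heis_elem_def mult intro!: rel) (auto simp: heis_rels_def)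
  then have "?c [^]\<^bsub>Heis r\<^esub> int r \<otimes>\<^bsub>Heis r\<^esub> (?b \<otimes>\<^bsub>Heis r\<^esub> ?a) = ?a \<otimes>\<^bsub>Heis r\<^esub> ?b"
    by (simp add: int_pow_int elem P.m_assoc P.inv_solve_right' flip: P.m_assoc)
  moreover have "?c [^]\<^bsub>Heis r\<^esub> int r \<otimes>\<^bsub>Heis r\<^esub> (?b \<otimes>\<^bsub>Heis r\<^esub> ?a) = ?b \<otimes>\<^bsub>Heis r\<^esub> ?a \<otimes>\<^bsub>Heis r\<^esub> ?c [^]\<^bsub>Heis r\<^esub> int r"
  proof (rule P.pow_commute)
    show "?c \<otimes>\<^bsub>Heis r\<^esub> (?b \<otimes>\<^bsub>Heis r\<^esub> ?a) = ?b \<otimes>\<^bsub>Heis r\<^esub> ?a \<otimes>\<^bsub>Heis r\<^esub> ?c"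
      by (metis ac bc elem P.m_assoc)
  qed (simp_all add: elem)
  ultimately have ab: "?a \<otimes>\<^bsub>Heis r\<^esub> ?b = ?b \<otimes>\<^bsub>Heis r\<^esub> ?a \<otimes>\<^bsub>Heis r\<^esub> ?c [^]\<^bsub>Heis r\<^esub> int r" by simp
  define q where "q = (\<lambda>(v :: int^2, z :: int). ?a [^]\<^bsub>Heis r\<^esub> (v $ 1) \<otimes>\<^bsub>Heis r\<^esub> ?b [^]\<^bsub>Heis r\<^esub> (v $ 2) \<otimes>\<^bsub>Heis r\<^esub> ?c [^]\<^bsub>Heis r\<^esub> z)"
  have q: "q \<in> hom (heis r) (Heis r)"
    unfolding q_def by (rule P.heis_universal[OF elem elem elem ab ac bc])
  have gens: "q hA = ?a" "q hB = ?b" "q hC = ?c" using elem by (simp_all add: q_def)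
  let ?g = "case_heis_gen hA hB hC"
  have pow1: "hC [^]\<^bsub>heis r\<^esub> r = (0, int r)" using heis_pow[of 0 r 1 "int r"] by (simp add: int_pow_int)
  have hinv: "inv\<^bsub>heis r\<^esub> hA = (vector [-1, 0], 0)" "inv\<^bsub>heis r\<^esub> hB = (vector [0, -1], 0)"
    by (rule M.inv_equality; simp add: vec_eq_iff forall_2)+
  have "word_value (heis r) ?g u = word_value (heis r) ?g v" if "(u, v) \<in> heis_rels r" for u v
    using that
    by (auto simp: heis_rels_def M.word_value_replicate pow1 hinv vec_eq_iff forall_2)
  then obtain p where p: "p \<in> hom (Heis r) (heis r)" "\<And>x. p (heis_elem r x) = ?g x"
    using M.presented_group_universal[of ?g "heis_rels r"] unfolding Heis_def heis_elem_def by auto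
  have pq: "(p \<circ> q) x = x" for x
  proof (rule heis_hom_eqI[OF _ _ group_heis])
    show "p \<circ> q \<in> hom (heis r) (heis r)" by (rule hom_compose[OF q p(1)])
    show "(\<lambda>x. x) \<in> hom (heis r) (heis r)" by (simp add: hom_def)
  qed (simp_all add: gens p(2))
  have surj: "?cl u \<in> range q" for u
  proof (induction u)
    case Nil
    have "q (0, 0) = ?cl []"
      using hom_one[OF q group_heis group_Heis] by (simp add: Heis_def presented_group_simps)
    then show ?case using rangeI[of q "(0, 0)"] by simp
  next
    case (Cons a u)
    obtain x s where a: "a = (x, s)" by fastforce
    have e: "heis_elem r x \<in> range q" by (cases x) (simp_all add: gens[symmetric])
    then obtain y where y: "q y = heis_elem r x" by auto
    have "q (inv\<^bsub>heis r\<^esub> y) = inv\<^bsub>Heis r\<^esub> heis_elem r x"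
      using group_hom.hom_inv[of "heis r" "Heis r" q y] q y
      by (simp add: group_hom_def group_hom_axioms_def group_heis group_Heis)
    then have "?cl [(x, s)] \<in> range q"
      using e rangeI[of q "inv\<^bsub>heis r\<^esub> y"] unfolding inv by (cases s) (simp_all add: heis_elem_def)
    then obtain y1 y2 where "q y1 = ?cl [(x, s)]" "q y2 = ?cl u" using Cons by (auto simp: image_iff)
    then have "q (y1 \<otimes>\<^bsub>heis r\<^esub> y2) = ?cl (a # u)" using hom_mult[OF q, of y1 y2] by (simp add: mult a)
    then show ?case using rangeI[of q "y1 \<otimes>\<^bsub>heis r\<^esub> y2"] by simp
  qed
  have "q \<in> iso (heis r) (Heis r)"
  proof (rule isoI[OF q], rule bij_betw_imageI)
    show "inj_on q (carrier (heis r))" using pq by (intro inj_on_inverseI[of _ p]) simp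
    show "q ` carrier (heis r) = carrier (Heis r)"
      using surj hom_in_carrier[OF q] by (auto simp: Heis_def presented_group_simps)
  qed
  then show ?thesis using that gens by blast
qed


section \<open>Automorphisms of the Heisenberg group\<close>

lemma matrix_vector_2:
  fixes K :: "int^2^2"
  shows "(K *v v) $ 1 = K $ 1 $ 1 * v $ 1 + K $ 1 $ 2 * v $ 2"
    "(K *v v) $ 2 = K $ 2 $ 1 * v $ 1 + K $ 2 $ 2 * v $ 2"
  by (simp_all add: matrix_vector_mult_def sum_2)

lemma omega_matrix: "omega (K *v v) (K *v w) = det K * omega v w"
  by (simp add: omega_def matrix_vector_2 det_2 algebra_simps)

lemma omega_linear:
  "omega (m + m') v = omega m v + omega m' v" "omega (m - m') v = omega m v - omega m' v"
  "omega (- m) v = - omega m v" "omega 0 v = 0" "omega m 0 = 0"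
  "omega m (v + w) = omega m v + omega m w"
  by (simp_all add: omega_def algebra_simps)

lemma det_unit: "invertible (K :: int^2^2) \<Longrightarrow> det K = 1 \<or> det K = -1"
  using minv(1)[of K] det_mul[of K "matrix_inv K"] by (auto simp: zmult_eq_1_iff)

lemma det_unit_square: "invertible (K :: int^2^2) \<Longrightarrow> det K * det K = 1"
  using det_unit by fastforce

lemma invertible_det_unit:
  fixes K :: "int^2^2"
  assumes "det K * det K = 1"
  shows "invertible K"
proof -
  let ?d = "det K"
  let ?A = "vector [vector [?d * K $ 2 $ 2, - ?d * K $ 1 $ 2], vector [- ?d * K $ 2 $ 1, ?d * K $ 1 $ 1]] :: int^2^2"
  have "?d * (K $ 1 $ 1 * K $ 2 $ 2 - K $ 1 $ 2 * K $ 2 $ 1) = 1" using assms by (simp add: det_2)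
  then have "K ** ?A = mat 1" "?A ** K = mat 1"
    by (simp_all add: vec_eq_iff forall_2 matrix_matrix_mult_def sum_2 mat_def algebra_simps)
  then show ?thesis unfolding invertible_def by blast
qed

lemma minv_mv:
  assumes "invertible (K :: int^2^2)"
  shows "K *v (matrix_inv K *v v) = v" "matrix_inv K *v (K *v v) = v"
  using assms by (simp_all only: matrix_vector_mul_assoc minv matrix_vector_mul_lid)

lemma omega_minv:
  assumes "invertible (K :: int^2^2)"
  shows "omega m (matrix_inv K *v v) = det K * omega (K *v m) v"
    "omega (matrix_inv K *v m) v = det K * omega m (K *v v)"
  using omega_matrix[of K m "matrix_inv K *v v"] omega_matrix[of K "matrix_inv K *v m" v]
    det_unit_square[OF assms] by (simp_all add: minv_mv[OF assms] algebra_simps)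

lemma det_minv: "invertible (K :: int^2^2) \<Longrightarrow> det (matrix_inv K) = det K"
proof -
  assume K: "invertible K"
  have "det K * det (matrix_inv K) = 1" using minv(1)[OF K] det_mul[of K "matrix_inv K"] by simp
  then show ?thesis using det_unit[OF K] by auto
qed

lemma fst_heis_mult: "fst (x \<otimes>\<^bsub>heis r\<^esub> y) = fst x + fst y"
  by (cases x; cases y) simp

text \<open>The cocycle of the group law is divisible by \<open>r\<close>. This is the reason why the vectors \<open>l\<close> and \<open>m\<close> in the
classification count only modulo \<open>r\<close>.\<close>

lemma snd_heis_mult: "[snd (x \<otimes>\<^bsub>heis r\<^esub> y) = snd x + snd y] (mod int r)"
  by (cases x; cases y) (simp add: cong_iff_dvd_diff)

lemma fst_heis_pow: "fst (x [^]\<^bsub>heis r\<^esub> (n :: int)) = n *s fst x"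
proof -
  have "fst (x [^]\<^bsub>heis r\<^esub> n) $ i = n * fst x $ i" for i
  proof -
    have "(\<lambda>x. fst x $ i) \<in> hom (heis r) integer_group" by (simp add: hom_def fst_heis_mult)
    from hom_int_pow[OF this, of x n] show ?thesis by (simp add: group_heis)
  qed
  then show ?thesis by (simp add: vec_eq_iff)
qed

lemma snd_heis_pow: "[snd (x [^]\<^bsub>heis r\<^esub> (n :: int)) = n * snd x] (mod int r)"
proof -
  interpret group "heis r" by (rule group_heis)
  have "[snd (x [^]\<^bsub>heis r\<^esub> (1 + n)) = snd x + snd (x [^]\<^bsub>heis r\<^esub> n)] (mod int r)" for n :: int
    using snd_heis_mult[of r x "x [^]\<^bsub>heis r\<^esub> n"] by (simp add: int_pow_mult)
  note step = this
  have iff: "[snd (x [^]\<^bsub>heis r\<^esub> (1 + n)) = (1 + n) * snd x] (mod int r) \<longleftrightarrow>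
      [snd (x [^]\<^bsub>heis r\<^esub> n) = n * snd x] (mod int r)" for n :: int
  proof -
    have "[snd (x [^]\<^bsub>heis r\<^esub> (1 + n)) = (1 + n) * snd x] (mod int r) \<longleftrightarrow>
        [snd x + snd (x [^]\<^bsub>heis r\<^esub> n) = snd x + n * snd x] (mod int r)"
      using step[of n] by (simp add: cong_def distrib_right)
    then show ?thesis by (simp only: cong_add_lcancel)
  qed
  show ?thesis
  proof (induction n rule: int_induct[where k = 0])
    case (step1 n) then show ?case using iff[of n] by (simp add: add.commute)
  next
    case (step2 n) then show ?case using iff[of "n - 1"] by simp
  qed simp
qed

lemma heis_hom_fst:
  assumes "f \<in> hom (heis r) (heis r')"
  shows "fst (f (v, z)) = v $ 1 *s fst (f hA) + v $ 2 *s fst (f hB) + z *s fst (f hC)"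
  unfolding heis_hom_eq[OF assms group_heis, of v z] fst_heis_mult fst_heis_pow ..

lemma heis_hom_snd:
  assumes "f \<in> hom (heis r) (heis r')"
  shows "[snd (f (v, z)) = v $ 1 * snd (f hA) + v $ 2 * snd (f hB) + z * snd (f hC)] (mod int r')"
  unfolding heis_hom_eq[OF assms group_heis, of v z]
  by (intro cong_trans[OF snd_heis_mult] cong_add snd_heis_pow)

text \<open>The commutator of \<open>a\<close> and \<open>b\<close> is \<open>(0, r * omega (fst a) (fst b))\<close>, so the conditions make \<open>c\<close> a central
element whose \<open>r\<close>-th power is this commutator.\<close>

lemma heis_hom_exists:
  assumes "fst c = 0" "snd c = omega (fst a) (fst b)"
  obtains f where "f \<in> hom (heis r) (heis r)" "f hA = a" "f hB = b" "f hC = c"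
proof -
  interpret group "heis r" by (rule group_heis)
  obtain t where c: "c = (0, t)" using assms(1) by (metis prod.collapse)
  have "c [^]\<^bsub>heis r\<^esub> int r = (0, int r * snd c)" by (simp add: c heis_pow)
  then have ab: "a \<otimes>\<^bsub>heis r\<^esub> b = b \<otimes>\<^bsub>heis r\<^esub> a \<otimes>\<^bsub>heis r\<^esub> c [^]\<^bsub>heis r\<^esub> int r"
    using heis_commutator[of r a b] assms(2) by simp
  have cc: "x \<otimes>\<^bsub>heis r\<^esub> c = c \<otimes>\<^bsub>heis r\<^esub> x" for x by (cases x) (simp add: c)
  define f where "f = (\<lambda>(v :: int^2, z :: int).
    a [^]\<^bsub>heis r\<^esub> (v $ 1) \<otimes>\<^bsub>heis r\<^esub> b [^]\<^bsub>heis r\<^esub> (v $ 2) \<otimes>\<^bsub>heis r\<^esub> c [^]\<^bsub>heis r\<^esub> z)"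
  have "f \<in> hom (heis r) (heis r)"
    unfolding f_def by (rule heis_universal[OF _ _ _ ab cc cc]) auto
  moreover have "f hA = a" "f hB = b" "f hC = c" by (simp_all add: f_def del: heis_simps(3))
  ultimately show ?thesis by (rule that)
qed

lemma heis_auto_iff: "f \<in> auto (heis r) \<longleftrightarrow> f \<in> iso (heis r) (heis r)"
  by (auto simp: auto_def Bij_def iso_def)

text \<open>The map acts on \<open>\<int>\<^sup>2\<close> by the invertible matrix \<open>K\<close> and on the subgroup generated by \<open>\<gamma>\<close> by the
unit \<open>det K\<close>; being bijective on both, it is bijective.\<close>

lemma heis_autoI:
  assumes f: "f \<in> hom (heis r) (heis r)" and K: "invertible K"
    and gens: "fst (f hA) = K *v vector [1, 0]" "fst (f hB) = K *v vector [0, 1]" "f hC = (0, det K)"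
  shows "f \<in> auto (heis r)" "fst (f (v, z)) = K *v v" "f (0, z) = (0, det K * z)"
proof -
  have 1: "fst (f (v, z)) = K *v v" for v z
    unfolding heis_hom_fst[OF f, of v z] gens
    by (simp add: vec_eq_iff forall_2 matrix_vector_2 algebra_simps)
  have 2: "f (0, z) = (0, det K * z)" for z
    unfolding heis_hom_eq[OF f group_heis, of 0 z] gens(3) by (simp add: heis_pow mult.commute)
  show "fst (f (v, z)) = K *v v" "f (0, z) = (0, det K * z)" by (rule 1, rule 2)
  have shift: "f (v, z + t) = (fst (f (v, z)), snd (f (v, z)) + det K * t)" for v z t
    using hom_mult[OF f, of "(v, z)" "(0, t)"] by (cases "f (v, z)") (simp add: 2)
  have "inj f"
  proof (rule injI)
    fix x y assume xy: "f x = f y"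
    have "K *v fst x = K *v fst y" using xy 1[of "fst x" "snd x"] 1[of "fst y" "snd y"] by simp
    then have v: "fst x = fst y" using minv_mv(2)[OF K] by metis
    have "f x = (fst (f y), snd (f y) + det K * (snd x - snd y))"
      using shift[of "fst y" "snd y" "snd x - snd y"] v by (metis add_diff_cancel_left' diff_add_cancel add.commute prod.collapse)
    then have "snd x = snd y" using xy det_unit[OF K] by (auto simp: prod_eq_iff)
    then show "x = y" using v by (simp add: prod_eq_iff)
  qed
  moreover have "surj f"
  proof (rule surjI)
    fix y :: "(int^2) \<times> int"
    let ?v = "matrix_inv K *v fst y"
    show "f (?v, 0 + det K * (snd y - snd (f (?v, 0)))) = y"
      unfolding shift 1 using det_unit_square[OF K] by (simp add: minv_mv[OF K] flip: mult.assoc)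
  qed
  ultimately show "f \<in> auto (heis r)" unfolding heis_auto_iff using f by (simp add: iso_def bij_def bij_betw_def)
qed

lemma heis_center: "group_center (heis r) = (if r = 0 then UNIV else {0} \<times> UNIV)"
proof -
  have "fst z = 0" if "r \<noteq> 0" "\<forall>h. z \<otimes>\<^bsub>heis r\<^esub> h = h \<otimes>\<^bsub>heis r\<^esub> z" for z
    using that(2)[rule_format, of hA] that(2)[rule_format, of hB] that(1)
    by (cases z) (auto simp: vec_eq_iff forall_2)
  moreover have "r = 0 \<Longrightarrow> x \<otimes>\<^bsub>heis r\<^esub> y = y \<otimes>\<^bsub>heis r\<^esub> x" for x y
    by (cases x; cases y) (simp add: add.commute)
  ultimately show ?thesis unfolding group_center_def by auto
qed

lemma iso_center:
  assumes f: "f \<in> iso H H'" and z: "z \<in> group_center H"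
  shows "f z \<in> group_center H'"
proof -
  have "f z \<otimes>\<^bsub>H'\<^esub> h = h \<otimes>\<^bsub>H'\<^esub> f z" if "h \<in> carrier H'" for h
  proof -
    obtain k where k: "k \<in> carrier H" "h = f k" using f \<open>h \<in> carrier H'\<close> by (auto simp: iso_def bij_betw_def)
    then have "f (z \<otimes>\<^bsub>H\<^esub> k) = f (k \<otimes>\<^bsub>H\<^esub> z)" using z by (simp add: group_center_def)
    moreover have "f \<in> hom H H'" "z \<in> carrier H" using f z by (auto simp: iso_def group_center_def)
    ultimately show ?thesis using k by (simp add: hom_mult)
  qed
  then show ?thesis using f z by (auto simp: group_center_def iso_def hom_def)
qed

text \<open>An isomorphism preserves centres, so it induces a matrix \<open>K\<close> on the quotients \<open>\<int>\<^sup>2\<close> and sends \<open>\<gamma>\<close> to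
\<open>\<gamma>\<^sup>\<epsilon>\<close> for some integer \<open>\<epsilon>\<close>. Applying it to the commutator relation of \<open>\<alpha>\<close> and \<open>\<beta>\<close> gives
\<open>r * \<epsilon> = r' * det K\<close>. The inverse isomorphism shows that \<open>\<epsilon>\<close> and \<open>det K\<close> are \<open>\<plusminus>1\<close>, and since \<open>r\<close> and
\<open>r'\<close> are positive, \<open>r = r'\<close> and \<open>\<epsilon> = det K\<close>.\<close>

lemma heis_iso_matrix:
  assumes f: "f \<in> iso (heis r) (heis r')" and r: "r \<ge> 1" "r' \<ge> 1"
  shows "r = r'"
    "\<exists>K. invertible K \<and> (\<forall>v z. fst (f (v, z)) = K *v v) \<and> (\<forall>z. f (0, z) = (0, det K * z))"
proof -
  interpret M: group "heis r" by (rule group_heis)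
  define M :: "_ \<Rightarrow> int^2^2" where "M g = (\<chi> i j. fst (g (if j = 1 then hA else hB)) $ i)" for g :: "(int^2) \<times> int \<Rightarrow> (int^2) \<times> int"
  have main: "(\<forall>v z. fst (g (v, z)) = M g *v v) \<and> (\<forall>z. g (0, z) = (0, z * snd (g hC)))
      \<and> int s * snd (g hC) = int s' * det (M g)"
    if g: "g \<in> iso (heis s) (heis s')" and s: "s \<ge> 1" "s' \<ge> 1" for g s s'
  proof -
    interpret M': group "heis s'" by (rule group_heis)
    have cancel: "x = y" if "a \<otimes>\<^bsub>heis s'\<^esub> x = a \<otimes>\<^bsub>heis s'\<^esub> y" for a x y
      by (rule iffD1[OF M'.Units_l_cancel, OF _ _ _ that]) (simp_all add: M'.Units_eq)
    have hom: "g \<in> hom (heis s) (heis s')" using g by (simp add: iso_def)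
    have c: "fst (g hC) = 0" using iso_center[OF g, of hC] s by (simp add: heis_center split: prod.splits)
       (metis mem_Times_iff singletonD)
    have 1: "fst (g (v, z)) = M g *v v" for v z
      unfolding heis_hom_fst[OF hom, of v z] c
      by (simp add: M_def vec_eq_iff forall_2 matrix_vector_2 mult.commute)
    have 2: "g (0, z) = (0, z * snd (g hC))" for z
      using c unfolding heis_hom_eq[OF hom group_heis, of 0 z] by (cases "g hC") (simp add: heis_pow)
    have "g (hA \<otimes>\<^bsub>heis s\<^esub> hB) = g (hB \<otimes>\<^bsub>heis s\<^esub> hA \<otimes>\<^bsub>heis s\<^esub> (0, int s))"
      by (rule arg_cong[where f = g]) (simp add: vec_eq_iff forall_2)
    then have "g hA \<otimes>\<^bsub>heis s'\<^esub> g hB = g hB \<otimes>\<^bsub>heis s'\<^esub> g hA \<otimes>\<^bsub>heis s'\<^esub> g (0, int s)"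
      by (simp only: hom_mult[OF hom] heis_simps(1) UNIV_I)
    then have "g hB \<otimes>\<^bsub>heis s'\<^esub> g hA \<otimes>\<^bsub>heis s'\<^esub> (0, int s' * omega (fst (g hA)) (fst (g hB)))
       = g hB \<otimes>\<^bsub>heis s'\<^esub> g hA \<otimes>\<^bsub>heis s'\<^esub> g (0, int s)"
      by (rule HOL.trans[OF HOL.sym[OF heis_commutator]])
    then have "g (0, int s) = (0, int s' * omega (fst (g hA)) (fst (g hB)))"
      by (rule HOL.sym[OF cancel])
    then have "int s * snd (g hC) = int s' * omega (fst (g hA)) (fst (g hB))"
      unfolding 2[of "int s"] by simp
    then have "int s * snd (g hC) = int s' * det (M g)" by (simp add: M_def omega_def det_2 algebra_simps)
    then show ?thesis using 1 2 by blast
  qed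
  define g where "g = inv_into UNIV f"
  have g: "g \<in> iso (heis r') (heis r)" using M.iso_set_sym[OF f] by (simp add: g_def)
  have fg: "f (g x) = x" and gf: "g (f x) = x" for x
    using f by (auto simp: g_def iso_def bij_betw_def f_inv_into_f)
  note F = main[OF f r] and G = main[OF g r(2,1)]
  have "M f *v (M g *v v) = v" "M g *v (M f *v v) = v" for v
  proof -
    have "M f *v fst (g (v, 0)) = v" using F fg[of "(v, 0)"] by (metis fst_conv prod.collapse)
    then show "M f *v (M g *v v) = v" using G by simp
    have "M g *v fst (f (v, 0)) = v" using G gf[of "(v, 0)"] by (metis fst_conv prod.collapse)
    then show "M g *v (M f *v v) = v" using F by simp
  qed
  then have "M f ** M g = mat 1" "M g ** M f = mat 1"
    by (simp_all add: matrix_eq flip: matrix_vector_mul_assoc)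
  then have K: "invertible (M f)" unfolding invertible_def by blast
  have "g (f hC) = (0, snd (f hC) * snd (g hC))" using F G by (metis mult_1)
  then have u: "snd (f hC) * snd (g hC) = 1" using gf[of hC] by simp
  then have "snd (f hC) = 1 \<or> snd (f hC) = -1" by (simp add: zmult_eq_1_iff) blast
  moreover have eq: "int r * snd (f hC) = int r' * det (M f)" using F by blast
  ultimately have "r = r' \<and> snd (f hC) = det (M f)" using det_unit[OF K] r by auto
  then have r: "r = r'" and d: "snd (f hC) = det (M f)" by blast+
  show "r = r'" by (rule r)
  have "\<forall>z. f (0, z) = (0, det (M f) * z)" using F unfolding d by (simp add: mult.commute)
  then show "\<exists>K. invertible K \<and> (\<forall>v z. fst (f (v, z)) = K *v v) \<and> (\<forall>z. f (0, z) = (0, det K * z))"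
    using K F by blast
qed

text \<open>The class of \<open>f\<close> in the outer automorphism group, which is \<open>GL(2,\<int>) \<ltimes> (\<int>/r\<int>)\<^sup>2\<close>: only the residue class
of \<open>m\<close> modulo \<open>r\<close> matters. The factor \<open>det K\<close> is the action on the centre. Taking \<open>m\<close> inside this
factor is the normalisation for which composition becomes the multiplication of \<open>GL2_Z2\<close>.\<close>

definition has_symbol :: "nat \<Rightarrow> ((int^2) \<times> int \<Rightarrow> (int^2) \<times> int) \<Rightarrow> int^2^2 \<Rightarrow> int^2 \<Rightarrow> bool" where
  "has_symbol r f K m \<longleftrightarrow> f \<in> auto (heis r) \<and> invertible K \<and>
     (\<forall>v z. fst (f (v, z)) = K *v v \<and> [snd (f (v, z)) = det K * (z + omega m v)] (mod int r))"

definition vec_cong :: "nat \<Rightarrow> int^2 \<Rightarrow> int^2 \<Rightarrow> bool" where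
  "vec_cong r l l' \<longleftrightarrow> (\<forall>i. [l $ i = l' $ i] (mod int r))"

lemma vec_cong_omega: "vec_cong r m m' \<Longrightarrow> [omega m v = omega m' v] (mod int r)"
  unfolding vec_cong_def omega_def by (intro cong_diff cong_mult) auto

lemma has_symbolI:
  assumes f: "f \<in> hom (heis r) (heis r)" and K: "invertible K"
    and gens: "fst (f hA) = K *v vector [1, 0]" "fst (f hB) = K *v vector [0, 1]" "f hC = (0, det K)"
    and snds: "[snd (f hA) = - det K * m $ 2] (mod int r)" "[snd (f hB) = det K * m $ 1] (mod int r)"
  shows "has_symbol r f K m"
proof -
  have "[snd (f (v, z)) = det K * (z + omega m v)] (mod int r)" for v z
  proof -
    have "[v $ 1 * snd (f hA) + v $ 2 * snd (f hB) + z * snd (f hC)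
        = v $ 1 * (- det K * m $ 2) + v $ 2 * (det K * m $ 1) + z * det K] (mod int r)"
      using snds by (intro cong_add cong_mult) (auto simp: gens)
    also have "v $ 1 * (- det K * m $ 2) + v $ 2 * (det K * m $ 1) + z * det K = det K * (z + omega m v)"
      by (simp add: omega_def algebra_simps)
    finally show ?thesis using cong_trans[OF heis_hom_snd[OF f]] by blast
  qed
  then show ?thesis using heis_autoI[OF f K gens] K unfolding has_symbol_def by blast
qed

text \<open>The exact values on the generators are needed as well as the symbol, because \<open>osc_aut\<close> is specified by
values and not by congruences.\<close>

lemma has_symbol_exists:
  assumes K: "invertible K"
  obtains f where "has_symbol r f K m"
    "f hA = (K *v vector [1, 0], - det K * m $ 2)" "f hB = (K *v vector [0, 1], det K * m $ 1)" "f hC = (0, det K)"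
proof -
  have "omega (K *v vector [1, 0]) (K *v vector [0, 1]) = det K" by (simp add: omega_matrix) (simp add: omega_def)
  then obtain f where "f \<in> hom (heis r) (heis r)" "f hA = (K *v vector [1, 0], - det K * m $ 2)"
      "f hB = (K *v vector [0, 1], det K * m $ 1)" "f hC = (0, det K)"
    using heis_hom_exists[of "(0, det K)" "(K *v vector [1, 0], - det K * m $ 2)" "(K *v vector [0, 1], det K * m $ 1)" r]
    by auto
  then show ?thesis using that has_symbolI[of f r K m] K by simp
qed

lemma auto_has_symbol:
  assumes f: "f \<in> auto (heis r)" and r: "r \<ge> 1"
  obtains K m where "has_symbol r f K m"
proof -
  have iso: "f \<in> iso (heis r) (heis r)" using f by (simp add: heis_auto_iff)
  from heis_iso_matrix(2)[OF iso r r] obtain K where K: "invertible K"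
    and 1: "\<And>v z. fst (f (v, z)) = K *v v" and 2: "\<And>z. f (0, z) = (0, det K * z)" by blast
  let ?m = "vector [det K * snd (f hB), - det K * snd (f hA)] :: int^2"
  have "has_symbol r f K ?m"
    by (rule has_symbolI[OF auto_hom[OF f] K]) (simp_all add: 1 2 det_unit_square[OF K] flip: mult.assoc)
  then show ?thesis by (rule that)
qed

lemma has_symbol_unique:
  assumes "has_symbol r f K m" "has_symbol r f K' m'"
  shows "K = K'" "vec_cong r m m'"
proof -
  have "K *v v = K' *v v" for v using assms unfolding has_symbol_def by metis
  then show KK: "K = K'" by (simp add: matrix_eq)
  have "[omega m v = omega m' v] (mod int r)" for v
  proof -
    have "[det K * omega m v = det K * omega m' v] (mod int r)"
    proof -
      have 1: "[snd (f (v, 0)) = det K * (0 + omega m v)] (mod int r)"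
        using assms(1) unfolding has_symbol_def by fast
      have 2: "[snd (f (v, 0)) = det K' * (0 + omega m' v)] (mod int r)"
        using assms(2) unfolding has_symbol_def by fast
      show ?thesis using cong_trans[OF cong_sym[OF 1] 2] unfolding KK add_0 .
    qed
    then have "[det K * (det K * omega m v) = det K * (det K * omega m' v)] (mod int r)"
      by (rule cong_scalar_left)
    then show ?thesis using det_unit_square[of K] assms by (simp add: has_symbol_def flip: mult.assoc)
  qed
  from this[of "vector [0, 1]"] this[of "vector [-1, 0]"] show "vec_cong r m m'"
    by (simp add: vec_cong_def forall_2 omega_def)
qed

text \<open>The vector \<open>m\<close> moves past \<open>K'\<close> by \<open>omega m (K' v) = det K' * omega (K'\<inverse> m) v\<close>. The result is the
multiplication of \<open>GL2_Z2\<close>.\<close>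

lemma has_symbol_compose:
  assumes f: "has_symbol r f K m" and g: "has_symbol r g K' m'"
  shows "has_symbol r (f \<otimes>\<^bsub>AutoGroup (heis r)\<^esub> g) (K ** K') (matrix_inv K' *v m + m')"
proof -
  interpret A: group "AutoGroup (heis r)" by (rule group.AutoGroup[OF group_heis])
  have au: "f \<in> auto (heis r)" "g \<in> auto (heis r)" and K: "invertible K" "invertible K'"
    using f g by (auto simp: has_symbol_def)
  have "[snd (f (g (v, z))) = det (K ** K') * (z + omega (matrix_inv K' *v m + m') v)] (mod int r)" for v z
  proof -
    have 1: "[snd (f (g (v, z))) = det K * (snd (g (v, z)) + omega m (fst (g (v, z))))] (mod int r)"
      using f unfolding has_symbol_def by (metis prod.collapse)
    have "[det K * (snd (g (v, z)) + omega m (fst (g (v, z))))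
        = det K * (det K' * (z + omega m' v) + omega m (K' *v v))] (mod int r)"
      using g unfolding has_symbol_def by (intro cong_mult cong_add) auto
    also have "omega m (K' *v v) = det K' * omega (matrix_inv K' *v m) v"
      using det_unit_square[OF K(2)] by (simp add: omega_minv[OF K(2)] flip: mult.assoc)
    also have "det K * (det K' * (z + omega m' v) + det K' * omega (matrix_inv K' *v m) v)
        = det (K ** K') * (z + omega (matrix_inv K' *v m + m') v)"
      by (simp add: det_mul omega_linear algebra_simps)
    finally show ?thesis by (rule cong_trans[OF 1])
  qed
  moreover have "fst (f (g (v, z))) = (K ** K') *v v" for v z
    using f g unfolding has_symbol_def by (metis matrix_vector_mul_assoc prod.collapse)
  ultimately show ?thesis using au A.m_closed[of f g] K
    by (simp add: has_symbol_def AutoGroup_mult_apply minv_mult)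
qed

lemma has_symbol_cong: "has_symbol r f K m \<Longrightarrow> vec_cong r m m' \<Longrightarrow> has_symbol r f K m'"
  unfolding has_symbol_def by (meson cong_add cong_mult cong_refl cong_trans vec_cong_omega)

text \<open>This is the formula by which the sign \<open>-1\<close> acts on \<open>(B, l)\<close>.\<close>

lemma has_symbol_inv:
  assumes f: "has_symbol r f K m"
  shows "has_symbol r (inv\<^bsub>AutoGroup (heis r)\<^esub> f) (matrix_inv K) (- (K *v m))"
proof -
  interpret A: group "AutoGroup (heis r)" by (rule group.AutoGroup[OF group_heis])
  let ?g = "inv\<^bsub>AutoGroup (heis r)\<^esub> f"
  have au: "f \<in> auto (heis r)" and K: "invertible K" using f by (auto simp: has_symbol_def)
  have g: "?g \<in> auto (heis r)" using A.inv_closed[of f] au by simp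
  have "fst (?g (v, z)) = matrix_inv K *v v \<and>
      [snd (?g (v, z)) = det (matrix_inv K) * (z + omega (- (K *v m)) v)] (mod int r)" for v z
  proof -
    obtain w u where wu: "?g (v, z) = (w, u)" by fastforce
    have "f (w, u) = (v, z)" using AutoGroup_inv_apply(1)[OF group_heis au, of "(v, z)"] wu by simp
    then have 1: "K *v w = v" and 2: "[z = det K * (u + omega m w)] (mod int r)"
      using f unfolding has_symbol_def by (metis fst_conv, metis snd_conv)
    have w: "w = matrix_inv K *v v" using 1 minv_mv(2)[OF K] by metis
    have "[det K * z = det K * (det K * (u + omega m w))] (mod int r)" using 2 by (rule cong_scalar_left)
    then have "[det K * z - omega m w = u + omega m w - omega m w] (mod int r)"
      using det_unit_square[OF K] by (intro cong_diff cong_refl) (simp flip: mult.assoc)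
    then have "[u = det K * z - omega m w] (mod int r)" by (simp add: cong_sym_eq)
    then show ?thesis using wu w K
      by (simp add: det_minv omega_minv(1) omega_linear algebra_simps)
  qed
  then show ?thesis using g K by (simp add: has_symbol_def invertible_minv)
qed

lemma has_symbol_center:
  assumes "has_symbol r f K m" "r \<ge> 1"
  shows "f (0, z) = (0, det K * z)"
proof -
  have f: "f \<in> iso (heis r) (heis r)" using assms by (simp add: has_symbol_def heis_auto_iff)
  from heis_iso_matrix(2)[OF f assms(2,2)] obtain K' where
    1: "\<And>v z. fst (f (v, z)) = K' *v v" and 2: "\<And>z. f (0, z) = (0, det K' * z)" by blast
  have "K' *v v = K *v v" for v using assms 1 unfolding has_symbol_def by metis
  then have "K' = K" by (simp add: matrix_eq)
  then show ?thesis using 2 by simp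
qed

text \<open>Conjugation by \<open>k\<close> changes only the last coordinate, and only by multiples of \<open>r\<close>, so it cannot be
seen in symbols.\<close>

lemma heis_conj_iff:
  "y \<otimes>\<^bsub>heis r\<^esub> k = k \<otimes>\<^bsub>heis r\<^esub> x \<longleftrightarrow> y = (fst x, snd x + int r * omega (fst k) (fst x))"
  by (cases x; cases y; cases k) (auto simp: omega_def algebra_simps)

lemma has_symbol_conj:
  assumes f: "has_symbol r f K m" and g: "g \<in> auto (heis r)"
    and conj: "\<And>x. g x \<otimes>\<^bsub>heis r\<^esub> k = k \<otimes>\<^bsub>heis r\<^esub> f x"
  shows "has_symbol r g K m"
proof -
  have gf: "g x = (fst (f x), snd (f x) + int r * omega (fst k) (fst (f x)))" for x
    using conj[of x] by (simp only: heis_conj_iff)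
  have "[snd (g x) = snd (f x)] (mod int r)" for x unfolding gf by (simp add: cong_iff_dvd_diff)
  then show ?thesis using f g gf unfolding has_symbol_def by (metis cong_trans fst_conv)
qed

text \<open>The two automorphisms agree up to factors \<open>\<gamma>\<^sup>r\<^sup>s\<close> and \<open>\<gamma>\<^sup>r\<^sup>t\<close> on \<open>\<alpha>\<close> and \<open>\<beta>\<close>. Conjugation by an element over
\<open>p\<close> in \<open>\<int>\<^sup>2\<close> multiplies the value at \<open>\<alpha>\<close> by \<open>\<gamma>\<close> to the power \<open>r * omega p (K e\<^sub>1)\<close>, and similarly at \<open>\<beta>\<close>.
As \<open>omega\<close> is unimodular and \<open>K\<close> is invertible over the integers, some \<open>p\<close> achieves any given \<open>s\<close> and \<open>t\<close>.\<close>

theorem same_symbol_conj: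
  assumes r: "r \<ge> 1" and f: "has_symbol r f K m" and g: "has_symbol r g K m"
  obtains k where "\<And>x. g x \<otimes>\<^bsub>heis r\<^esub> k = k \<otimes>\<^bsub>heis r\<^esub> f x"
proof -
  have K: "invertible K" using f by (simp add: has_symbol_def)
  have fst: "fst (f (v, z)) = K *v v" "fst (g (v, z)) = K *v v" for v z using f g by (auto simp: has_symbol_def)
  have "[snd (g x) = snd (f x)] (mod int r)" for x
    using f g unfolding has_symbol_def by (metis cong_sym cong_trans prod.collapse)
  then have "\<exists>t. snd (g x) = snd (f x) + int r * t" for x
    using cong_sym cong_iff_lin by metis
  then obtain s t where s: "snd (g hA) = snd (f hA) + int r * s" and t: "snd (g hB) = snd (f hB) + int r * t"
    by metis
  \<comment> \<open>The solution of \<open>omega p (K e\<^sub>1) = s\<close> and \<open>omega p (K e\<^sub>2) = t\<close>; the factors \<open>det K\<close> cancel the one in \<open>omega_matrix\<close>.\<close>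
  define p where "p = K *v vector [det K * t, - det K * s]"
  have p: "omega p (K *v vector [1, 0]) = s" "omega p (K *v vector [0, 1]) = t"
    unfolding p_def omega_matrix using det_unit_square[OF K] by (simp_all add: omega_def flip: mult.assoc)
  let ?c = "\<lambda>x. (fst x, snd x + int r * omega p (fst x))"
  have "?c \<in> hom (heis r) (heis r)"
    by (rule homI) (auto simp: omega_linear algebra_simps)
  then have c: "?c \<circ> f \<in> hom (heis r) (heis r)"
    using f by (intro hom_compose[OF auto_hom]) (auto simp: has_symbol_def)
  have "g x = (?c \<circ> f) x" for x
  proof (rule heis_hom_eqI[OF _ c group_heis])
    show "g \<in> hom (heis r) (heis r)" using g by (auto simp: has_symbol_def auto_hom)
  qed (simp_all add: prod_eq_iff fst s t p has_symbol_center[OF f r] has_symbol_center[OF g r] omega_linear)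
  then have "g x \<otimes>\<^bsub>heis r\<^esub> (p, 0) = (p, 0) \<otimes>\<^bsub>heis r\<^esub> f x" for x
    by (simp only: heis_conj_iff fst_conv o_apply)
  then show ?thesis by (rule that)
qed


section \<open>Extensions of the Heisenberg group\<close>

text \<open>The value at \<open>\<gamma>\<close> is zero because \<open>\<gamma>\<^sup>r\<close> is a commutator. On \<open>\<int>\<^sup>2\<close> the homomorphism is then a row vector
fixed by \<open>B\<close>, which must vanish since \<open>det (B - 1) = 2 - trace B\<close> is not zero.\<close>

lemma heis_extension_hom_int:
  assumes r: "r \<ge> 1" and B: "B \<in> SL2_trace_gt2" and f: "has_symbol r f B l"
    and \<xi>: "\<xi> \<in> hom (cyclic_extension (heis r) f) integer_group"
  shows "\<xi> (h, 0) = 0"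
proof -
  have au: "f \<in> auto (heis r)" using f by (simp add: has_symbol_def)
  let ?G = "cyclic_extension (heis r) f"
  note simps = cyclic_extension_simps[OF group_heis au]
  define c where "c h = \<xi> (h, 0)" for h
  have "c = \<xi> \<circ> (\<lambda>h. (h, 0))" by (simp add: c_def fun_eq_iff)
  then have c: "c \<in> hom (heis r) integer_group"
    using hom_compose[OF fibre_hom_cyclic_extension[OF group_heis au] \<xi>] by simp
  have inv: "c (f x) = c x" for x
  proof -
    have eq: "(f x, 0) \<otimes>\<^bsub>?G\<^esub> (\<one>\<^bsub>heis r\<^esub>, 1) = (\<one>\<^bsub>heis r\<^esub>, 1) \<otimes>\<^bsub>?G\<^esub> (x, 0)"
      using group.is_monoid[OF group_heis, of r]
      by (simp add: simps auto_power_1[OF group_heis au, simplified] AutoGroup_one_apply monoid.l_one monoid.r_one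
          del: heis_simps(3))
    have "\<xi> ((f x, 0) \<otimes>\<^bsub>?G\<^esub> (\<one>\<^bsub>heis r\<^esub>, 1)) = \<xi> (f x, 0) + \<xi> (\<one>\<^bsub>heis r\<^esub>, 1)"
      using hom_mult[OF \<xi>, of "(f x, 0)" "(\<one>\<^bsub>heis r\<^esub>, 1)"] by (simp add: simps(1))
    moreover have "\<xi> ((\<one>\<^bsub>heis r\<^esub>, 1) \<otimes>\<^bsub>?G\<^esub> (x, 0)) = \<xi> (\<one>\<^bsub>heis r\<^esub>, 1) + \<xi> (x, 0)"
      using hom_mult[OF \<xi>, of "(\<one>\<^bsub>heis r\<^esub>, 1)" "(x, 0)"] by (simp add: simps(1))
    ultimately show ?thesis using eq by (simp add: c_def)
  qed
  have form: "c (v, z) = v $ 1 * c hA + v $ 2 * c hB + z * c hC" for v z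
    using heis_hom_eq[OF c group_integer_group, of v z] by simp
  have cC: "c hC = 0"
  proof -
    have "c (hA \<otimes>\<^bsub>heis r\<^esub> hB) = c (hB \<otimes>\<^bsub>heis r\<^esub> hA \<otimes>\<^bsub>heis r\<^esub> (0, int r))"
      by (rule arg_cong[where f = c]) (simp add: vec_eq_iff forall_2)
    then have "c (0, int r) = 0" by (simp only: hom_mult[OF c] heis_simps(1) UNIV_I mult_integer_group)
    then have "int r * c hC = 0" using form[of 0 "int r"] by simp
    then show ?thesis using r by simp
  qed
  have val: "c hA * B $ 1 $ 1 + c hB * B $ 2 $ 1 = c hA" "c hA * B $ 1 $ 2 + c hB * B $ 2 $ 2 = c hB"
  proof -
    have "c (f (v, 0)) = (B *v v) $ 1 * c hA + (B *v v) $ 2 * c hB" for v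
      using form[of "fst (f (v, 0))" "snd (f (v, 0))"] f by (simp add: has_symbol_def cC)
    from this[of "vector [1, 0]"] this[of "vector [0, 1]"]
    show "c hA * B $ 1 $ 1 + c hB * B $ 2 $ 1 = c hA" "c hA * B $ 1 $ 2 + c hB * B $ 2 $ 2 = c hB"
      by (simp_all add: inv matrix_vector_2 mult.commute)
  qed
  have det: "B $ 1 $ 1 * B $ 2 $ 2 - B $ 1 $ 2 * B $ 2 $ 1 = 1" and tr: "B $ 1 $ 1 + B $ 2 $ 2 > 2"
    using B by (auto simp: SL2_trace_gt2_def det_2 trace_def sum_2)
  \<comment> \<open>The determinant of \<open>B - 1\<close>; the linear system \<open>val\<close> is solved by Cramer's rule.\<close>
  let ?e = "(B $ 1 $ 1 - 1) * (B $ 2 $ 2 - 1) - B $ 1 $ 2 * B $ 2 $ 1"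
  have e: "?e = 2 - (B $ 1 $ 1 + B $ 2 $ 2)" using det by (simp add: algebra_simps)
  have "c hA * ?e = (c hA * B $ 1 $ 1 + c hB * B $ 2 $ 1 - c hA) * (B $ 2 $ 2 - 1)
      - (c hA * B $ 1 $ 2 + c hB * B $ 2 $ 2 - c hB) * B $ 2 $ 1" by (simp add: algebra_simps)
  then have "c hA = 0" using val e tr by simp
  moreover have "c hB * ?e = (c hA * B $ 1 $ 2 + c hB * B $ 2 $ 2 - c hB) * (B $ 1 $ 1 - 1)
      - (c hA * B $ 1 $ 1 + c hB * B $ 2 $ 1 - c hA) * B $ 1 $ 2" by (simp add: algebra_simps)
  then have "c hB = 0" using val e tr by simp
  ultimately have "c h = 0" using form[of "fst h" "snd h"] cC by simp
  then show ?thesis by (simp add: c_def)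
qed

lemma vec_cong_sym: "vec_cong r l l' \<Longrightarrow> vec_cong r l' l"
  by (simp add: vec_cong_def cong_sym_eq)

lemma has_symbol_power:
  assumes f: "has_symbol r f B l" and e: "e = 1 \<or> e = (-1 :: int)"
  shows "has_symbol r (f [^]\<^bsub>AutoGroup (heis r)\<^esub> e)
    (if e = 1 then B else matrix_inv B) (if e = 1 then l else - (B *v l))"
proof -
  have "f \<in> auto (heis r)" using f by (simp add: has_symbol_def)
  note pow = auto_power_1[OF group_heis this] auto_power_minus_1[OF group_heis this]
  show ?thesis using e f has_symbol_inv[OF f] by (auto simp: pow)
qed

text \<open>Up to inner automorphisms the condition on \<open>\<theta>\<close> is \<open>\<theta> f = f'\<^sup>e \<theta>\<close>. For symbols it becomes
\<open>(K, m) (B, l) = (B', l')\<^sup>e (K, m)\<close>, and the right-hand side of the equivalence is this equation multiplied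
out.\<close>

theorem heis_extension_iso_iff:
  assumes r: "r \<ge> 1" "r' \<ge> 1" and B: "B \<in> SL2_trace_gt2" "B' \<in> SL2_trace_gt2"
    and f: "has_symbol r f B l" and f': "has_symbol r' f' B' l'"
  shows "cyclic_extension (heis r) f \<cong> cyclic_extension (heis r') f' \<longleftrightarrow>
    r = r' \<and> (\<exists>K m. \<exists>e\<in>{1, -1 :: int}. invertible K \<and>
      K ** B = (if e = 1 then B' else matrix_inv B') ** K \<and>
      vec_cong r (matrix_inv B *v m + l)
        (matrix_inv K *v (if e = 1 then l' else - (B' *v l')) + m))"
    (is "?iso \<longleftrightarrow> r = r' \<and> ?conj")
proof
  have au: "f \<in> auto (heis r)" "f' \<in> auto (heis r')" using f f' by (auto simp: has_symbol_def)
  let ?A = "AutoGroup (heis r)"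
  {
    assume ?iso
    then obtain \<theta> k e where \<theta>: "\<theta> \<in> iso (heis r) (heis r')" and e: "e = 1 \<or> e = (-1 :: int)"
      and conj: "\<And>x. \<theta> (f x) \<otimes>\<^bsub>heis r'\<^esub> k = k \<otimes>\<^bsub>heis r'\<^esub> (f' [^]\<^bsub>AutoGroup (heis r')\<^esub> e) (\<theta> x)"
      using cyclic_extension_isoD[OF group_heis au(1) group_heis au(2)]
        heis_extension_hom_int[OF r(1) B(1) f] heis_extension_hom_int[OF r(2) B(2) f']
      by (metis UNIV_I heis_simps(1))
    have rr: "r = r'" by (rule heis_iso_matrix(1)[OF \<theta> r])
    have \<theta>a: "\<theta> \<in> auto (heis r)" using \<theta> rr by (simp add: heis_auto_iff)
    then obtain K m where K: "has_symbol r \<theta> K m" using auto_has_symbol[OF _ r(1)] by blast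
    let ?P = "if e = 1 then B' else matrix_inv B'" and ?q = "if e = 1 then l' else - (B' *v l')"
    have p: "has_symbol r (f' [^]\<^bsub>?A\<^esub> e) ?P ?q" using has_symbol_power[OF f' e] rr by simp
    then have pa: "f' [^]\<^bsub>?A\<^esub> e \<in> auto (heis r)" by (simp add: has_symbol_def)
    have 1: "has_symbol r (\<theta> \<otimes>\<^bsub>?A\<^esub> f) (K ** B) (matrix_inv B *v m + l)"
      by (rule has_symbol_compose[OF K f])
    have "has_symbol r (\<theta> \<otimes>\<^bsub>?A\<^esub> f) (?P ** K) (matrix_inv K *v ?q + m)"
    proof (rule has_symbol_conj[OF has_symbol_compose[OF p K]])
      show "\<theta> \<otimes>\<^bsub>?A\<^esub> f \<in> auto (heis r)" using 1 by (simp add: has_symbol_def)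
      show "(\<theta> \<otimes>\<^bsub>?A\<^esub> f) x \<otimes>\<^bsub>heis r\<^esub> k = k \<otimes>\<^bsub>heis r\<^esub> (f' [^]\<^bsub>?A\<^esub> e \<otimes>\<^bsub>?A\<^esub> \<theta>) x" for x
        using conj[of x] rr AutoGroup_mult_apply[OF \<theta>a au(1)] AutoGroup_mult_apply[OF pa \<theta>a] by simp
    qed
    from has_symbol_unique[OF 1 this] have "K ** B = ?P ** K"
      "vec_cong r (matrix_inv B *v m + l) (matrix_inv K *v ?q + m)" .
    moreover have "invertible K" using K by (simp add: has_symbol_def)
    ultimately show "r = r' \<and> ?conj" using rr e by blast
  next
    assume "r = r' \<and> ?conj"
    then obtain K m e where rr: "r = r'" and e: "e = 1 \<or> e = (-1 :: int)" and K: "invertible K"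
      and eq: "K ** B = (if e = 1 then B' else matrix_inv B') ** K"
        "vec_cong r (matrix_inv B *v m + l) (matrix_inv K *v (if e = 1 then l' else - (B' *v l')) + m)"
      by blast
    obtain \<theta> where \<theta>: "has_symbol r \<theta> K m" using has_symbol_exists[OF K] by metis
    then have \<theta>a: "\<theta> \<in> auto (heis r)" by (simp add: has_symbol_def)
    let ?P = "if e = 1 then B' else matrix_inv B'" and ?q = "if e = 1 then l' else - (B' *v l')"
    have p: "has_symbol r (f' [^]\<^bsub>?A\<^esub> e) ?P ?q" using has_symbol_power[OF f' e] rr by simp
    then have pa: "f' [^]\<^bsub>?A\<^esub> e \<in> auto (heis r)" by (simp add: has_symbol_def)
    have 1: "has_symbol r (\<theta> \<otimes>\<^bsub>?A\<^esub> f) (?P ** K) (matrix_inv K *v ?q + m)"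
      using has_symbol_cong[OF has_symbol_compose[OF \<theta> f] eq(2)] unfolding eq(1) .
    obtain k where k: "\<And>x. (\<theta> \<otimes>\<^bsub>?A\<^esub> f) x \<otimes>\<^bsub>heis r\<^esub> k = k \<otimes>\<^bsub>heis r\<^esub> (f' [^]\<^bsub>?A\<^esub> e \<otimes>\<^bsub>?A\<^esub> \<theta>) x"
      using same_symbol_conj[OF r(1) has_symbol_compose[OF p \<theta>] 1] by blast
    have "\<theta> (f x) \<otimes>\<^bsub>heis r\<^esub> k = k \<otimes>\<^bsub>heis r\<^esub> (f' [^]\<^bsub>?A\<^esub> e) (\<theta> x)" for x
      using k[of x] AutoGroup_mult_apply[OF \<theta>a au(1)] AutoGroup_mult_apply[OF pa \<theta>a] by simp
    then have "cyclic_extension (heis r) f \<cong> cyclic_extension (heis r) f'"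
      using au(2) rr by (intro cyclic_extension_isoI[OF group_heis au(1) group_heis _ auto_iso[OF \<theta>a] _ e]) simp_all
    then show ?iso using rr by simp
  }
qed

lemma cyclic_extension_transport:
  assumes H: "group H" and H': "group H'" and \<theta>: "\<theta> \<in> iso H H'" and f: "f \<in> auto H" and f': "f' \<in> auto H'"
    and eq: "\<And>x. x \<in> carrier H \<Longrightarrow> \<theta> (f x) = f' (\<theta> x)"
  shows "cyclic_extension H f \<cong> cyclic_extension H' f'"
proof (rule cyclic_extension_isoI[OF H f H' f' \<theta>])
  show "\<one>\<^bsub>H'\<^esub> \<in> carrier H'" using H' by (simp add: group.is_monoid monoid.one_closed)
  fix x assume x: "x \<in> carrier H"
  then have "f' (\<theta> x) \<in> carrier H'" using auto_closed[OF f'] \<theta> by (auto simp: iso_def hom_def)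
  then show "\<theta> (f x) \<otimes>\<^bsub>H'\<^esub> \<one>\<^bsub>H'\<^esub> = \<one>\<^bsub>H'\<^esub> \<otimes>\<^bsub>H'\<^esub> (f' [^]\<^bsub>AutoGroup H'\<^esub> (1 :: int)) (\<theta> x)"
    unfolding auto_power_1[OF H' f'] eq[OF x] using H' by (simp add: group.is_monoid)
qed simp

text \<open>The automorphism that \<open>osc_aut\<close> describes by its values on the generators is constructed in
coordinates and carried over to the presented group; it is the only one because the generators
generate.\<close>

theorem Osc_coordinates:
  assumes B: "B \<in> SL2_trace_gt2"
  obtains f where "has_symbol r f B l" "group (Osc r B l)" "cyclic_extension (heis r) f \<cong> Osc r B l"
proof -
  have det: "det B = 1" and inv: "invertible B" using B by (auto simp: SL2_trace_gt2_def SL2_minv)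
  obtain f where f: "has_symbol r f B l" and
    fv: "f hA = (B *v vector [1, 0], - l $ 2)" "f hB = (B *v vector [0, 1], l $ 1)" "f hC = (0, 1)"
    using has_symbol_exists[OF inv, of r l] unfolding det by auto
  have fa: "f \<in> auto (heis r)" using f by (simp add: has_symbol_def)
  obtain q where q: "q \<in> iso (heis r) (Heis r)" and
    qv: "q hA = heis_elem r Alpha" "q hB = heis_elem r Beta" "q hC = heis_elem r Gamma"
    by (rule Heis_coordinates)
  have qh: "q \<in> hom (heis r) (Heis r)" and qs: "q ` UNIV = carrier (Heis r)"
    using q by (auto simp: iso_def bij_betw_def)
  obtain f' where f': "f' \<in> auto (Heis r)" and qf: "\<And>x. q (f x) = f' (q x)"
    using conj_auto[OF group_heis group_Heis q fa] by auto
  let ?val = "\<lambda>g. g (heis_elem r Alpha) = heis_elem r Alpha [^]\<^bsub>Heis r\<^esub> (B $ 1 $ 1)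
        \<otimes>\<^bsub>Heis r\<^esub> heis_elem r Beta [^]\<^bsub>Heis r\<^esub> (B $ 2 $ 1) \<otimes>\<^bsub>Heis r\<^esub> heis_elem r Gamma [^]\<^bsub>Heis r\<^esub> (- (l $ 2)) \<and>
      g (heis_elem r Beta) = heis_elem r Alpha [^]\<^bsub>Heis r\<^esub> (B $ 1 $ 2)
        \<otimes>\<^bsub>Heis r\<^esub> heis_elem r Beta [^]\<^bsub>Heis r\<^esub> (B $ 2 $ 2) \<otimes>\<^bsub>Heis r\<^esub> heis_elem r Gamma [^]\<^bsub>Heis r\<^esub> (l $ 1) \<and>
      g (heis_elem r Gamma) = heis_elem r Gamma"
  have val: "?val f'"
  proof -
    have "f' (heis_elem r Alpha) = q (B *v vector [1, 0], - (l $ 2))"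
      "f' (heis_elem r Beta) = q (B *v vector [0, 1], l $ 1)" "f' (heis_elem r Gamma) = heis_elem r Gamma"
      using qf[of hA] qf[of hB] qf[of hC] by (simp_all add: fv qv)
    then show ?thesis
      unfolding heis_hom_eq[OF qh group_Heis, of "B *v vector [1, 0]"]
        heis_hom_eq[OF qh group_Heis, of "B *v vector [0, 1]"] by (simp add: qv matrix_vector_2)
  qed
  have uniq: "g = f'" if g: "g \<in> auto (Heis r)" and "?val g" for g
  proof (rule auto_eqI[OF g f'])
    fix y assume "y \<in> carrier (Heis r)"
    then obtain x where y: "y = q x" using qs by blast
    have "(g \<circ> q) x = (f' \<circ> q) x"
      by (rule heis_hom_eqI[OF hom_compose[OF qh auto_hom[OF g]] hom_compose[OF qh auto_hom[OF f']] group_Heis])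
        (use val \<open>?val g\<close> in \<open>simp_all add: qv\<close>)
    then show "g y = f' y" by (simp add: y)
  qed
  have "osc_aut r B l = f'"
    unfolding osc_aut_def Let_def by (rule the_equality) (use f' val uniq in blast)+
  then have Osc: "Osc r B l = cyclic_extension (Heis r) f'" by (simp add: Osc_def cyclic_extension_def)
  show ?thesis
  proof (rule that[OF f])
    show "group (Osc r B l)" unfolding Osc by (rule group_cyclic_extension[OF group_Heis f'])
    show "cyclic_extension (heis r) f \<cong> Osc r B l"
      unfolding Osc by (rule cyclic_extension_transport[OF group_heis group_Heis q fa f']) (rule qf)
  qed
qed

lemma group_Osc: "B \<in> SL2_trace_gt2 \<Longrightarrow> group (Osc r B l)"
  using Osc_coordinates by blast

theorem Osc_iso_iff:
  assumes r: "r \<ge> 1" "r' \<ge> 1" and B: "B \<in> SL2_trace_gt2" "B' \<in> SL2_trace_gt2"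
  shows "Osc r B l \<cong> Osc r' B' l' \<longleftrightarrow>
    r = r' \<and> (\<exists>K m. \<exists>e\<in>{1, -1 :: int}. invertible K \<and>
      K ** B = (if e = 1 then B' else matrix_inv B') ** K \<and>
      vec_cong r (matrix_inv B *v m + l)
        (matrix_inv K *v (if e = 1 then l' else - (B' *v l')) + m))"
proof -
  obtain f where f: "has_symbol r f B l" "group (Osc r B l)" "cyclic_extension (heis r) f \<cong> Osc r B l"
    by (rule Osc_coordinates[OF B(1)])
  obtain f' where f': "has_symbol r' f' B' l'" "group (Osc r' B' l')" "cyclic_extension (heis r') f' \<cong> Osc r' B' l'"
    by (rule Osc_coordinates[OF B(2)])
  have "group (cyclic_extension (heis r) f)" "group (cyclic_extension (heis r') f')"
    using f(1) f'(1) by (auto simp: has_symbol_def intro: group_cyclic_extension[OF group_heis])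
  then have "Osc r B l \<cong> Osc r' B' l' \<longleftrightarrow> cyclic_extension (heis r) f \<cong> cyclic_extension (heis r') f'"
    using f(2,3) f'(2,3) by (meson group.iso_sym iso_trans)
  also note heis_extension_iso_iff[OF r B f(1) f'(1)]
  finally show ?thesis .
qed

text \<open>Conjugation in \<open>GL(2,\<int>)\<close> and inversion in \<open>SL(2,\<int>)\<close> preserve the trace.\<close>

corollary Osc_iso_invariants:
  assumes "r \<ge> 1" "r' \<ge> 1" "B \<in> SL2_trace_gt2" "B' \<in> SL2_trace_gt2" and "Osc r B l \<cong> Osc r' B' l'"
  shows "r = r'" "trace B = trace B'"
proof -
  from assms Osc_iso_iff[OF assms(1-4)] obtain K e where "r = r'" and K: "invertible K"
    and eq: "K ** B = (if e = (1 :: int) then B' else matrix_inv B') ** K" by blast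
  show "r = r'" by fact
  have "K ** B ** matrix_inv K = (if e = 1 then B' else matrix_inv B')"
    unfolding eq using minv(1)[OF K] by (simp flip: matrix_mul_assoc)
  then have "trace B = trace (if e = 1 then B' else matrix_inv B')" using conj_SL2(2)[OF K] by metis
  then show "trace B = trace B'" using assms(4) by (auto simp: SL2_trace_gt2_def SL2_minv)
qed


section \<open>Hyperbolic automorphisms\<close>

lemma matrix_inv_both:
  assumes "invertible P"
  shows "P ** matrix_inv P = mat 1" "matrix_inv P ** P = mat 1"
  using assms someI_ex[of "\<lambda>A. P ** A = mat 1 \<and> A ** P = mat 1"]
  unfolding invertible_def matrix_inv_def by auto

text \<open>An element of \<open>SO_plus_1_1\<close> has equal diagonal entries \<open>x > 0\<close> and equal off-diagonal entries \<open>y\<close> with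
\<open>x\<^sup>2 - y\<^sup>2 = 1\<close>. Unless it is the identity, its trace \<open>2 x\<close> is greater than \<open>2\<close>; determinant and
trace are invariant under conjugation. Conversely, the boost \<open>S\<close> with the trace of \<open>B\<close> has the same
characteristic polynomial as \<open>B\<close>, and \<open>e\<^sub>1\<close> is a cyclic vector for both matrices, so they are conjugate.\<close>

lemma conj_boost_iff:
  fixes B :: "int^2^2"
  shows "(\<exists>P :: real^2^2. invertible P \<and>
      P ** map_matrix real_of_int B ** matrix_inv P \<in> SO_plus_1_1 - {mat 1}) \<longleftrightarrow> B \<in> SL2_trace_gt2"
proof
  let ?R = "map_matrix real_of_int B"
  have R: "?R $ i $ j = real_of_int (B $ i $ j)" for i j by (simp add: map_matrix_def)
  have detR: "det ?R = real_of_int (det B)" and trR: "trace ?R = real_of_int (trace B)"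
    by (simp_all add: det_2 trace_def sum_2 R)
  {
    assume "\<exists>P :: real^2^2. invertible P \<and> P ** ?R ** matrix_inv P \<in> SO_plus_1_1 - {mat 1}"
    then obtain P :: "real^2^2" where P: "invertible P" and S: "P ** ?R ** matrix_inv P \<in> SO_plus_1_1"
      and ne: "P ** ?R ** matrix_inv P \<noteq> mat 1" by blast
    define S where "S = P ** ?R ** matrix_inv P"
    have PP: "P ** matrix_inv P = mat 1" "matrix_inv P ** P = mat 1"
      by (rule matrix_inv_both[OF P])+
    have "det P * det (matrix_inv P) = 1" using PP(1) det_mul[of P "matrix_inv P"] by simp
    then have detS: "det S = det ?R" by (simp add: S_def det_mul algebra_simps)
    have "trace S = trace (matrix_inv P ** (P ** ?R))" unfolding S_def by (rule trace_mul_sym)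
    then have trS: "trace S = trace ?R" by (simp add: matrix_mul_assoc PP)
    have J: "transpose S ** minkowski ** S = minkowski" and d: "det S = 1" and pos: "S $ 1 $ 1 > 0"
      using S by (auto simp: SO_plus_1_1_def S_def)
    have "(transpose S ** minkowski ** S) $ i $ j = minkowski $ i $ j" for i j by (simp add: J)
    from this[of 1 1] this[of 1 2]
    have q: "S $ 1 $ 1 * S $ 1 $ 1 - S $ 2 $ 1 * S $ 2 $ 1 = 1"
      "S $ 1 $ 1 * S $ 1 $ 2 - S $ 2 $ 1 * S $ 2 $ 2 = 0"
      by (simp_all add: matrix_matrix_mult_def transpose_def minkowski_def sum_2)
    have d': "S $ 1 $ 1 * S $ 2 $ 2 - S $ 1 $ 2 * S $ 2 $ 1 = 1" using d by (simp add: det_2)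
    have s22: "S $ 2 $ 2 = S $ 1 $ 1" using q d' by algebra
    have s12: "S $ 1 $ 2 = S $ 2 $ 1" using q d' by algebra
    have "S $ 1 $ 1 > 1"
    proof (rule ccontr)
      assume "\<not> S $ 1 $ 1 > 1"
      then have "S $ 1 $ 1 * S $ 1 $ 1 \<le> 1" using pos by (simp add: mult_le_one)
      moreover have "S $ 2 $ 1 * S $ 2 $ 1 \<ge> 0" by simp
      ultimately have "S $ 2 $ 1 * S $ 2 $ 1 = 0" "S $ 1 $ 1 * S $ 1 $ 1 = 1" using q(1) by linarith+
      then have "S $ 2 $ 1 = 0" "S $ 1 $ 1 = 1" using pos by (auto simp: square_eq_1_iff)
      then have "S = mat 1" using s12 s22 by (simp add: vec_eq_iff forall_2 mat_def)
      then show False using ne by (simp add: S_def)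
    qed
    then have "trace S > 2" using s22 by (simp add: trace_def sum_2)
    then have "real_of_int (trace B) > 2" "real_of_int (det B) = 1" using trS detS d trR detR by simp_all
    then show "B \<in> SL2_trace_gt2" by (simp add: SL2_trace_gt2_def)
  next
    assume B: "B \<in> SL2_trace_gt2"
    define a b c d where abcd: "a = real_of_int (B $ 1 $ 1)" "b = real_of_int (B $ 1 $ 2)"
      "c = real_of_int (B $ 2 $ 1)" "d = real_of_int (B $ 2 $ 2)"
    have "real_of_int (det B) = 1" using B by (simp add: SL2_trace_gt2_def)
    then have det: "a * d - b * c = 1" by (simp add: det_2 abcd)
    have "real_of_int (trace B) > 2" using B by (simp add: SL2_trace_gt2_def)
    then have tr: "a + d > 2" by (simp add: trace_def sum_2 abcd)
    have "B $ 2 $ 1 \<noteq> 0"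
    proof
      assume "B $ 2 $ 1 = 0"
      then have "B $ 1 $ 1 * B $ 2 $ 2 = 1" using B by (simp add: SL2_trace_gt2_def det_2)
      then have "B $ 1 $ 1 + B $ 2 $ 2 \<le> 2" by (auto simp: zmult_eq_1_iff)
      then show False using B by (simp add: SL2_trace_gt2_def trace_def sum_2)
    qed
    then have c: "c \<noteq> 0" by (simp add: abcd)
    define t where "t = (a + d) / 2"
    define s where "s = sqrt (t\<^sup>2 - 1)"
    have t: "t > 1" using tr by (simp add: t_def)
    then have t2: "t\<^sup>2 > 1" by simp
    then have s: "s > 0" and ss: "s * s = t * t - 1" by (simp_all add: s_def flip: power2_eq_square)
    define S :: "real^2^2" where "S = vector [vector [t, s], vector [s, t]]"
    \<comment> \<open>The matrix that sends the basis \<open>e\<^sub>1, B e\<^sub>1\<close> to the basis \<open>e\<^sub>1, S e\<^sub>1\<close>.\<close>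
    define P :: "real^2^2" where "P = vector [vector [1, (t - a) / c], vector [0, s / c]]"
    have d: "d = 2 * t - a" by (simp add: t_def field_simps)
    have "P ** ?R = S ** P"
    proof -
      have bc: "b * c = a * d - 1" using det by simp
      have "b + (t - a) * d / c = (b * c + (t - a) * d) / c" using c by (simp add: field_simps)
      also have "b * c + (t - a) * d = t * (t - a) + s * s" unfolding bc ss d by (simp add: algebra_simps)
      also have "(t * (t - a) + s * s) / c = t * ((t - a) / c) + s * (s / c)" by (simp add: add_divide_distrib)
      finally have 1: "b + (t - a) * d / c = t * ((t - a) / c) + s * (s / c)" .
      have 2: "s * d / c = s * ((t - a) / c) + t * (s / c)" unfolding d using c by (simp add: field_simps)
      show ?thesis using 1 2 c
        by (simp add: vec_eq_iff forall_2 matrix_matrix_mult_def sum_2 P_def S_def R flip: abcd)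
    qed
    moreover have P: "invertible P" using s c by (simp add: invertible_det_nz P_def det_2)
    ultimately have "P ** ?R ** matrix_inv P = S"
      by (simp add: matrix_inv_both flip: matrix_mul_assoc)
    moreover have "S \<in> SO_plus_1_1"
      using t ss by (simp add: SO_plus_1_1_def S_def minkowski_def matrix_matrix_mult_def transpose_def
          vec_eq_iff forall_2 sum_2 det_2)
    moreover have "S \<noteq> mat 1"
    proof
      assume "S = mat 1"
      then have "S $ 1 $ 2 = 0" by (simp add: mat_def)
      then show False using s by (simp add: S_def mat_def)
    qed
    ultimately show "\<exists>P :: real^2^2. invertible P \<and> P ** ?R ** matrix_inv P \<in> SO_plus_1_1 - {mat 1}"
      using P by blast
  }
qed

lemma center_carrier: "z \<in> group_center H \<Longrightarrow> z \<in> carrier H"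
  unfolding group_center_def by blast

lemma center_normal: "group H \<Longrightarrow> group_center H \<lhd> H"
proof -
  assume "group H"
  then interpret group H .
  have comm: "z \<otimes>\<^bsub>H\<^esub> h = h \<otimes>\<^bsub>H\<^esub> z" if "z \<in> group_center H" "h \<in> carrier H" for z h
    using that unfolding group_center_def by blast
  have "subgroup (group_center H) H"
  proof (rule subgroupI)
    show "group_center H \<noteq> {}" by (auto simp: group_center_def intro!: exI[of _ "\<one>\<^bsub>H\<^esub>"])
    fix x assume x: "x \<in> group_center H"
    then have xc: "x \<in> carrier H" by (rule center_carrier)
    have "inv\<^bsub>H\<^esub> x \<otimes>\<^bsub>H\<^esub> h = h \<otimes>\<^bsub>H\<^esub> inv\<^bsub>H\<^esub> x" if h: "h \<in> carrier H" for h
      using comm[OF x h] xc h by (metis inv_closed inv_solve_left inv_solve_right m_assoc m_closed)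
    then show "inv\<^bsub>H\<^esub> x \<in> group_center H" using xc unfolding group_center_def by blast
    fix y assume y: "y \<in> group_center H"
    then have yc: "y \<in> carrier H" unfolding group_center_def by blast
    have "x \<otimes>\<^bsub>H\<^esub> y \<otimes>\<^bsub>H\<^esub> h = h \<otimes>\<^bsub>H\<^esub> (x \<otimes>\<^bsub>H\<^esub> y)" if h: "h \<in> carrier H" for h
      using comm[OF x h] comm[OF y h] xc yc h by (metis m_assoc)
    then show "x \<otimes>\<^bsub>H\<^esub> y \<in> group_center H" using xc yc unfolding group_center_def by blast
  qed (auto simp: group_center_def)
  moreover have "h \<otimes>\<^bsub>H\<^esub> z \<otimes>\<^bsub>H\<^esub> inv\<^bsub>H\<^esub> h = z" if "h \<in> carrier H" "z \<in> group_center H" for h z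
  proof -
    have "z \<in> carrier H" using that unfolding group_center_def by blast
    then show ?thesis using comm[OF that(2,1)] that by (metis inv_closed m_assoc r_inv r_one)
  qed
  ultimately show ?thesis by (simp add: normal_inv_iff)
qed

definition pair_action :: "int^2^2 \<Rightarrow> int \<times> int \<Rightarrow> int \<times> int" where
  "pair_action B = (\<lambda>(x, y). (B $ 1 $ 1 * x + B $ 1 $ 2 * y, B $ 2 $ 1 * x + B $ 2 $ 2 * y))"

lemma group_Z2: "group (integer_group \<times>\<times> integer_group)"
  by (simp add: DirProd_group)

text \<open>An isomorphism from the central quotient to \<open>\<int>\<^sup>2\<close> amounts to a homomorphism \<open>p\<close> onto \<open>\<int>\<^sup>2\<close> whose kernel is
the centre. In this form, which mentions no cosets, the condition is easy to transport along
isomorphisms and to test in coordinates.\<close>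

theorem hyperbolic_iff_hom:
  assumes H: "group H" and f: "f \<in> auto H"
  shows "hyperbolic_on_central_quotient H f \<longleftrightarrow>
    (\<exists>p. \<exists>B\<in>SL2_trace_gt2. p \<in> hom H (integer_group \<times>\<times> integer_group) \<and> p ` carrier H = UNIV \<and>
      kernel H (integer_group \<times>\<times> integer_group) p = group_center H \<and>
      (\<forall>h\<in>carrier H. p (f h) = pair_action B (p h)))"
proof
  interpret H: group H by (rule H)
  let ?Z2 = "integer_group \<times>\<times> integer_group" and ?Z = "group_center H"
  interpret N: normal ?Z H by (rule center_normal[OF H])
  let ?\<pi> = "\<lambda>h. ?Z #>\<^bsub>H\<^esub> h"
  have fZ: "f ` ?Z = ?Z"
  proof
    show "f ` ?Z \<subseteq> ?Z" using iso_center[OF auto_iso[OF f]] by blast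
    show "?Z \<subseteq> f ` ?Z"
    proof
      fix z assume z: "z \<in> ?Z"
      have zc: "z \<in> carrier H" using z unfolding group_center_def by blast
      let ?w = "inv_into (carrier H) f z"
      have "?w \<in> ?Z" using iso_center[OF H.iso_set_sym[OF auto_iso[OF f]] z] .
      moreover have "f ?w = z" using auto_bij[OF f] zc by (simp add: bij_betw_def f_inv_into_f)
      ultimately show "z \<in> f ` ?Z" by (metis imageI)
    qed
  qed
  have coset: "?\<pi> k = (\<lambda>z. z \<otimes>\<^bsub>H\<^esub> k) ` ?Z" for k by (auto simp: r_coset_def)
  have image: "f ` ?\<pi> h = ?\<pi> (f h)" if h: "h \<in> carrier H" for h
  proof -
    have "f ` ?\<pi> h = (\<lambda>z. f z \<otimes>\<^bsub>H\<^esub> f h) ` ?Z"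
      unfolding coset image_image by (intro image_cong HOL.refl auto_mult[OF f _ h] center_carrier)
    also have "\<dots> = (\<lambda>z. z \<otimes>\<^bsub>H\<^esub> f h) ` (f ` ?Z)" by (simp only: image_image)
    finally show ?thesis unfolding fZ coset .
  qed
  {
    assume "hyperbolic_on_central_quotient H f"
    then obtain \<psi> and B :: "int^2^2" where \<psi>: "\<psi> \<in> iso (H Mod ?Z) ?Z2"
      and act: "\<And>X x y. X \<in> carrier (H Mod ?Z) \<Longrightarrow> \<psi> X = (x, y) \<Longrightarrow>
        \<psi> (f ` X) = (B $ 1 $ 1 * x + B $ 1 $ 2 * y, B $ 2 $ 1 * x + B $ 2 $ 2 * y)"
      and B: "B \<in> SL2_trace_gt2"
      unfolding hyperbolic_on_central_quotient_def conj_boost_iff by metis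
    let ?p = "\<psi> \<circ> ?\<pi>"
    have Q: "group (H Mod ?Z)" by (rule N.factorgroup_is_group)
    have \<psi>h: "\<psi> \<in> hom (H Mod ?Z) ?Z2" and inj: "inj_on \<psi> (carrier (H Mod ?Z))"
      and onto: "\<psi> ` carrier (H Mod ?Z) = UNIV" using \<psi> by (auto simp: iso_def bij_betw_def)
    have cos: "?\<pi> h \<in> carrier (H Mod ?Z)" if "h \<in> carrier H" for h
      using that by (simp add: carrier_FactGroup)
    have "?p \<in> hom H ?Z2" by (rule hom_compose[OF N.r_coset_hom_Mod \<psi>h])
    moreover have "?p ` carrier H = UNIV" using onto by (simp add: carrier_FactGroup image_comp)
    moreover have "kernel H ?Z2 ?p = ?Z"
    proof -
      have "\<psi> (?\<pi> h) = \<one>\<^bsub>?Z2\<^esub> \<longleftrightarrow> h \<in> ?Z" if h: "h \<in> carrier H" for h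
      proof -
        have one: "\<psi> ?Z = \<one>\<^bsub>?Z2\<^esub>" using hom_one[OF \<psi>h Q group_Z2] by simp
        have Zc: "?Z \<in> carrier (H Mod ?Z)" using group.is_monoid[OF Q] monoid.one_closed by fastforce
        have "\<psi> (?\<pi> h) = \<one>\<^bsub>?Z2\<^esub> \<longleftrightarrow> ?\<pi> h = ?Z"
          using inj_on_eq_iff[OF inj cos[OF h] Zc] one by simp
        also have "\<dots> \<longleftrightarrow> h \<in> ?Z"
          using H.coset_join1[OF _ h N.is_subgroup] H.coset_join2[OF h N.is_subgroup] N.subset by blast
        finally show ?thesis .
      qed
      then show ?thesis using N.subset by (auto simp: kernel_def)
    qed
    moreover have "?p (f h) = pair_action B (?p h)" if h: "h \<in> carrier H" for h
      using act[OF cos[OF h]] image[OF h] by (cases "\<psi> (?\<pi> h)") (simp add: pair_action_def)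
    ultimately show "\<exists>p. \<exists>B\<in>SL2_trace_gt2. p \<in> hom H ?Z2 \<and> p ` carrier H = UNIV \<and>
      kernel H ?Z2 p = ?Z \<and> (\<forall>h\<in>carrier H. p (f h) = pair_action B (p h))" using B by blast
  next
    assume "\<exists>p. \<exists>B\<in>SL2_trace_gt2. p \<in> hom H ?Z2 \<and> p ` carrier H = UNIV \<and>
      kernel H ?Z2 p = ?Z \<and> (\<forall>h\<in>carrier H. p (f h) = pair_action B (p h))"
    then obtain p B where B: "B \<in> SL2_trace_gt2" and p: "p \<in> hom H ?Z2" "p ` carrier H = UNIV"
      "kernel H ?Z2 p = ?Z" and act: "\<And>h. h \<in> carrier H \<Longrightarrow> p (f h) = pair_action B (p h)" by blast
    interpret p: group_hom H ?Z2 p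
      using p(1) H group_Z2 by (simp add: group_hom_def group_hom_axioms_def)
    let ?\<psi> = "\<lambda>X. the_elem (p ` X)"
    have \<psi>: "?\<psi> \<in> iso (H Mod ?Z) ?Z2"
      using p.FactGroup_iso_set p by simp
    have val: "?\<psi> (?\<pi> h) = p h" if h: "h \<in> carrier H" for h
    proof -
      have "p (z \<otimes>\<^bsub>H\<^esub> h) = p h" if z: "z \<in> ?Z" for z
      proof -
        have zc: "z \<in> carrier H" by (rule center_carrier[OF z])
        have "p z = \<one>\<^bsub>?Z2\<^esub>" using z unfolding p(3)[symmetric] kernel_def by blast
        then have "p (z \<otimes>\<^bsub>H\<^esub> h) = \<one>\<^bsub>?Z2\<^esub> \<otimes>\<^bsub>?Z2\<^esub> p h" using p.hom_mult[OF zc h] by (simp only:)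
        also have "\<dots> = p h" by (rule p.H.l_one[OF p.hom_closed[OF h]])
        finally show ?thesis .
      qed
      then have "(\<lambda>z. p (z \<otimes>\<^bsub>H\<^esub> h)) ` ?Z = (\<lambda>z. p h) ` ?Z" by (rule image_cong[OF HOL.refl])
      also have "\<dots> = {p h}" using N.one_closed by blast
      finally have "p ` ?\<pi> h = {p h}" unfolding coset image_image .
      then show ?thesis by simp
    qed
    have "?\<psi> (f ` X) = (B $ 1 $ 1 * x + B $ 1 $ 2 * y, B $ 2 $ 1 * x + B $ 2 $ 2 * y)"
      if "X \<in> carrier (H Mod ?Z)" "?\<psi> X = (x, y)" for X x y
    proof -
      have "X \<in> ?\<pi> ` carrier H" using that(1) unfolding carrier_FactGroup .
      then obtain h where h: "h \<in> carrier H" and X: "X = ?\<pi> h" by (rule imageE)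
      have "?\<psi> (f ` X) = p (f h)" unfolding X image[OF h] by (rule val[OF auto_closed[OF f h]])
      then show ?thesis using that(2) act[OF h] unfolding X val[OF h] by (simp add: pair_action_def)
    qed
    then show "hyperbolic_on_central_quotient H f"
      unfolding hyperbolic_on_central_quotient_def conj_boost_iff using \<psi> B by blast
  }
qed

lemma hyperbolic_transport:
  assumes H: "group H" and H': "group H'" and \<theta>: "\<theta> \<in> iso H H'" and f: "f \<in> auto H" and f': "f' \<in> auto H'"
    and eq: "\<And>x. x \<in> carrier H \<Longrightarrow> \<theta> (f x) = f' (\<theta> x)"
    and hyp: "hyperbolic_on_central_quotient H f"
  shows "hyperbolic_on_central_quotient H' f'"
proof -
  let ?Z2 = "integer_group \<times>\<times> integer_group"
  obtain p B where B: "B \<in> SL2_trace_gt2" and p: "p \<in> hom H ?Z2" "p ` carrier H = UNIV"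
    "kernel H ?Z2 p = group_center H" and act: "\<And>h. h \<in> carrier H \<Longrightarrow> p (f h) = pair_action B (p h)"
    using hyp unfolding hyperbolic_iff_hom[OF H f] by blast
  define \<sigma> where "\<sigma> = inv_into (carrier H) \<theta>"
  have \<sigma>: "\<sigma> \<in> iso H' H" unfolding \<sigma>_def by (rule group.iso_set_sym[OF H \<theta>])
  have \<sigma>c: "\<sigma> y \<in> carrier H" if "y \<in> carrier H'" for y using \<sigma> that by (auto simp: iso_def hom_def)
  have \<theta>\<sigma>: "\<theta> (\<sigma> y) = y" if "y \<in> carrier H'" for y
    using \<theta> that by (auto simp: \<sigma>_def iso_def bij_betw_def f_inv_into_f)
  have \<sigma>\<theta>: "\<sigma> (\<theta> x) = x" if "x \<in> carrier H" for x
    using \<theta> that by (auto simp: \<sigma>_def iso_def bij_betw_def)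
  have "p \<circ> \<sigma> \<in> hom H' ?Z2" using \<sigma> p(1) by (intro hom_compose) (auto simp: iso_def)
  moreover have "(p \<circ> \<sigma>) ` carrier H' = UNIV"
    unfolding image_comp[symmetric] using \<sigma> p(2) by (simp add: iso_def bij_betw_def)
  moreover have "kernel H' ?Z2 (p \<circ> \<sigma>) = group_center H'"
  proof -
    have "y \<in> kernel H' ?Z2 (p \<circ> \<sigma>) \<longleftrightarrow> y \<in> group_center H'" if y: "y \<in> carrier H'" for y
    proof -
      have "y \<in> kernel H' ?Z2 (p \<circ> \<sigma>) \<longleftrightarrow> \<sigma> y \<in> kernel H ?Z2 p" using y \<sigma>c by (simp add: kernel_def)
      also have "\<dots> \<longleftrightarrow> y \<in> group_center H'"
        unfolding p(3) using iso_center[OF \<sigma>, of y] iso_center[OF \<theta>, of "\<sigma> y"] \<theta>\<sigma>[OF y] by auto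
      finally show ?thesis .
    qed
    then show ?thesis by (auto simp: kernel_def group_center_def)
  qed
  moreover have "(p \<circ> \<sigma>) (f' y) = pair_action B ((p \<circ> \<sigma>) y)" if y: "y \<in> carrier H'" for y
  proof -
    have "\<sigma> (f' y) = f (\<sigma> y)"
      using eq[OF \<sigma>c[OF y]] \<theta>\<sigma>[OF y] \<sigma>\<theta>[OF auto_closed[OF f \<sigma>c[OF y]]] by simp
    then show ?thesis using act[OF \<sigma>c[OF y]] by simp
  qed
  ultimately show ?thesis unfolding hyperbolic_iff_hom[OF H' f'] using B by blast
qed

text \<open>Any \<open>p\<close> as in \<open>hyperbolic_iff_hom\<close> is given on \<open>\<int>\<^sup>2\<close> by an integer matrix \<open>Q\<close>. Surjectivity makes \<open>Q\<close>
invertible over the integers, and equivariance means \<open>Q K = B Q\<close>; so \<open>K\<close> and \<open>B\<close> have the same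
determinant and trace.\<close>

theorem heis_hyperbolic_iff:
  assumes r: "r \<ge> 1" and f: "has_symbol r f K m"
  shows "hyperbolic_on_central_quotient (heis r) f \<longleftrightarrow> K \<in> SL2_trace_gt2"
proof
  have au: "f \<in> auto (heis r)" using f by (simp add: has_symbol_def)
  have fst_f: "fst (f x) = K *v fst x" for x using f unfolding has_symbol_def by (metis prod.collapse)
  let ?Z2 = "integer_group \<times>\<times> integer_group"
  {
    assume "hyperbolic_on_central_quotient (heis r) f"
    then obtain p B where B: "B \<in> SL2_trace_gt2" and p: "p \<in> hom (heis r) ?Z2" "range p = UNIV"
      "kernel (heis r) ?Z2 p = group_center (heis r)" and act: "\<And>h. p (f h) = pair_action B (p h)"
      unfolding hyperbolic_iff_hom[OF group_heis au] by auto
    have "hC \<in> kernel (heis r) ?Z2 p" unfolding p(3) heis_center using r by simp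
    then have pC: "p hC = (0, 0)" by (simp add: kernel_def)
    have c: "fst \<circ> p \<in> hom (heis r) integer_group" "snd \<circ> p \<in> hom (heis r) integer_group"
      using hom_mult[OF p(1)] by (auto simp: hom_def mult_DirProd' split: prod.splits)
    define Q :: "int^2^2" where "Q = vector [vector [fst (p hA), fst (p hB)], vector [snd (p hA), snd (p hB)]]"
    have Qv: "p x = ((Q *v fst x) $ 1, (Q *v fst x) $ 2)" for x
      using heis_hom_eq[OF c(1) group_integer_group, of "fst x" "snd x"]
        heis_hom_eq[OF c(2) group_integer_group, of "fst x" "snd x"]
      by (simp add: pC Q_def matrix_vector_2 prod_eq_iff mult.commute)
    have "Q *v (K *v v) = B *v (Q *v v)" for v
      using act[of "(v, 0)"] unfolding Qv fst_f
      by (simp add: pair_action_def vec_eq_iff forall_2 matrix_vector_2[of B])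
    then have QK: "Q ** K = B ** Q" by (simp add: matrix_eq flip: matrix_vector_mul_assoc)
    obtain x y where "p x = (1, 0)" "p y = (0, 1)" using p(2) by (metis UNIV_I imageE)
    then have xy: "Q *v fst x = vector [1, 0]" "Q *v fst y = vector [0, 1]"
      unfolding Qv by (simp_all add: vec_eq_iff forall_2)
    define R :: "int^2^2" where "R = vector [vector [fst x $ 1, fst y $ 1], vector [fst x $ 2, fst y $ 2]]"
    have "Q ** R = mat 1"
      using xy by (simp add: R_def vec_eq_iff forall_2 matrix_matrix_mult_def matrix_vector_mult_def sum_2 mat_def)
    then have "det Q * det R = 1" by (metis det_mul det_I)
    then have "det Q * det Q = 1" by (auto simp: zmult_eq_1_iff)
    then have Q: "invertible Q" by (rule invertible_det_unit)
    have "Q ** K ** matrix_inv Q = B" unfolding QK using minv(1)[OF Q] by (simp flip: matrix_mul_assoc)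
    then have "det B = det K" "trace B = trace K" using conj_SL2[OF Q, of K] by auto
    then show "K \<in> SL2_trace_gt2" using B by (simp add: SL2_trace_gt2_def)
  next
    assume K: "K \<in> SL2_trace_gt2"
    let ?p = "\<lambda>x :: (int^2) \<times> int. (fst x $ 1, fst x $ 2)"
    have "?p \<in> hom (heis r) ?Z2" by (auto simp: hom_def fst_heis_mult)
    moreover have "range ?p = UNIV"
    proof (rule surjI)
      show "?p (vector [fst x, snd x], 0) = x" for x by simp
    qed
    moreover have "kernel (heis r) ?Z2 ?p = group_center (heis r)"
      using r by (auto simp: kernel_def heis_center vec_eq_iff forall_2)
    moreover have "?p (f h) = pair_action K (?p h)" for h
      by (simp add: fst_f pair_action_def matrix_vector_2)
    ultimately show "hyperbolic_on_central_quotient (heis r) f"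
      unfolding hyperbolic_iff_hom[OF group_heis au] using K by (intro exI[of _ ?p] bexI[of _ K]) auto
  }
qed

section \<open>Isomorphism classes\<close>

lemma nat_copy:
  fixes G :: "'a :: countable monoid"
  assumes "group G"
  obtains N :: "nat monoid" and \<theta> where "group N" "\<theta> \<in> iso G N"
proof
  define M :: "nat monoid" where "M = \<lparr>carrier = UNIV, mult = (\<lambda>x y. to_nat (from_nat x \<otimes>\<^bsub>G\<^esub> from_nat y)), one = to_nat \<one>\<^bsub>G\<^esub>\<rparr>"
  have hom: "to_nat \<in> hom G M" by (simp add: hom_def M_def)
  let ?N = "M\<lparr>carrier := to_nat ` carrier G, one := to_nat \<one>\<^bsub>G\<^esub>\<rparr>"
  show "group ?N" by (rule group.hom_imp_img_group[OF assms hom])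
  show "to_nat \<in> iso G ?N" using hom by (simp add: iso_def hom_def bij_betw_def)
qed

text \<open>The element \<open>X\<close> guarantees that the class is not empty: a group without a copy on the natural numbers
would not be determined by its class.\<close>

lemma iso_class_eq_iff:
  assumes "group G" "group G'" and "X \<in> iso_class G"
  shows "iso_class G = iso_class G' \<longleftrightarrow> G \<cong> G'"
proof
  assume "iso_class G = iso_class G'"
  then have "group X" "X \<cong> G" "X \<cong> G'" using assms(3) by (auto simp: iso_class_def)
  then show "G \<cong> G'" using group.iso_sym iso_trans by blast
next
  assume iso: "G \<cong> G'"
  then have iso': "G' \<cong> G" by (rule group.iso_sym[OF assms(1)])
  have "X \<cong> G \<longleftrightarrow> X \<cong> G'" for X :: "nat monoid"
    using iso_trans[OF _ iso, of X] iso_trans[OF _ iso', of X] by blast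
  then show "iso_class G = iso_class G'" by (simp add: iso_class_def)
qed

theorem heis_extension_iso_Osc:
  assumes r: "r \<ge> 1" and B: "B \<in> SL2_trace_gt2" and f: "has_symbol r f B l"
  shows "cyclic_extension (heis r) f \<cong> Osc r B l"
proof -
  obtain g where g: "has_symbol r g B l" "cyclic_extension (heis r) g \<cong> Osc r B l"
    by (rule Osc_coordinates[OF B])
  have "cyclic_extension (heis r) f \<cong> cyclic_extension (heis r) g"
    unfolding heis_extension_iso_iff[OF r r B B f g(1)]
    by (intro conjI HOL.refl exI[of _ "mat 1"] exI[of _ 0] bexI[of _ 1]) (auto simp: inv_mat1 minv_1 vec_cong_def)
  then show ?thesis using g(2) by (rule iso_trans)
qed

lemma iso_class_Osc_nonempty:
  assumes "B \<in> SL2_trace_gt2"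
  obtains X where "X \<in> iso_class (Osc r B l)"
proof -
  obtain f where f: "has_symbol r f B l" "cyclic_extension (heis r) f \<cong> Osc r B l"
    by (rule Osc_coordinates[OF assms])
  then have G: "group (cyclic_extension (heis r) f)"
    by (intro group_cyclic_extension group_heis) (simp add: has_symbol_def)
  obtain X :: "nat monoid" and \<theta> where X: "group X" "\<theta> \<in> iso (cyclic_extension (heis r) f) X"
    using nat_copy[OF G] by blast
  then have "X \<cong> cyclic_extension (heis r) f" using group.iso_sym[OF G] is_isoI by blast
  then show ?thesis using that X(1) iso_trans[OF _ f(2)] by (auto simp: iso_class_def)
qed

lemma iso_class_Osc_eq_iff:
  assumes "B \<in> SL2_trace_gt2" "B' \<in> SL2_trace_gt2"
  shows "iso_class (Osc r B l) = iso_class (Osc r' B' l') \<longleftrightarrow> Osc r B l \<cong> Osc r' B' l'"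
  using iso_class_Osc_nonempty[OF assms(1)] iso_class_eq_iff[OF group_Osc group_Osc] assms by metis

text \<open>In coordinates the automorphism \<open>\<phi> 1\<close> has a symbol \<open>(K, m)\<close>. Hyperbolicity puts \<open>K\<close> into
\<open>SL2_trace_gt2\<close>, and the symbol determines the extension up to isomorphism.\<close>

theorem split_oscillator_is_Osc:
  assumes "discrete_split_oscillator_group (G :: ('h \<times> int) monoid)"
  obtains r B l where "r \<ge> 1" "B \<in> SL2_trace_gt2" "group G" "G \<cong> Osc r B l"
proof -
  obtain H :: "'h monoid" and \<phi> where H: "discrete_heisenberg_group H" and \<phi>: "\<phi> \<in> hom integer_group (AutoGroup H)"
    and hyp: "hyperbolic_on_central_quotient H (\<phi> 1)" and G: "G = semidirect H integer_group \<phi>"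
    using assms unfolding discrete_split_oscillator_group_def by blast
  obtain r where r: "r \<ge> 1" and gH: "group H" and HH: "H \<cong> Heis r"
    using H unfolding discrete_heisenberg_group_def by blast
  have f: "\<phi> 1 \<in> auto H" using hom_in_carrier[OF \<phi>, of 1] by simp
  have "\<phi> = (\<lambda>n. \<phi> 1 [^]\<^bsub>AutoGroup H\<^esub> n)"
    by (rule ext) (rule hom_integer_group_pow_eq[OF \<phi> group.AutoGroup[OF gH]])
  then have Gc: "G = cyclic_extension H (\<phi> 1)" unfolding G cyclic_extension_def by simp
  obtain q where "q \<in> iso (heis r) (Heis r)" by (rule Heis_coordinates)
  then have "Heis r \<cong> heis r" by (intro group.iso_sym[OF group_heis] is_isoI)
  with HH have "H \<cong> heis r" by (rule iso_trans)
  then obtain \<theta> where \<theta>: "\<theta> \<in> iso H (heis r)" unfolding is_iso_def by blast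
  obtain g where g: "g \<in> auto (heis r)" "\<And>x. x \<in> carrier H \<Longrightarrow> \<theta> (\<phi> 1 x) = g (\<theta> x)"
    using conj_auto[OF gH group_heis \<theta> f] by blast
  obtain K m where K: "has_symbol r g K m" by (rule auto_has_symbol[OF g(1) r])
  have "hyperbolic_on_central_quotient (heis r) g"
    by (rule hyperbolic_transport[OF gH group_heis \<theta> f g(1) g(2) hyp])
  then have SL: "K \<in> SL2_trace_gt2" by (simp add: heis_hyperbolic_iff[OF r K])
  have "G \<cong> cyclic_extension (heis r) g"
    unfolding Gc by (rule cyclic_extension_transport[OF gH group_heis \<theta> f g(1) g(2)])
  then have "G \<cong> Osc r K m" using heis_extension_iso_Osc[OF r SL K] by (rule iso_trans)
  moreover have "group G" unfolding Gc by (rule group_cyclic_extension[OF gH f])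
  ultimately show ?thesis using that r SL by blast
qed

text \<open>The members of \<open>osc_classes\<close> are built from Heisenberg groups on the natural numbers, so the
automorphism is first moved to such a copy.\<close>

theorem Osc_is_split_oscillator:
  assumes r: "r \<ge> 1" and B: "B \<in> SL2_trace_gt2"
  shows "iso_class (Osc r B l) \<in> osc_classes"
proof -
  obtain f where f: "has_symbol r f B l" "cyclic_extension (heis r) f \<cong> Osc r B l"
    by (rule Osc_coordinates[OF B])
  have fa: "f \<in> auto (heis r)" using f(1) by (simp add: has_symbol_def)
  obtain N :: "nat monoid" and \<theta> where N: "group N" and \<theta>: "\<theta> \<in> iso (heis r) N"
    using nat_copy[OF group_heis] by blast
  obtain g where g: "g \<in> auto N" "\<And>x. x \<in> carrier (heis r) \<Longrightarrow> \<theta> (f x) = g (\<theta> x)"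
    using conj_auto[OF group_heis N \<theta> fa] by blast
  let ?G = "cyclic_extension N g"
  obtain q where q: "q \<in> iso (heis r) (Heis r)" by (rule Heis_coordinates)
  have "N \<cong> heis r" using group.iso_sym[OF group_heis is_isoI[OF \<theta>]] .
  then have "N \<cong> Heis r" using is_isoI[OF q] by (rule iso_trans)
  then have "discrete_heisenberg_group N" unfolding discrete_heisenberg_group_def using N r by blast
  moreover have "(\<lambda>n. g [^]\<^bsub>AutoGroup N\<^esub> n) \<in> hom integer_group (AutoGroup N)"
    using group.hom_integer_group_pow[OF group.AutoGroup[OF N]] g(1) by simp
  moreover have "hyperbolic_on_central_quotient N g"
    using hyperbolic_transport[OF group_heis N \<theta> fa g] heis_hyperbolic_iff[OF r f(1)] B by blast
  then have "hyperbolic_on_central_quotient N (g [^]\<^bsub>AutoGroup N\<^esub> (1 :: int))"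
    unfolding auto_power_1[OF N g(1)] .
  ultimately have disc: "discrete_split_oscillator_group ?G"
    unfolding discrete_split_oscillator_group_def cyclic_extension_def by blast
  have "cyclic_extension (heis r) f \<cong> ?G"
    by (rule cyclic_extension_transport[OF group_heis N \<theta> fa g])
  then have "?G \<cong> cyclic_extension (heis r) f"
    by (rule group.iso_sym[OF group_cyclic_extension[OF group_heis fa]])
  then have GO: "?G \<cong> Osc r B l" using f(2) by (rule iso_trans)
  have gG: "group ?G" by (rule group_cyclic_extension[OF N g(1)])
  have "Osc r B l \<cong> ?G" by (rule group.iso_sym[OF gG GO])
  moreover obtain X where "X \<in> iso_class (Osc r B l)" by (rule iso_class_Osc_nonempty[OF B])
  ultimately have "iso_class (Osc r B l) = iso_class ?G"
    using iso_class_eq_iff[OF group_Osc[OF B] gG] by blast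
  then show ?thesis unfolding osc_classes_def using disc by blast
qed

lemma osc_classes_rT_eq:
  assumes r: "r \<ge> 1"
  shows "osc_classes_rT r T = {iso_class (Osc r B l) | B l. B \<in> SL2_trace T}"
  unfolding osc_classes_rT_def SL2_trace_def using Osc_is_split_oscillator[OF r] by blast

lemma osc_classes_eq: "osc_classes = (\<Union>r\<in>{1..}. \<Union>T\<in>{3..}. osc_classes_rT r T)"
proof (intro equalityI subsetI)
  fix C assume C: "C \<in> osc_classes"
  then obtain G :: "(nat \<times> int) monoid" where disc: "discrete_split_oscillator_group G" and CG: "C = iso_class G"
    unfolding osc_classes_def by blast
  obtain r B l where r: "r \<ge> 1" and B: "B \<in> SL2_trace_gt2" and G: "group G" "G \<cong> Osc r B l"
    by (rule split_oscillator_is_Osc[OF disc])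
  obtain X where "X \<in> iso_class (Osc r B l)" by (rule iso_class_Osc_nonempty[OF B])
  then have "C = iso_class (Osc r B l)"
    using iso_class_eq_iff[OF group_Osc[OF B] G(1)] group.iso_sym[OF G] CG by blast
  then have "C \<in> osc_classes_rT r (trace B)" using C B by (auto simp: osc_classes_rT_def)
  moreover have "trace B \<ge> 3" using B by (simp add: SL2_trace_gt2_def)
  ultimately show "C \<in> (\<Union>r\<in>{1..}. \<Union>T\<in>{3..}. osc_classes_rT r T)" using r by auto
qed (auto simp: osc_classes_rT_def)

lemma osc_classes_rT_disjoint:
  "disjoint_family_on (\<lambda>(r, T). osc_classes_rT r T) ({1..} \<times> {3..})"
proof -
  have "r = r' \<and> T = T'"
    if r: "r \<ge> 1" "r' \<ge> 1" and C: "C \<in> osc_classes_rT r T" "C \<in> osc_classes_rT r' T'" for r r' T T' C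
  proof -
    obtain B l where B: "B \<in> SL2_trace_gt2" "trace B = T" "C = iso_class (Osc r B l)"
      using C(1) by (auto simp: osc_classes_rT_def)
    obtain B' l' where B': "B' \<in> SL2_trace_gt2" "trace B' = T'" "C = iso_class (Osc r' B' l')"
      using C(2) by (auto simp: osc_classes_rT_def)
    have "Osc r B l \<cong> Osc r' B' l'" using iso_class_Osc_eq_iff[OF B(1) B'(1)] B(3) B'(3) by metis
    then show ?thesis using Osc_iso_invariants[OF r B(1) B'(1)] B(2) B'(2) by metis
  qed
  then show ?thesis unfolding disjoint_family_on_def by fastforce
qed

section \<open>Orbits\<close>

lemma residue_class_self: "l \<in> residue_class r l"
  by (simp add: residue_class_def)

lemma residue_class_eq_iff: "residue_class r l = residue_class r l' \<longleftrightarrow> vec_cong r l l'"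
proof
  assume "residue_class r l = residue_class r l'"
  then have "l \<in> residue_class r l'" using residue_class_self by blast
  then show "vec_cong r l l'" by (simp add: residue_class_def vec_cong_def)
next
  assume "vec_cong r l l'"
  then show "residue_class r l = residue_class r l'"
    unfolding residue_class_def vec_cong_def by (blast intro: cong_trans cong_sym)
qed

lemma residue_plane_class: "L \<in> residue_plane r \<Longrightarrow> l \<in> L \<Longrightarrow> L = residue_class r l"
proof -
  assume "L \<in> residue_plane r" and l: "l \<in> L"
  then obtain k where k: "L = residue_class r k" by (auto simp: residue_plane_def)
  then have "vec_cong r l k" using l by (simp add: residue_class_def vec_cong_def)
  then show ?thesis unfolding k residue_class_eq_iff by (rule vec_cong_sym)
qed

lemma affine_residue_class:
  fixes A :: "int^2^2"
  assumes "invertible A" "\<And>l. f l = A *v l + c"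
  shows "f ` residue_class r l = residue_class r (f l)"
proof (rule residue_plane_class)
  show "f ` residue_class r l \<in> residue_plane r"
    by (rule affine_residue[OF assms]) (simp add: residue_plane_def)
qed (simp add: residue_class_self)

lemma aff_act_residue_class:
  assumes "invertible K"
  shows "aff_act (K, m) (B, residue_class r l) =
    (K ** B ** matrix_inv K, residue_class r (K *v (l - (mat 1 - matrix_inv B) *v m)))"
  unfolding aff_act_def case_prod_conv
  by (subst affine_residue_class[OF assms, where c = "- (K *v ((mat 1 - matrix_inv B) *v m))"])
    (simp_all add: matrix_vector_mult_diff_distrib)

lemma sign_act_residue_class:
  assumes "invertible B"
  shows "sign_act e (B, residue_class r l) =
    (if e = -1 then (matrix_inv B, residue_class r (- (B *v l))) else (B, residue_class r l))"
proof -
  have "(- B) ** (- matrix_inv B) = mat 1" "(- matrix_inv B) ** (- B) = mat 1"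
    using minv[OF assms] by (simp_all add: vec_eq_iff matrix_matrix_mult_def)
  then have "invertible (- B)" unfolding invertible_def by blast
  then have "(\<lambda>l. - (B *v l)) ` residue_class r l = residue_class r (- (B *v l))"
    by (rule affine_residue_class[where c = 0]) (simp add: vec_eq_iff matrix_vector_mult_def sum_2)
  then show ?thesis by (simp add: sign_act_def)
qed

lemma vec_cong_mv: "vec_cong r l l' \<Longrightarrow> vec_cong r (K *v l) (K *v l')"
  unfolding vec_cong_def forall_2 matrix_vector_2 by (intro conjI cong_add cong_mult) auto

lemma vec_cong_add_right: "vec_cong r (l + m) (l' + m) \<longleftrightarrow> vec_cong r l l'"
  by (simp add: vec_cong_def cong_add_rcancel)

text \<open>Since the sign acts by an involution, \<open>\<kappa> (K, m) (B, l) = (B', l')\<close> can be written as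
\<open>(K, m) (B, l) = \<kappa> (B', l')\<close>. Clearing the inverse of \<open>K\<close> in both components turns this into the
condition of \<open>Osc_iso_iff\<close> with \<open>e = \<kappa>\<close>.\<close>

lemma mem_orbit_iff_iso:
  assumes r: "r \<ge> 1" and B: "B \<in> SL2_trace T" "B' \<in> SL2_trace T"
  shows "(B', residue_class r l') \<in> orbit acting_group (osc_act r T) (B, residue_class r l) \<longleftrightarrow>
    Osc r B l \<cong> Osc r B' l'"
proof -
  have BB: "B \<in> SL2_trace_gt2" "B' \<in> SL2_trace_gt2" using B by (auto simp: SL2_trace_def)
  then have inv: "invertible B" "invertible B'" by (auto simp: SL2_trace_gt2_def SL2_minv)
  let ?x = "(B, residue_class r l)" and ?y = "(B', residue_class r l')"
  have xE: "?x \<in> SL2_trace T \<times> residue_plane r" using B by (simp add: residue_plane_def)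
  have step: "osc_act r T (e, K, m) ?x = ?y \<longleftrightarrow>
      K ** B = (if e = 1 then B' else matrix_inv B') ** K \<and>
      vec_cong r (matrix_inv B *v m + l) (matrix_inv K *v (if e = 1 then l' else - (B' *v l')) + m)"
    if e: "e \<in> {1, -1}" and K: "invertible K" for e :: int and K m
  proof -
    let ?P = "if e = 1 then B' else matrix_inv B'" and ?q = "if e = 1 then l' else - (B' *v l')"
    let ?z = "aff_act (K, m) ?x"
    have iz: "invertible (fst ?z)"
      using K inv by (simp add: aff_act_def minv_mult invertible_minv)
    have e': "e \<in> carrier sign_img" using e by (auto simp: sign_img_def)
    have ee: "e * e = 1" using e by auto
    have s1: "sign_act (1 :: int) w = w" for w by (cases w) (simp add: sign_act_def)
    have "osc_act r T (e, K, m) ?x = sign_act e ?z"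
      using xE by (simp only: osc_act_def case_prod_conv restrict_apply if_True)
    also have "sign_act e ?z = ?y \<longleftrightarrow> ?z = sign_act e ?y"
      using sign_act_mult[OF e' e' iz] sign_act_mult[OF e' e', of ?y] inv(2) by (auto simp: ee s1)
    also have "sign_act e ?y = (?P, residue_class r ?q)"
      using e by (auto simp: sign_act_residue_class[OF inv(2)])
    also have "?z = (K ** B ** matrix_inv K, residue_class r (K *v (l - (mat 1 - matrix_inv B) *v m)))"
      by (rule aff_act_residue_class[OF K])
    also have "(K ** B ** matrix_inv K, residue_class r (K *v (l - (mat 1 - matrix_inv B) *v m))) = (?P, residue_class r ?q)
      \<longleftrightarrow> K ** B ** matrix_inv K = ?P \<and> vec_cong r (K *v (l - (mat 1 - matrix_inv B) *v m)) ?q"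
      by (simp only: prod.inject residue_class_eq_iff)
    also have "K ** B ** matrix_inv K = ?P \<longleftrightarrow> K ** B = ?P ** K"
    proof
      assume "K ** B ** matrix_inv K = ?P"
      then have "K ** B ** (matrix_inv K ** K) = ?P ** K" by (simp only: matrix_mul_assoc)
      then show "K ** B = ?P ** K" by (simp only: minv(2)[OF K] matrix_mul_rid)
    next
      assume eq: "K ** B = ?P ** K"
      show "K ** B ** matrix_inv K = ?P" unfolding eq using minv(1)[OF K] by (simp flip: matrix_mul_assoc)
    qed
    also have "vec_cong r (K *v (l - (mat 1 - matrix_inv B) *v m)) ?q \<longleftrightarrow>
        vec_cong r (l - (mat 1 - matrix_inv B) *v m) (matrix_inv K *v ?q)"
      using vec_cong_mv[of r "K *v (l - (mat 1 - matrix_inv B) *v m)" ?q "matrix_inv K"]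
        vec_cong_mv[of r "l - (mat 1 - matrix_inv B) *v m" "matrix_inv K *v ?q" K]
      unfolding minv_mv[OF K] by blast
    also have "\<dots> \<longleftrightarrow> vec_cong r (matrix_inv B *v m + l) (matrix_inv K *v ?q + m)"
      using vec_cong_add_right[of r "l - (mat 1 - matrix_inv B) *v m" m "matrix_inv K *v ?q"]
      by (simp add: matrix_vector_mult_diff_rdistrib algebra_simps)
    finally show ?thesis .
  qed
  have carrier: "carrier acting_group = {(e, K, m) | e K m. e \<in> {1, -1 :: int} \<and> invertible K}"
    by (auto simp: DirProd_def sign_img_def GL2_Z2_def)
  have "?y \<in> orbit acting_group (osc_act r T) ?x \<longleftrightarrow>
      (\<exists>K m. \<exists>e\<in>{1, -1 :: int}. invertible K \<and> osc_act r T (e, K, m) ?x = ?y)"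
  proof
    assume "?y \<in> orbit acting_group (osc_act r T) ?x"
    then have "\<exists>g. ?y = osc_act r T g ?x \<and> g \<in> carrier acting_group"
      by (simp only: orbit_def mem_Collect_eq)
    then obtain g where "g \<in> carrier acting_group" and y: "osc_act r T g ?x = ?y"
      by (elim exE conjE) simp
    then obtain e K m where "g = (e, K, m)" "e \<in> {1, -1}" "invertible K" unfolding carrier by blast
    then show "\<exists>K m. \<exists>e\<in>{1, -1 :: int}. invertible K \<and> osc_act r T (e, K, m) ?x = ?y" using y by blast
  next
    assume "\<exists>K m. \<exists>e\<in>{1, -1 :: int}. invertible K \<and> osc_act r T (e, K, m) ?x = ?y"
    then obtain K m e where "e \<in> {1, -1 :: int}" "invertible K" and y: "osc_act r T (e, K, m) ?x = ?y" by blast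
    then have "(e, K, m) \<in> carrier acting_group" unfolding carrier by blast
    then show "?y \<in> orbit acting_group (osc_act r T) ?x" unfolding orbit_def y[symmetric] by blast
  qed
  also have "\<dots> \<longleftrightarrow> Osc r B l \<cong> Osc r B' l'"
    unfolding Osc_iso_iff[OF r r BB] using step by (simp del: insert_iff cong: conj_cong)
  finally show ?thesis .
qed

lemma orbit_eq_iff_iso:
  assumes r: "r \<ge> 1" and x: "B \<in> SL2_trace T" "L \<in> residue_plane r" "l \<in> L"
    and y: "B' \<in> SL2_trace T" "L' \<in> residue_plane r" "l' \<in> L'"
  shows "orbit acting_group (osc_act r T) (B, L) = orbit acting_group (osc_act r T) (B', L') \<longleftrightarrow>
    Osc r B l \<cong> Osc r B' l'"
proof -
  interpret group_action acting_group "SL2_trace T \<times> residue_plane r" "osc_act r T"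
    by (rule osc_group_action)
  let ?O = "orbit acting_group (osc_act r T)"
  have E: "(B, L) \<in> SL2_trace T \<times> residue_plane r" "(B', L') \<in> SL2_trace T \<times> residue_plane r" using x y by auto
  have "?O (B, L) = ?O (B', L') \<longleftrightarrow> (B', L') \<in> ?O (B, L)"
  proof
    assume "?O (B, L) = ?O (B', L')"
    then show "(B', L') \<in> ?O (B, L)" using orbit_refl[OF E(2)] by simp
  next
    assume "(B', L') \<in> ?O (B, L)"
    moreover have "(B', L') \<in> ?O (B', L')" by (rule orbit_refl[OF E(2)])
    moreover have "?O (B, L) \<in> orbits acting_group (SL2_trace T \<times> residue_plane r) (osc_act r T)"
      "?O (B', L') \<in> orbits acting_group (SL2_trace T \<times> residue_plane r) (osc_act r T)"
      using E by (auto simp: orbits_def)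
    ultimately show "?O (B, L) = ?O (B', L')" using disjoint_union by blast
  qed
  also have "\<dots> \<longleftrightarrow> Osc r B l \<cong> Osc r B' l'"
    using mem_orbit_iff_iso[OF r x(1) y(1), of l' l] residue_plane_class[OF x(2,3)] residue_plane_class[OF y(2,3)] by simp
  finally show ?thesis .
qed

text \<open>Orbits and isomorphism classes determine each other by \<open>orbit_eq_iff_iso\<close>, so the class of an
arbitrary member of the orbit defines \<open>F\<close>, and \<open>F\<close> is injective.\<close>

theorem orbit_bijection:
  assumes r: "r \<ge> 1"
  shows "\<exists>F. (\<forall>B\<in>SL2_trace T. \<forall>L\<in>residue_plane r. \<forall>l\<in>L.
           F (orbit acting_group (osc_act r T) (B, L)) = iso_class (Osc r B l)) \<and>
        bij_betw F (orbits acting_group (SL2_trace T \<times> residue_plane r) (osc_act r T)) (osc_classes_rT r T)"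
proof -
  let ?O = "orbit acting_group (osc_act r T)"
  let ?rep = "\<lambda>O' C. \<exists>B\<in>SL2_trace T. \<exists>L\<in>residue_plane r. \<exists>l\<in>L. O' = ?O (B, L) \<and> C = iso_class (Osc r B l)"
  have gt: "B \<in> SL2_trace_gt2" if "B \<in> SL2_trace T" for B using that by (simp add: SL2_trace_def)
  have eq: "?O (B, L) = ?O (B', L') \<longleftrightarrow> iso_class (Osc r B l) = iso_class (Osc r B' l')"
    if "B \<in> SL2_trace T" "L \<in> residue_plane r" "l \<in> L" "B' \<in> SL2_trace T" "L' \<in> residue_plane r" "l' \<in> L'"
    for B L l B' L' l'
    using orbit_eq_iff_iso[OF r that] iso_class_Osc_eq_iff[OF gt gt] that by simp
  define F where "F O' = (SOME C. ?rep O' C)" for O'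
  have F: "F (?O (B, L)) = iso_class (Osc r B l)"
    if x: "B \<in> SL2_trace T" "L \<in> residue_plane r" "l \<in> L" for B L l
  proof -
    have "?rep (?O (B, L)) (F (?O (B, L)))"
      unfolding F_def by (rule someI[of _ "iso_class (Osc r B l)"]) (use x in blast)
    then show ?thesis using eq[OF x] by metis
  qed
  have ne: "\<exists>l. l \<in> L" if "L \<in> residue_plane r" for L
    using that residue_class_self by (auto simp: residue_plane_def)
  have "bij_betw F (orbits acting_group (SL2_trace T \<times> residue_plane r) (osc_act r T)) (osc_classes_rT r T)"
  proof (rule bij_betw_imageI)
    show "inj_on F (orbits acting_group (SL2_trace T \<times> residue_plane r) (osc_act r T))"
    proof (rule inj_onI)
      fix X Y assume "X \<in> orbits acting_group (SL2_trace T \<times> residue_plane r) (osc_act r T)"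
        "Y \<in> orbits acting_group (SL2_trace T \<times> residue_plane r) (osc_act r T)" and XY: "F X = F Y"
      then obtain B L B' L' where X: "X = ?O (B, L)" "B \<in> SL2_trace T" "L \<in> residue_plane r"
        and Y: "Y = ?O (B', L')" "B' \<in> SL2_trace T" "L' \<in> residue_plane r" by (auto simp: orbits_def)
      obtain l l' where l: "l \<in> L" "l' \<in> L'" using ne[OF X(3)] ne[OF Y(3)] by blast
      have "iso_class (Osc r B l) = iso_class (Osc r B' l')"
        using XY F[OF X(2,3) l(1)] F[OF Y(2,3) l(2)] unfolding X(1) Y(1) by simp
      then show "X = Y" unfolding X(1) Y(1) using eq[OF X(2,3) l(1) Y(2,3) l(2)] by blast
    qed
    show "F ` orbits acting_group (SL2_trace T \<times> residue_plane r) (osc_act r T) = osc_classes_rT r T"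
    proof (intro equalityI subsetI)
      fix C assume "C \<in> F ` orbits acting_group (SL2_trace T \<times> residue_plane r) (osc_act r T)"
      then obtain B L where C: "C = F (?O (B, L))" and B: "B \<in> SL2_trace T" "L \<in> residue_plane r"
        by (auto simp: orbits_def)
      obtain l where "l \<in> L" using ne[OF B(2)] by blast
      then have "C = iso_class (Osc r B l)" using F[OF B] C by simp
      then show "C \<in> osc_classes_rT r T" unfolding osc_classes_rT_eq[OF r] using B(1) by blast
    next
      fix C assume "C \<in> osc_classes_rT r T"
      then obtain B l where B: "B \<in> SL2_trace T" and C: "C = iso_class (Osc r B l)"
        by (auto simp: osc_classes_rT_eq[OF r])
      have L: "residue_class r l \<in> residue_plane r" by (simp add: residue_plane_def)
      have "C = F (?O (B, residue_class r l))" using F[OF B L residue_class_self] C by simp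
      then show "C \<in> F ` orbits acting_group (SL2_trace T \<times> residue_plane r) (osc_act r T)"
        using B L by (auto simp: orbits_def)
    qed
  qed
  then show ?thesis using F by blast
qed

theorem proposition5p3:
  shows
    "(\<forall>r\<ge>1. \<forall>r'\<ge>1. \<forall>B\<in>SL2_trace_gt2. \<forall>B'\<in>SL2_trace_gt2. \<forall>l l'.
        Osc r B l \<cong> Osc r' B' l' \<longrightarrow> r = r' \<and> trace B = trace B')
     \<and>
     (osc_classes = (\<Union>r\<in>{1..}. \<Union>T\<in>{3..}. osc_classes_rT r T) \<and>
      disjoint_family_on (\<lambda>(r, T). osc_classes_rT r T) ({1..} \<times> {3..}))
     \<and>
     (\<forall>r\<ge>1. \<forall>T\<ge>3. \<exists>F.
        (\<forall>B\<in>SL2_trace T. \<forall>L\<in>residue_plane r. \<forall>l\<in>L.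
           F (orbit acting_group (osc_act r T) (B, L)) = iso_class (Osc r B l)) \<and>
        bij_betw F (orbits acting_group (SL2_trace T \<times> residue_plane r) (osc_act r T))
          (osc_classes_rT r T))"
proof (intro conjI)
  show "\<forall>r\<ge>1. \<forall>r'\<ge>1. \<forall>B\<in>SL2_trace_gt2. \<forall>B'\<in>SL2_trace_gt2. \<forall>l l'.
      Osc r B l \<cong> Osc r' B' l' \<longrightarrow> r = r' \<and> trace B = trace B'"
  proof (intro allI ballI impI)
    fix r r' :: nat and B B' l l'
    assume "1 \<le> r" "1 \<le> r'" "B \<in> SL2_trace_gt2" "B' \<in> SL2_trace_gt2" "Osc r B l \<cong> Osc r' B' l'"
    from Osc_iso_invariants[OF this] show "r = r' \<and> trace B = trace B'" ..
  qed
  show "osc_classes = (\<Union>r\<in>{1..}. \<Union>T\<in>{3..}. osc_classes_rT r T)" by (rule osc_classes_eq)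
  show "disjoint_family_on (\<lambda>(r, T). osc_classes_rT r T) ({1..} \<times> {3..})"
    by (rule osc_classes_rT_disjoint)
  show "\<forall>r\<ge>1. \<forall>T\<ge>3. \<exists>F.
      (\<forall>B\<in>SL2_trace T. \<forall>L\<in>residue_plane r. \<forall>l\<in>L.
         F (orbit acting_group (osc_act r T) (B, L)) = iso_class (Osc r B l)) \<and>
      bij_betw F (orbits acting_group (SL2_trace T \<times> residue_plane r) (osc_act r T))
        (osc_classes_rT r T)"
    by (intro allI impI) (rule orbit_bijection)
qed

end
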